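(* Let $\alpha\ge -\tfrac12$ and $d_\alpha=2\alpha+2$. Let $\phi,\psi:(0,\infty)\to(0,\infty)$ satisfy the doubling condition, and assume that $\phi(r)r^{d_\alpha}$ and $\psi(r)r^{d_\alpha}$ are almost increasing. Let $\rho:(0,\infty)\to(0,\infty)$ satisfy: (a) $\int_0^1\frac{\rho(t)}{t}dt<\infty$; (b) the doubling condition; (c) there is $C_1'>0$ with $\int_r^\infty\frac{\rho(t)}{t^2}dt\le C_1'\frac{\rho(r)}{r}$ for all $r>0$; (d) there is $C_1''>0$ such that $\frac12\le\frac rs\le2$ implies $\big|\frac{\rho(r)}{r^{d_\alpha}}-\frac{\rho(s)}{s^{d_\alpha}}\big|\le C_1''|r-s|\frac{\rho(s)}{s^{d_\alpha+1}}$. Assume there exists $C>0$ such that for all $r>0$, $$\phi(r)\int_0^r\frac{\rho(t)}{t}dt+r\int_r^\infty\frac{\rho(t)\phi(t)}{t^2}dt\le C\psi(r).$$ Then the modified operator $\tilde T^\alpha_\rho$ is bounded from $L^{1,\phi}(\mathbb{R},d\mu_\alpha)$ to $\mathcal{L}^{1,\psi}(\mathbb{R},d\mu_\alpha)$.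
   Context: Dunkl setting on $\mathbb{R}$: fix $\alpha\ge-\frac12$, $d_\alpha=2\alpha+2$, $d\mu_\alpha(x)=A_\alpha|x|^{2\alpha+1}dx$ with $A_\alpha=(2^{\alpha+1}\Gamma(\alpha+1))^{-1}$; $B(0,r)=(-r,r)$, $B_0=B(0,1)$. For $x,y,z\in\mathbb{R}$ let $\sigma_{x,y,z}=\frac{x^2+y^2-z^2}{2xy}$ if $x,y\neq0$ and $0$ otherwise; let $\kappa_\alpha(|x|,|y|,|z|)=D_\alpha\frac{([(|x|+|y|)^2-z^2][z^2-(|x|-|y|)^2])^{\alpha-1/2}}{|xyz|^{2\alpha}}$ if $|z|\in[\,||x|-|y||,|x|+|y|\,]$ and $0$ otherwise, where $D_\alpha=\Gamma(\alpha+1)^2/(2^{\alpha-1}\sqrt\pi\,\Gamma(\alpha+\frac12))$; let $W_\alpha(x,y,z)=(1-\sigma_{x,y,z}+\sigma_{z,x,y}+\sigma_{z,y,x})\kappa_\alpha(|x|,|y|,|z|)$. The Dunkl translation is $\tau_x^\alpha f(y)=\int_{\mathbb{R}}f(z)W_\alpha(x,y,z)\,d\mu_\alpha(z)$ for $x,y\neq0$, $\tau_x^\alpha f(0)=f(x)$, $\tau_0^\alpha f(y)=f(y)$ (extended to locally integrable functions in the usual way). $\theta:(0,\infty)\to(0,\infty)$ satisfies the doubling condition if there is $C>0$ with $\frac1{C}\le\frac{\theta(r)}{\theta(s)}\le C$ whenever $\frac12\le\frac rs\le2$; it is almost increasing if there is $C>0$ with $\theta(r)\le C\theta(s)$ for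 $r\le s$. For $1\le p<\infty$: the Morrey space $L^{p,\phi}(\mathbb{R},d\mu_\alpha)$ consists of locally $p$-integrable $f$ with $\|f\|_{L^{p,\phi}}:=\sup_{r>0,x\in\mathbb{R}}\frac1{\phi(r)}\big(\frac1{r^{d_\alpha}}\int_{B(0,r)}\tau^\alpha_x|f|^p(y)d\mu_\alpha(y)\big)^{1/p}<\infty$; the Campanato space $\mathcal{L}^{p,\phi}(\mathbb{R},d\mu_\alpha)$ consists of locally integrable $f$ with $\|f\|_{\mathcal{L}^{p,\phi}}:=\sup_{r>0,x\in\mathbb{R}}\frac1{\phi(r)}\big(\frac1{\mu_\alpha(B(0,r))}\int_{B(0,r)}|\tau^\alpha_xf(y)-f^\alpha_{B(0,r)}(x)|^pd\mu_\alpha(y)\big)^{1/p}<\infty$, where $f^\alpha_{B(0,r)}(x)=\frac1{\mu_\alpha(B(0,r))}\int_{B(0,r)}\tau_x^\alpha f(y)d\mu_\alpha(y)$. The modified generalized Dunkl-type fractional integral operator is $\tilde T^\alpha_\rho f(x)=\int_{\mathbb{R}}f(y)\Big(\tau_x^\alpha\Big(\frac{\rho(|\cdot|)}{|\cdot|^{d_\alpha}}\Big)(y)-\frac{\rho(|y|)}{|y|^{d_\alpha}}(1-\chi_{B_0}(y))\Big)d\mu_\alpha(y)$. *)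

theory Defs
  imports "HOL-Analysis.Analysis"
begin

definition d_alpha :: "real \<Rightarrow> real" where
  "d_alpha \<alpha> = 2 * \<alpha> + 2"

definition A_alpha :: "real \<Rightarrow> real" where
  "A_alpha \<alpha> = 1 / (2 powr (\<alpha> + 1) * Gamma (\<alpha> + 1))"

definition mu_alpha :: "real \<Rightarrow> real measure" where
  "mu_alpha \<alpha> = density lborel (\<lambda>x. ennreal (A_alpha \<alpha> * \<bar>x\<bar> powr (2 * \<alpha> + 1)))"

definition D_alpha :: "real \<Rightarrow> real" where
  "D_alpha \<alpha> = Gamma (\<alpha> + 1) ^ 2 / (2 powr (\<alpha> - 1) * sqrt pi * Gamma (\<alpha> + 1 / 2))"

definition sigma_dk :: "real \<Rightarrow> real \<Rightarrow> real \<Rightarrow> real" where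
  "sigma_dk x y z = (if x \<noteq> 0 \<and> y \<noteq> 0 then (x^2 + y^2 - z^2) / (2 * x * y) else 0)"

definition kappa_alpha :: "real \<Rightarrow> real \<Rightarrow> real \<Rightarrow> real \<Rightarrow> real" where
  "kappa_alpha \<alpha> x y z =
     (if \<bar>\<bar>x\<bar> - \<bar>y\<bar>\<bar> \<le> \<bar>z\<bar> \<and> \<bar>z\<bar> \<le> \<bar>x\<bar> + \<bar>y\<bar> then
        D_alpha \<alpha> * ((((\<bar>x\<bar> + \<bar>y\<bar>)^2 - z^2) * (z^2 - (\<bar>x\<bar> - \<bar>y\<bar>)^2)) powr (\<alpha> - 1/2))
          / (\<bar>x * y * z\<bar> powr (2 * \<alpha>))
      else 0)"

definition W_alpha :: "real \<Rightarrow> real \<Rightarrow> real \<Rightarrow> real \<Rightarrow> real" where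
  "W_alpha \<alpha> x y z =
     (1 - sigma_dk x y z + sigma_dk z x y + sigma_dk z y x) * kappa_alpha \<alpha> x y z"

text \<open>Dunkl translation tau_x f (y).  For alpha = -1/2 (Dunkl parameter 0) the
  Dunkl translation is the classical translation f(x+y); the integral formula is
  the one for alpha > -1/2.\<close>
definition dunkl_trans :: "real \<Rightarrow> real \<Rightarrow> (real \<Rightarrow> real) \<Rightarrow> real \<Rightarrow> real" where
  "dunkl_trans \<alpha> x f y =
     (if \<alpha> = -1/2 then f (x + y)
      else if x = 0 then f y
      else if y = 0 then f x
      else (LINT z|mu_alpha \<alpha>. f z * W_alpha \<alpha> x y z))"

definition doubling :: "(real \<Rightarrow> real) \<Rightarrow> bool" where
  "doubling \<theta> \<longleftrightarrow> (\<exists>C>0. \<forall>r>0. \<forall>s>0. 1/2 \<le> r / s \<and> r / s \<le> 2 \<longrightarrow>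
       1 / C \<le> \<theta> r / \<theta> s \<and> \<theta> r / \<theta> s \<le> C)"

definition almost_increasing :: "(real \<Rightarrow> real) \<Rightarrow> bool" where
  "almost_increasing \<theta> \<longleftrightarrow> (\<exists>C>0. \<forall>r>0. \<forall>s>0. r \<le> s \<longrightarrow> \<theta> r \<le> C * \<theta> s)"

definition loc_integrable_dk :: "real \<Rightarrow> (real \<Rightarrow> real) \<Rightarrow> bool" where
  "loc_integrable_dk \<alpha> f \<longleftrightarrow> (\<forall>r>0. set_integrable (mu_alpha \<alpha>) {-r<..<r} f)"

definition morrey1_quant :: "real \<Rightarrow> (real \<Rightarrow> real) \<Rightarrow> (real \<Rightarrow> real) \<Rightarrow> real \<Rightarrow> real \<Rightarrow> real" where
  "morrey1_quant \<alpha> \<phi> f r x =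
     1 / \<phi> r * (1 / r powr d_alpha \<alpha> *
       (LINT y:{-r<..<r}|mu_alpha \<alpha>. dunkl_trans \<alpha> x (\<lambda>z. \<bar>f z\<bar>) y))"

definition morrey1_space :: "real \<Rightarrow> (real \<Rightarrow> real) \<Rightarrow> (real \<Rightarrow> real) set" where
  "morrey1_space \<alpha> \<phi> = {f. loc_integrable_dk \<alpha> f \<and>
      bdd_above {morrey1_quant \<alpha> \<phi> f r x | r x. r > 0}}"

definition morrey1_norm :: "real \<Rightarrow> (real \<Rightarrow> real) \<Rightarrow> (real \<Rightarrow> real) \<Rightarrow> real" where
  "morrey1_norm \<alpha> \<phi> f = Sup {morrey1_quant \<alpha> \<phi> f r x | r x. r > 0}"

definition ball_avg_dk :: "real \<Rightarrow> (real \<Rightarrow> real) \<Rightarrow> real \<Rightarrow> real \<Rightarrow> real" where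
  "ball_avg_dk \<alpha> f r x =
     1 / measure (mu_alpha \<alpha>) {-r<..<r} *
       (LINT y:{-r<..<r}|mu_alpha \<alpha>. dunkl_trans \<alpha> x f y)"

definition campanato1_quant :: "real \<Rightarrow> (real \<Rightarrow> real) \<Rightarrow> (real \<Rightarrow> real) \<Rightarrow> real \<Rightarrow> real \<Rightarrow> real" where
  "campanato1_quant \<alpha> \<phi> f r x =
     1 / \<phi> r * (1 / measure (mu_alpha \<alpha>) {-r<..<r} *
       (LINT y:{-r<..<r}|mu_alpha \<alpha>. \<bar>dunkl_trans \<alpha> x f y - ball_avg_dk \<alpha> f r x\<bar>))"

definition campanato1_space :: "real \<Rightarrow> (real \<Rightarrow> real) \<Rightarrow> (real \<Rightarrow> real) set" where
  "campanato1_space \<alpha> \<phi> = {f. loc_integrable_dk \<alpha> f \<and>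
      bdd_above {campanato1_quant \<alpha> \<phi> f r x | r x. r > 0}}"

definition campanato1_norm :: "real \<Rightarrow> (real \<Rightarrow> real) \<Rightarrow> (real \<Rightarrow> real) \<Rightarrow> real" where
  "campanato1_norm \<alpha> \<phi> f = Sup {campanato1_quant \<alpha> \<phi> f r x | r x. r > 0}"

definition modT :: "real \<Rightarrow> (real \<Rightarrow> real) \<Rightarrow> (real \<Rightarrow> real) \<Rightarrow> real \<Rightarrow> real" where
  "modT \<alpha> \<rho> f x =
     (LINT y|mu_alpha \<alpha>. f y *
        (dunkl_trans \<alpha> x (\<lambda>z. \<rho> \<bar>z\<bar> / \<bar>z\<bar> powr d_alpha \<alpha>) y
         - \<rho> \<bar>y\<bar> / \<bar>y\<bar> powr d_alpha \<alpha> * (1 - indicator {-1<..<1} y)))"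

end

(*
A Dunkl translate of an even function is an average over the angle: with
s = sqrt (x^2 + y^2 + 2 x y t), tau_x K (y) is the integral of K(s) against a probability
measure in t on [-1,1] (a point mass at t = 1 when alpha = -1/2).  By duality the Morrey condition
bounds the mass of |f| on {s < u}, averaged over t, by a multiple of phi(u) u^d; letting x run
over x and -x, it bounds the mass of |f| on the annuli | |y| - |x| | < r.

Since |s(x,y,t) - s(x',y,t)| <= |x - x'|, the regularity of the kernel compares the tails
{s >= r} of the operator at two points at distance D >= r, with an error of order
D * INT_r^oo rho phi / t^2.  The part {s < r} is controlled in mean over an annulus by
phi(r) * INT_0^r rho / t.

No product formula for iterated translations is needed.  The signed kernel W(x,y,z) with |y| < r
lives on | |z| - |x| | < r and has total mass one, and for z of the sign opposite to x it carries
an extra factor r / (|x| + r).  This factor compensates the distance D = 2(|x| + r) at which the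
operator has to be compared between x and such a z.
*)
theory Submission
  imports Defs "HOL-Probability.Giry_Monad"
begin

section \<open>The angular variable and the measure\<close>

text \<open>The translation kernel is signed, the operator need not converge at every point, and a
  divergent Bochner integral is silently 0. The estimates therefore concern nonnegative integrals in
  \<open>ennreal\<close>: where a bound is infinite the claim is trivial, and where it is finite it
  supplies the integrability needed to split an integral. The recurring factor (r / (|x| + r)) powr
  (2 \<alpha> + 1) is, up to constants, the mass r^d of the ball of radius r about 0 divided by the
  mass r (|x| + r) powr (2 \<alpha> + 1) of the annulus of half-width r about |x|. It is also the
  measure of a sector: for x y \<le> 0 and |x| large against r, a radius below r forces 1 - t to be
  of order (r / |x|)^2, and the angular weight behaves like (1 - t) powr (\<alpha> - 1/2). The mean
  of a translate is never computed: oscillation is measured from the value at x of the operator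
  whose kernel is cut off at radius r, and passing to the mean costs a factor 2. The case \<alpha> =
  -1/2 stands apart because \<open>D_alpha\<close> then contains Gamma at the pole 0.\<close>

definition rad :: "real \<Rightarrow> real \<Rightarrow> real \<Rightarrow> real" where
  "rad x y t = sqrt (x\<^sup>2 + y\<^sup>2 + 2 * x * y * t)"

lemma rad_arg_nonneg:
  fixes x y t :: real assumes "\<bar>t\<bar> \<le> 1" shows "0 \<le> x\<^sup>2 + y\<^sup>2 + 2 * x * y * t"
proof -
  have "\<bar>x * y * t\<bar> \<le> \<bar>x * y\<bar> * 1" unfolding abs_mult[of "x*y"] by (intro mult_left_mono) (use assms in auto)
  moreover have "0 \<le> (\<bar>x\<bar> - \<bar>y\<bar>)\<^sup>2" by simp
  moreover have "(\<bar>x\<bar> - \<bar>y\<bar>)\<^sup>2 = x\<^sup>2 + y\<^sup>2 - 2 * \<bar>x * y\<bar>" by (simp add: power2_diff abs_mult)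
  ultimately show ?thesis by linarith
qed

lemma rad_sq: "\<bar>t\<bar> \<le> 1 \<Longrightarrow> (rad x y t)\<^sup>2 = x\<^sup>2 + y\<^sup>2 + 2 * x * y * t"
  by (simp add: rad_def rad_arg_nonneg)

lemma rad_nonneg: "\<bar>t\<bar> \<le> 1 \<Longrightarrow> 0 \<le> rad x y t"
  by (simp add: rad_def rad_arg_nonneg)

lemma rad_zero: "rad 0 y t = \<bar>y\<bar>" "rad x 0 t = \<bar>x\<bar>"
  by (simp_all add: rad_def)

lemma rad_one: "rad x y 1 = \<bar>x + y\<bar>"
proof -
  have "x\<^sup>2 + y\<^sup>2 + 2 * x * y * 1 = (x + y)\<^sup>2" by (simp add: power2_sum)
  then show ?thesis by (simp add: rad_def)
qed

text \<open>The radicand is extremal at x y t = -|x y| and x y t = |x y|, where it is a perfect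
  square.\<close>

lemma rad_bounds:
  assumes "\<bar>t\<bar> \<le> 1" shows "\<bar>\<bar>x\<bar> - \<bar>y\<bar>\<bar> \<le> rad x y t" "rad x y t \<le> \<bar>x\<bar> + \<bar>y\<bar>"
proof -
  have "\<bar>x * y * t\<bar> \<le> \<bar>x * y\<bar>" unfolding abs_mult[of "x*y"] using mult_left_mono[OF assms, of "\<bar>x*y\<bar>"] by simp
  then have a: "x * y * t \<le> \<bar>x * y\<bar>" "- \<bar>x * y\<bar> \<le> x * y * t" by linarith+
  have b: "(\<bar>x\<bar> - \<bar>y\<bar>)\<^sup>2 = x\<^sup>2 + y\<^sup>2 - 2 * \<bar>x * y\<bar>" "(\<bar>x\<bar> + \<bar>y\<bar>)\<^sup>2 = x\<^sup>2 + y\<^sup>2 + 2 * \<bar>x * y\<bar>"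
    by (simp_all add: power2_diff power2_sum abs_mult)
  have "\<bar>\<bar>x\<bar> - \<bar>y\<bar>\<bar>\<^sup>2 \<le> (rad x y t)\<^sup>2" using a b unfolding rad_sq[OF assms] power2_abs by linarith
  then show "\<bar>\<bar>x\<bar> - \<bar>y\<bar>\<bar> \<le> rad x y t" by (rule power2_le_imp_le) (rule rad_nonneg[OF assms])
  have "(rad x y t)\<^sup>2 \<le> (\<bar>x\<bar> + \<bar>y\<bar>)\<^sup>2" using a b unfolding rad_sq[OF assms] power2_abs by linarith
  then show "rad x y t \<le> \<bar>x\<bar> + \<bar>y\<bar>" by (rule power2_le_imp_le) simp
qed

text \<open>With \<open>t = cos \<theta>\<close>, \<open>rad x y t\<close> is the distance from \<open>x\<close> to \<open>- y e\<^bsup>i\<theta>\<^esup>\<close>.\<close>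
lemma rad_lipschitz:
  assumes "\<bar>t\<bar> \<le> 1" shows "\<bar>rad x y t - rad x' y t\<bar> \<le> \<bar>x - x'\<bar>"
proof -
  have t2: "t\<^sup>2 \<le> 1" using assms by (simp add: abs_square_le_1)
  have r: "rad u y t = cmod (of_real u + of_real y * Complex t (sqrt (1 - t\<^sup>2)))" for u
  proof -
    have "(u + y * t)\<^sup>2 + (y * sqrt (1 - t\<^sup>2))\<^sup>2 = u\<^sup>2 + y\<^sup>2 + 2 * u * y * t"
      using t2 by (simp add: power_mult_distrib algebra_simps power2_eq_square)
    then show ?thesis by (simp add: cmod_def rad_def)
  qed
  show ?thesis unfolding r
    by (rule order_trans[OF norm_triangle_ineq3]) (simp add: norm_of_real flip: of_real_diff)
qed

lemma measurable_rad [measurable]: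
  assumes [measurable]: "f \<in> borel_measurable M" "g \<in> borel_measurable M" "h \<in> borel_measurable M"
  shows "(\<lambda>w. rad (f w) (g w) (h w)) \<in> borel_measurable M"
  unfolding rad_def by measurable

section \<open>The weighted measure: reflection, null sets, size of balls\<close>

lemma A_alpha_pos: "-1/2 \<le> \<alpha> \<Longrightarrow> 0 < A_alpha \<alpha>"
  unfolding A_alpha_def by (intro divide_pos_pos mult_pos_pos Gamma_real_pos) auto

lemma D_alpha_pos: "-1/2 < \<alpha> \<Longrightarrow> 0 < D_alpha \<alpha>"
  unfolding D_alpha_def
  by (intro divide_pos_pos mult_pos_pos zero_less_power Gamma_real_pos) auto

lemma sets_mu_alpha [measurable_cong, simp]: "sets (mu_alpha \<alpha>) = sets borel"
  by (simp add: mu_alpha_def)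

lemma space_mu_alpha [simp]: "space (mu_alpha \<alpha>) = UNIV"
  by (simp add: mu_alpha_def)

lemma sigma_finite_mu_alpha: "sigma_finite_measure (mu_alpha \<alpha>)"
  unfolding mu_alpha_def
  by (subst sigma_finite_measure.sigma_finite_iff_density_finite[OF sigma_finite_lborel]) auto

lemma nn_integral_mu_alpha:
  assumes [measurable]: "f \<in> borel_measurable borel"
  shows "(\<integral>\<^sup>+x. f x \<partial>mu_alpha \<alpha>) = (\<integral>\<^sup>+x. ennreal (A_alpha \<alpha> * \<bar>x\<bar> powr (2 * \<alpha> + 1)) * f x \<partial>lborel)"
  unfolding mu_alpha_def by (subst nn_integral_density) auto

text \<open>The density is even. This invariance is what permits replacing the Dunkl kernel by its
  even part in one variable.\<close>

lemma distr_mu_alpha_uminus: "distr (mu_alpha \<alpha>) borel uminus = mu_alpha \<alpha>"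
proof -
  have "distr (density lborel (\<lambda>x. ennreal (A_alpha \<alpha> * \<bar>- x\<bar> powr (2 * \<alpha> + 1)))) borel uminus
     = density (distr lborel borel uminus) (\<lambda>x. ennreal (A_alpha \<alpha> * \<bar>x\<bar> powr (2 * \<alpha> + 1)))"
    by (subst density_distr) auto
  then show ?thesis by (simp add: mu_alpha_def lborel_distr_uminus)
qed

lemma integral_mu_alpha_reflect:
  fixes f :: "real \<Rightarrow> real"
  assumes [measurable]: "f \<in> borel_measurable borel"
  shows "(\<integral>x. f (- x) \<partial>mu_alpha \<alpha>) = (\<integral>x. f x \<partial>mu_alpha \<alpha>)"
  by (subst (2) distr_mu_alpha_uminus[symmetric], subst integral_distr) auto

lemma integrable_mu_alpha_reflect:
  fixes f :: "real \<Rightarrow> real"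
  assumes "integrable (mu_alpha \<alpha>) f"
  shows "integrable (mu_alpha \<alpha>) (\<lambda>x. f (- x))"
proof -
  have "integrable (distr (mu_alpha \<alpha>) borel uminus) f" using assms by (simp add: distr_mu_alpha_uminus)
  then show ?thesis by (subst (asm) integrable_distr_eq) (use assms in \<open>auto dest: borel_measurable_integrable\<close>)
qed

text \<open>There are no atoms, so the exceptional branches of \<open>dunkl_trans\<close> at 0 and
  the singular set |y| = |z| of a translated kernel can be ignored.\<close>

lemma AE_mu_alpha_neq: "AE x in mu_alpha \<alpha>. x \<noteq> a"
  unfolding mu_alpha_def using AE_lborel_singleton[of a] by (subst AE_density) auto

lemma AE_mu_alpha_abs_neq: "AE x in mu_alpha \<alpha>. \<bar>x\<bar> \<noteq> a"
  using AE_mu_alpha_neq[of a \<alpha>] AE_mu_alpha_neq[of "-a" \<alpha>] by eventually_elim auto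

lemma emeasure_mu_alpha_upper:
  assumes "-1/2 \<le> \<alpha>" and [measurable]: "S \<in> sets borel" and "\<And>x. x \<in> S \<Longrightarrow> \<bar>x\<bar> \<le> R"
  shows "emeasure (mu_alpha \<alpha>) S \<le> ennreal (A_alpha \<alpha> * R powr (2 * \<alpha> + 1)) * emeasure lborel S"
proof -
  have "emeasure (mu_alpha \<alpha>) S = (\<integral>\<^sup>+x. ennreal (A_alpha \<alpha> * \<bar>x\<bar> powr (2 * \<alpha> + 1)) * indicator S x \<partial>lborel)"
    unfolding mu_alpha_def by (subst emeasure_density) auto
  also have "\<dots> \<le> (\<integral>\<^sup>+x. ennreal (A_alpha \<alpha> * R powr (2 * \<alpha> + 1)) * indicator S x \<partial>lborel)"
    using assms A_alpha_pos[OF assms(1)]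
    by (intro nn_integral_mono) (auto split: split_indicator intro!: ennreal_leI mult_left_mono powr_mono2)
  also have "\<dots> = ennreal (A_alpha \<alpha> * R powr (2 * \<alpha> + 1)) * emeasure lborel S"
    by (subst nn_integral_cmult_indicator) auto
  finally show ?thesis .
qed

lemma emeasure_mu_alpha_lower:
  assumes "-1/2 \<le> \<alpha>" and [measurable]: "S \<in> sets borel" and "0 \<le> R" and "\<And>x. x \<in> S \<Longrightarrow> R \<le> \<bar>x\<bar>"
  shows "ennreal (A_alpha \<alpha> * R powr (2 * \<alpha> + 1)) * emeasure lborel S \<le> emeasure (mu_alpha \<alpha>) S"
proof -
  have "ennreal (A_alpha \<alpha> * R powr (2 * \<alpha> + 1)) * emeasure lborel S
      = (\<integral>\<^sup>+x. ennreal (A_alpha \<alpha> * R powr (2 * \<alpha> + 1)) * indicator S x \<partial>lborel)"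
    by (subst nn_integral_cmult_indicator) auto
  also have "\<dots> \<le> (\<integral>\<^sup>+x. ennreal (A_alpha \<alpha> * \<bar>x\<bar> powr (2 * \<alpha> + 1)) * indicator S x \<partial>lborel)"
    using assms A_alpha_pos[OF assms(1)]
    by (intro nn_integral_mono) (auto split: split_indicator intro!: ennreal_leI mult_left_mono powr_mono2)
  also have "\<dots> = emeasure (mu_alpha \<alpha>) S"
    unfolding mu_alpha_def by (subst emeasure_density) auto
  finally show ?thesis .
qed

text \<open>Only comparability with r powr d is needed. The lower bound keeps just the interval from
  r/2 to r, where the density is at least its value at r/2; this is the origin of 2 powr (-
  d).\<close>

lemma emeasure_mu_alpha_ball:
  assumes "-1/2 \<le> \<alpha>" "0 < r"
  shows "emeasure (mu_alpha \<alpha>) {-r<..<r} < \<infinity>"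
    and "A_alpha \<alpha> * 2 powr (- d_alpha \<alpha>) * r powr d_alpha \<alpha> \<le> measure (mu_alpha \<alpha>) {-r<..<r}"
proof -
  have "emeasure (mu_alpha \<alpha>) {-r<..<r} \<le> ennreal (A_alpha \<alpha> * r powr (2 * \<alpha> + 1)) * emeasure lborel {-r<..<r}"
    by (intro emeasure_mu_alpha_upper) (use assms in auto)
  also have "\<dots> < \<infinity>" using assms by (simp add: ennreal_mult_less_top)
  finally show f: "emeasure (mu_alpha \<alpha>) {-r<..<r} < \<infinity>" .
  have "ennreal (A_alpha \<alpha> * 2 powr (- d_alpha \<alpha>) * r powr d_alpha \<alpha>)
     = ennreal (A_alpha \<alpha> * (r / 2) powr (2 * \<alpha> + 1)) * emeasure lborel {r/2<..<r}"
  proof -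
    have "(r / 2) powr (2 * \<alpha> + 1) * (r / 2) = (r / 2) powr (2 * \<alpha> + 2)"
      using assms powr_add[of "r/2" "2*\<alpha>+1" 1] by (simp add: add.commute)
    also have "\<dots> = 2 powr (- d_alpha \<alpha>) * r powr d_alpha \<alpha>"
      using assms unfolding d_alpha_def powr_minus_divide by (simp add: powr_divide)
    finally show ?thesis using assms A_alpha_pos[OF assms(1)]
      by (simp add: ennreal_mult[symmetric] mult.assoc)
  qed
  also have "\<dots> \<le> emeasure (mu_alpha \<alpha>) {r/2<..<r}"
    by (intro emeasure_mu_alpha_lower) (use assms in auto)
  also have "\<dots> \<le> emeasure (mu_alpha \<alpha>) {-r<..<r}"
    by (intro emeasure_mono) (use assms in auto)
  also have "\<dots> = ennreal (measure (mu_alpha \<alpha>) {-r<..<r})"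
    using f by (intro emeasure_eq_ennreal_measure) auto
  finally show "A_alpha \<alpha> * 2 powr (- d_alpha \<alpha>) * r powr d_alpha \<alpha> \<le> measure (mu_alpha \<alpha>) {-r<..<r}"
    by (simp add: ennreal_le_iff)
qed

section \<open>The translation kernel as an angular average\<close>

text \<open>The constant is the one that \<open>kappa_alpha\<close> and the density of \<open>mu_alpha\<close> leave behind after
  substituting \<open>z\<^sup>2 = x\<^sup>2 + y\<^sup>2 + 2 x y t\<close>; by Legendre duplication it normalises the mass to one.\<close>
definition gegw :: "real \<Rightarrow> real \<Rightarrow> real" where
  "gegw \<alpha> t = 2 * A_alpha \<alpha> * D_alpha \<alpha> * 4 powr (\<alpha> - 1/2) * (1 - t\<^sup>2) powr (\<alpha> - 1/2) * indicator {-1..1} t"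

definition geg :: "real \<Rightarrow> real measure" where
  "geg \<alpha> = density lborel (\<lambda>t. ennreal (gegw \<alpha> t))"

text \<open>The factor 1 + t is what 1 - \<open>sigma_dk\<close> becomes at z =
  \<open>rad x y t\<close>, where \<open>sigma_dk\<close> equals -t. Without it, \<open>geg\<close>
  is even in t. At \<alpha> = -1/2 the point mass at t = 1 reproduces the classical translation, the
  radius there being |x + y|.\<close>

definition ang :: "real \<Rightarrow> real measure" where
  "ang \<alpha> = (if \<alpha> = -1/2 then return borel 1
             else density lborel (\<lambda>t. ennreal ((1 + t) * gegw \<alpha> t)))"

lemma gegw_nonneg: "-1/2 < \<alpha> \<Longrightarrow> 0 \<le> gegw \<alpha> t"
  using A_alpha_pos[of \<alpha>] D_alpha_pos[of \<alpha>] by (simp add: gegw_def)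

lemma gegw_even: "gegw \<alpha> (- t) = gegw \<alpha> t"
  by (auto simp: gegw_def indicator_def)

lemma measurable_gegw [measurable]: "gegw \<alpha> \<in> borel_measurable borel"
  unfolding gegw_def[abs_def] by measurable

lemma sets_geg [measurable_cong, simp]: "sets (geg \<alpha>) = sets borel"
  by (simp add: geg_def)

lemma sets_ang [measurable_cong, simp]: "sets (ang \<alpha>) = sets borel"
  by (simp add: ang_def)

lemma space_ang [simp]: "space (ang \<alpha>) = UNIV" "space (geg \<alpha>) = UNIV"
  by (simp_all add: ang_def geg_def)

lemma AE_geg_abs_le: "AE t in geg \<alpha>. \<bar>t\<bar> \<le> 1"
  unfolding geg_def by (subst AE_density) (auto simp: gegw_def indicator_def)

text \<open>For |t| > 1 the radicand of \<open>rad\<close> can be negative, and \<open>sqrt\<close>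
  then returns a negative number. Bounds on radii are therefore used almost everywhere, on the
  support of the angular measure.\<close>

lemma AE_ang_abs_le: "AE t in ang \<alpha>. \<bar>t\<bar> \<le> 1"
proof (cases "\<alpha> = -1/2")
  case True then show ?thesis unfolding ang_def if_P[OF True] by (subst AE_return) auto
next
  case False then show ?thesis
    unfolding ang_def by (auto simp: AE_density gegw_def indicator_def)
qed

text \<open>Changing t to -t has the same effect on \<open>rad x y t\<close> as changing the sign of
  x, so averages over \<open>geg\<close> do not see the signs of the centres.\<close>

lemma nn_integral_geg_reflect:
  assumes [measurable]: "h \<in> borel_measurable borel"
  shows "(\<integral>\<^sup>+t. h (- t) \<partial>geg \<alpha>) = (\<integral>\<^sup>+t. h t \<partial>geg \<alpha>)"
proof -
  have "(\<integral>\<^sup>+t. ennreal (gegw \<alpha> t) * h t \<partial>lborel) = (\<integral>\<^sup>+t. ennreal (gegw \<alpha> (-t)) * h (-t) \<partial>lborel)"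
    by (subst nn_integral_real_affine[where c="-1" and t=0]) auto
  then show ?thesis unfolding geg_def by (simp add: nn_integral_density gegw_even)
qed

lemma nn_integral_ang:
  assumes [measurable]: "h \<in> borel_measurable borel" and a: "-1/2 < \<alpha>"
  shows "(\<integral>\<^sup>+t. h t \<partial>ang \<alpha>) = (\<integral>\<^sup>+t. ennreal (1 + t) * h t \<partial>geg \<alpha>)"
proof -
  \<comment> \<open>Where 1 + t is negative the weight \<open>gegw\<close> vanishes, so truncation
    at 0 by \<open>ennreal\<close> does no harm.\<close>
  have "ennreal ((1 + t) * gegw \<alpha> t) = ennreal (gegw \<alpha> t) * ennreal (1 + t)" for t
    by (cases "\<bar>t\<bar> \<le> 1")
       (auto simp: mult.commute gegw_nonneg[OF a] ennreal_mult[symmetric], auto simp: gegw_def indicator_def)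
  then show ?thesis using a unfolding ang_def geg_def
    by (simp add: nn_integral_density mult.assoc)
qed

lemma nn_integral_even:
  fixes F :: "real \<Rightarrow> ennreal"
  assumes [measurable]: "F \<in> borel_measurable borel" and even: "\<And>z. F (- z) = F z"
  shows "(\<integral>\<^sup>+z. F z \<partial>lborel) = (\<integral>\<^sup>+z. 2 * F z * indicator {0..} z \<partial>lborel)"
proof -
  have "(\<integral>\<^sup>+z. F z \<partial>lborel) = (\<integral>\<^sup>+z. F z * indicator {0..} z + F z * indicator {..0} z \<partial>lborel)"
    \<comment> \<open>Both half-lines contain 0, so the two integrands agree only off this null
      set.\<close>
    using AE_lborel_singleton[of 0] by (intro nn_integral_cong_AE) (auto split: split_indicator)
  also have "\<dots> = (\<integral>\<^sup>+z. F z * indicator {0..} z \<partial>lborel) + (\<integral>\<^sup>+z. F z * indicator {..0} z \<partial>lborel)"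
    by (rule nn_integral_add) auto
  also have "(\<integral>\<^sup>+z. F z * indicator {..0} z \<partial>lborel) = (\<integral>\<^sup>+z. F (-z) * indicator {..0} (-z) \<partial>lborel)"
    by (subst nn_integral_real_affine[where c="-1" and t=0]) auto
  also have "\<dots> = (\<integral>\<^sup>+z. F z * indicator {0..} z \<partial>lborel)"
    by (intro nn_integral_cong) (auto simp: even split: split_indicator)
  also have "(\<integral>\<^sup>+z. F z * indicator {0..} z \<partial>lborel) + (\<integral>\<^sup>+z. F z * indicator {0..} z \<partial>lborel)
      = (\<integral>\<^sup>+z. 2 * F z * indicator {0..} z \<partial>lborel)"
    by (simp add: nn_integral_add[symmetric] mult_2 distrib_right)
  finally show ?thesis .
qed

section \<open>Symmetries, support and change of variables for the kernel\<close>

lemma kappa_commute: "kappa_alpha \<alpha> x y z = kappa_alpha \<alpha> y x z"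
  unfolding kappa_alpha_def by (simp add: abs_minus_commute add.commute power2_commute mult.commute)

text \<open>By Heron's formula the product under the power is 16 times the squared area of the
  triangle with sides |x|, |y|, |z|, and the support condition says that this triangle exists. Both
  are symmetric in the three sides.\<close>

lemma kappa_rotate: "kappa_alpha \<alpha> x y z = kappa_alpha \<alpha> x z y"
proof -
  have c: "(\<bar>\<bar>x\<bar> - \<bar>y\<bar>\<bar> \<le> \<bar>z\<bar> \<and> \<bar>z\<bar> \<le> \<bar>x\<bar> + \<bar>y\<bar>) = (\<bar>\<bar>x\<bar> - \<bar>z\<bar>\<bar> \<le> \<bar>y\<bar> \<and> \<bar>y\<bar> \<le> \<bar>x\<bar> + \<bar>z\<bar>)" by arith
  have "((a + b)^2 - c^2) * (c^2 - (a - b)^2) = ((a + c)^2 - b^2) * (b^2 - (a - c)^2)" for a b c :: real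
    by algebra
  from this[of "\<bar>x\<bar>" "\<bar>y\<bar>" "\<bar>z\<bar>"]
  have p: "((\<bar>x\<bar> + \<bar>y\<bar>)^2 - z^2) * (z^2 - (\<bar>x\<bar> - \<bar>y\<bar>)^2) = ((\<bar>x\<bar> + \<bar>z\<bar>)^2 - y^2) * (y^2 - (\<bar>x\<bar> - \<bar>z\<bar>)^2)"
    by simp
  have m: "x * y * z = x * z * y" by simp
  show ?thesis unfolding kappa_alpha_def c p m ..
qed

lemma kappa_abs: "kappa_alpha \<alpha> \<bar>x\<bar> y z = kappa_alpha \<alpha> x y z" "kappa_alpha \<alpha> x \<bar>y\<bar> z = kappa_alpha \<alpha> x y z"
   "kappa_alpha \<alpha> x y \<bar>z\<bar> = kappa_alpha \<alpha> x y z"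
  "kappa_alpha \<alpha> (-x) y z = kappa_alpha \<alpha> x y z" "kappa_alpha \<alpha> x (-y) z = kappa_alpha \<alpha> x y z"
   "kappa_alpha \<alpha> x y (-z) = kappa_alpha \<alpha> x y z"
  by (simp_all add: kappa_alpha_def abs_mult)

lemma kappa_nonneg: "-1/2 < \<alpha> \<Longrightarrow> 0 \<le> kappa_alpha \<alpha> x y z"
  using D_alpha_pos[of \<alpha>] by (simp add: kappa_alpha_def)

lemma measurable_kappa [measurable]:
  assumes [measurable]: "f \<in> borel_measurable M" "g \<in> borel_measurable M" "h \<in> borel_measurable M"
  shows "(\<lambda>w. kappa_alpha \<alpha> (f w) (g w) (h w)) \<in> borel_measurable M"
  unfolding kappa_alpha_def by measurable

lemma measurable_sigma_dk [measurable]: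
  assumes [measurable]: "f \<in> borel_measurable M" "g \<in> borel_measurable M" "h \<in> borel_measurable M"
  shows "(\<lambda>w. sigma_dk (f w) (g w) (h w)) \<in> borel_measurable M"
  unfolding sigma_dk_def by measurable

lemma measurable_W_alpha [measurable]:
  assumes [measurable]: "f \<in> borel_measurable M" "g \<in> borel_measurable M" "h \<in> borel_measurable M"
  shows "(\<lambda>w. W_alpha \<alpha> (f w) (g w) (h w)) \<in> borel_measurable M"
  unfolding W_alpha_def by measurable

text \<open>Law of cosines: u is minus the cosine of the angle opposite z in the triangle with sides
  |x|, |y|, z. Its derivative in z is z / |x y|, and the product in \<open>kappa_alpha\<close> is 4
  |x y|^2 (1 - u^2). The factor 2 on the right pays for the two signs of z.\<close>

lemma kappa_gegw:
  fixes x y z \<alpha> :: real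
  defines "u \<equiv> (z\<^sup>2 - x\<^sup>2 - y\<^sup>2) / (2 * \<bar>x * y\<bar>)"
  assumes x: "x \<noteq> 0" and y: "y \<noteq> 0" and z: "\<bar>\<bar>x\<bar> - \<bar>y\<bar>\<bar> \<le> z" "z \<le> \<bar>x\<bar> + \<bar>y\<bar>"
  shows "\<bar>u\<bar> \<le> 1" and "rad \<bar>x\<bar> \<bar>y\<bar> u = z"
    and "gegw \<alpha> u * (z / \<bar>x * y\<bar>) = 2 * (A_alpha \<alpha> * \<bar>z\<bar> powr (2 * \<alpha> + 1) * kappa_alpha \<alpha> x y z)"
proof -
  have z0: "0 \<le> z" using z by linarith
  define m where "m = \<bar>x * y\<bar>"
  have m: "0 < m" using x y by (simp add: m_def)
  have sq: "(\<bar>x\<bar> + \<bar>y\<bar>)\<^sup>2 = x\<^sup>2 + y\<^sup>2 + 2 * m" "(\<bar>x\<bar> - \<bar>y\<bar>)\<^sup>2 = x\<^sup>2 + y\<^sup>2 - 2 * m"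
    by (simp_all add: m_def power2_sum power2_diff abs_mult)
  have "(\<bar>x\<bar> - \<bar>y\<bar>)\<^sup>2 \<le> z\<^sup>2" "z\<^sup>2 \<le> (\<bar>x\<bar> + \<bar>y\<bar>)\<^sup>2"
    using z z0 by (metis abs_le_square_iff abs_of_nonneg, intro power_mono) auto
  then have b: "x\<^sup>2 + y\<^sup>2 - 2 * m \<le> z\<^sup>2" "z\<^sup>2 \<le> x\<^sup>2 + y\<^sup>2 + 2 * m" by (simp_all add: sq)
  have u: "u = (z\<^sup>2 - x\<^sup>2 - y\<^sup>2) / (2 * m)" by (simp add: u_def m_def)
  show u1: "\<bar>u\<bar> \<le> 1" unfolding u abs_le_iff using m b by (simp add: field_simps)
  have "\<bar>x\<bar>\<^sup>2 + \<bar>y\<bar>\<^sup>2 + 2 * \<bar>x\<bar> * \<bar>y\<bar> * u = z\<^sup>2"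
  proof -
    have "2 * \<bar>x\<bar> * \<bar>y\<bar> * u = 2 * m * u" by (simp add: m_def abs_mult)
    also have "\<dots> = z\<^sup>2 - x\<^sup>2 - y\<^sup>2" using m by (simp add: u)
    finally show ?thesis by simp
  qed
  then show "rad \<bar>x\<bar> \<bar>y\<bar> u = z" unfolding rad_def using z0 by simp
  define P where "P = ((\<bar>x\<bar> + \<bar>y\<bar>)^2 - z^2) * (z^2 - (\<bar>x\<bar> - \<bar>y\<bar>)^2)"
  have P: "0 \<le> P" unfolding P_def sq using b by (intro mult_nonneg_nonneg) auto
  have "1 - u\<^sup>2 = (1 - u) * (1 + u)" by algebra
  also have "1 - u = ((\<bar>x\<bar> + \<bar>y\<bar>)^2 - z^2) / (2 * m)" unfolding u sq using m by (simp add: field_simps)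
  also have "1 + u = (z^2 - (\<bar>x\<bar> - \<bar>y\<bar>)^2) / (2 * m)" unfolding u sq using m by (simp add: field_simps)
  finally have u2: "1 - u\<^sup>2 = P / (4 * (m * m))" by (simp add: P_def)
  have k: "kappa_alpha \<alpha> x y z = D_alpha \<alpha> * P powr (\<alpha> - 1/2) / (m powr (2 * \<alpha>) * z powr (2 * \<alpha>))"
    unfolding kappa_alpha_def P_def using z z0 by (simp add: abs_mult m_def powr_mult)
  show "gegw \<alpha> u * (z / \<bar>x * y\<bar>) = 2 * (A_alpha \<alpha> * \<bar>z\<bar> powr (2 * \<alpha> + 1) * kappa_alpha \<alpha> x y z)"
  proof (cases "z = 0")
    case False
    then have zp: "0 < z" using z0 by simp
    \<comment> \<open>The power of 4 in \<open>gegw\<close> cancels the 4 in 1 - u^2 = P / (4 m^2);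
      writing m powr (1 - 2 \<alpha>) as m / m powr (2 \<alpha>) sets aside the factor m that
      cancels the denominator of z / m.\<close>
    have e: "4 powr (\<alpha> - 1/2) * (P / (4 * (m * m))) powr (\<alpha> - 1/2) = P powr (\<alpha> - 1/2) * m / m powr (2 * \<alpha>)"
    proof -
      have "(m * m) powr (\<alpha> - 1/2) * m = m powr (2 * \<alpha>)"
        using m powr_add[of m "2 * \<alpha> - 1" 1] powr_add[of m "\<alpha> - 1/2" "\<alpha> - 1/2"]
        by (simp add: powr_mult)
      moreover have "0 < (m * m) powr (\<alpha> - 1/2)" using m by simp
      ultimately show ?thesis using m P
        by (simp add: powr_divide powr_mult field_simps)
    qed
    have "z powr (2 * \<alpha> + 1) = z powr (2 * \<alpha>) * z" using zp by (simp add: powr_add)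
    then have r: "2 * (A_alpha \<alpha> * \<bar>z\<bar> powr (2 * \<alpha> + 1) * kappa_alpha \<alpha> x y z)
       = 2 * A_alpha \<alpha> * D_alpha \<alpha> * (P powr (\<alpha> - 1/2) / m powr (2 * \<alpha>)) * z"
      using zp by (simp add: k)
    have "gegw \<alpha> u = 2 * A_alpha \<alpha> * D_alpha \<alpha> * (P powr (\<alpha> - 1/2) * m / m powr (2 * \<alpha>))"
      unfolding e[symmetric] gegw_def u2 using u1 by (simp add: abs_le_iff)
    then show ?thesis unfolding r m_def[symmetric] using m by simp
  qed simp
qed

text \<open>Substitution in t: the map z to (z^2 - x^2 - y^2) / (2 |x y|) increases from -1 to 1 on
  the support of the kernel in z \<ge> 0. The integral over both signs of z is folded onto this
  half-line.\<close>

lemma nn_integral_kappa_abs: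
  fixes h :: "real \<Rightarrow> ennreal"
  assumes [measurable]: "h \<in> borel_measurable borel" and a: "-1/2 < \<alpha>" and x: "x \<noteq> 0" and y: "y \<noteq> 0"
  shows "(\<integral>\<^sup>+z. h \<bar>z\<bar> * ennreal (kappa_alpha \<alpha> x y z) \<partial>mu_alpha \<alpha>) = (\<integral>\<^sup>+t. h (rad \<bar>x\<bar> \<bar>y\<bar> t) \<partial>geg \<alpha>)"
proof -
  let ?F = "\<lambda>z. ennreal (A_alpha \<alpha> * \<bar>z\<bar> powr (2 * \<alpha> + 1)) * (h \<bar>z\<bar> * ennreal (kappa_alpha \<alpha> x y z))"
  let ?a = "\<bar>\<bar>x\<bar> - \<bar>y\<bar>\<bar>" and ?b = "\<bar>x\<bar> + \<bar>y\<bar>"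
  let ?g = "\<lambda>z. (z\<^sup>2 - x\<^sup>2 - y\<^sup>2) / (2 * \<bar>x * y\<bar>)"
  have A: "0 < A_alpha \<alpha>" using A_alpha_pos a by simp
  have ab: "?a < ?b" using x y by linarith
  have ga: "?g ?a = -1" and gb: "?g ?b = 1"
    using x y by (simp_all add: power2_sum power2_diff abs_mult)
  have "(\<integral>\<^sup>+t. h (rad \<bar>x\<bar> \<bar>y\<bar> t) \<partial>geg \<alpha>) = (\<integral>\<^sup>+t. ennreal (gegw \<alpha> t) * h (rad \<bar>x\<bar> \<bar>y\<bar> t) \<partial>lborel)"
    unfolding geg_def by (subst nn_integral_density) auto
  also have "\<dots> = (\<integral>\<^sup>+t. ennreal (gegw \<alpha> t) * h (rad \<bar>x\<bar> \<bar>y\<bar> t) * indicator {?g ?a..?g ?b} t \<partial>lborel)"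
    unfolding ga gb by (intro nn_integral_cong) (auto simp: gegw_def split: split_indicator)
  also have "\<dots> = (\<integral>\<^sup>+z. ennreal (gegw \<alpha> (?g z)) * h (rad \<bar>x\<bar> \<bar>y\<bar> (?g z)) * ennreal (z / \<bar>x * y\<bar>) * indicator {?a..?b} z \<partial>lborel)"
  proof (intro nn_integral_substitution_aux)
    show "0 \<le> z / \<bar>x * y\<bar>" if "z \<in> {?a..?b}" for z
    proof -
      have "?a \<le> z" using that by simp
      then have "0 \<le> z" by linarith
      then show ?thesis by simp
    qed
  qed (use ab x y in \<open>auto intro!: derivative_eq_intros continuous_intros simp: divide_simps\<close>)
  also have "\<dots> = (\<integral>\<^sup>+z. 2 * ?F z * indicator {0..} z \<partial>lborel)"
  proof (intro nn_integral_cong)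
    fix z :: real
    show "ennreal (gegw \<alpha> (?g z)) * h (rad \<bar>x\<bar> \<bar>y\<bar> (?g z)) * ennreal (z / \<bar>x * y\<bar>) * indicator {?a..?b} z
      = 2 * ?F z * indicator {0..} z"
    proof (cases "z \<in> {?a..?b}")
      case True
      then have zz: "?a \<le> z" "z \<le> ?b" and z0: "0 \<le> z" by auto
      note k = kappa_gegw[OF x y zz]
      have "ennreal (gegw \<alpha> (?g z)) * ennreal (z / \<bar>x * y\<bar>)
         = ennreal (2 * (A_alpha \<alpha> * \<bar>z\<bar> powr (2 * \<alpha> + 1) * kappa_alpha \<alpha> x y z))"
        unfolding k(3)[symmetric] using gegw_nonneg[OF a] z0 by (subst ennreal_mult) auto
      also have "\<dots> = 2 * (ennreal (A_alpha \<alpha> * \<bar>z\<bar> powr (2 * \<alpha> + 1)) * ennreal (kappa_alpha \<alpha> x y z))"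
        using A kappa_nonneg[OF a] by (simp add: ennreal_mult)
      finally show ?thesis using True z0 unfolding k(2) by (simp add: mult_ac)
    next
      case False
      then have "kappa_alpha \<alpha> x y z = 0 \<or> z < 0" unfolding kappa_alpha_def by auto
      then show ?thesis using False by auto
    qed
  qed
  also have "\<dots> = (\<integral>\<^sup>+z. ?F z \<partial>lborel)"
    by (subst (2) nn_integral_even) (auto simp: kappa_abs)
  also have "\<dots> = (\<integral>\<^sup>+z. h \<bar>z\<bar> * ennreal (kappa_alpha \<alpha> x y z) \<partial>mu_alpha \<alpha>)"
    by (subst nn_integral_mu_alpha) auto
  finally show ?thesis ..
qed

text \<open>When x y < 0, passing from absolute values to signed centres amounts to t becoming -t,
  which \<open>geg\<close> does not notice. The signed form matters as soon as a factor depending on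
  t is present.\<close>

lemma nn_integral_kappa:
  fixes h :: "real \<Rightarrow> ennreal"
  assumes h [measurable]: "h \<in> borel_measurable borel" and a: "-1/2 < \<alpha>" and x: "x \<noteq> 0" and y: "y \<noteq> 0"
  shows "(\<integral>\<^sup>+z. h \<bar>z\<bar> * ennreal (kappa_alpha \<alpha> x y z) \<partial>mu_alpha \<alpha>) = (\<integral>\<^sup>+t. h (rad x y t) \<partial>geg \<alpha>)"
proof -
  have "(\<integral>\<^sup>+t. h (rad \<bar>x\<bar> \<bar>y\<bar> t) \<partial>geg \<alpha>) = (\<integral>\<^sup>+t. h (rad x y t) \<partial>geg \<alpha>)"
  proof (cases "0 \<le> x * y")
    case True
    then have "\<bar>x\<bar> * \<bar>y\<bar> = x * y" by (simp flip: abs_mult)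
    then show ?thesis by (simp add: rad_def mult.assoc[of 2])
  next
    case False
    then have e: "\<bar>x\<bar> * \<bar>y\<bar> = - (x * y)" by (simp flip: abs_mult)
    have "rad \<bar>x\<bar> \<bar>y\<bar> (- t) = rad x y t" for t
    proof -
      have "2 * \<bar>x\<bar> * \<bar>y\<bar> * (- t) = 2 * x * y * t" using e by (simp add: mult.assoc[of 2])
      then show ?thesis by (simp add: rad_def)
    qed
    then show ?thesis by (subst nn_integral_geg_reflect[symmetric]) auto
  qed
  then show ?thesis using nn_integral_kappa_abs[OF assms] by simp
qed

text \<open>The function \<open>sigma_dk\<close> x y z is even in z, so it may be included in the
  function of |z|. Along the substitution 1 - \<open>sigma_dk\<close> turns into 1 + t, the factor
  that distinguishes \<open>ang\<close> from \<open>geg\<close>.\<close>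

lemma nn_integral_kappa_sigma:
  fixes h :: "real \<Rightarrow> ennreal"
  assumes h [measurable]: "h \<in> borel_measurable borel" and a: "-1/2 < \<alpha>" and x: "x \<noteq> 0" and y: "y \<noteq> 0"
  shows "(\<integral>\<^sup>+z. h \<bar>z\<bar> * ennreal ((1 - sigma_dk x y z) * kappa_alpha \<alpha> x y z) \<partial>mu_alpha \<alpha>)
       = (\<integral>\<^sup>+t. h (rad x y t) \<partial>ang \<alpha>)"
proof -
  have s: "sigma_dk x y \<bar>z\<bar> = sigma_dk x y z" for z by (simp add: sigma_dk_def)
  have "(\<integral>\<^sup>+z. h \<bar>z\<bar> * ennreal ((1 - sigma_dk x y z) * kappa_alpha \<alpha> x y z) \<partial>mu_alpha \<alpha>)
     = (\<integral>\<^sup>+z. (h \<bar>z\<bar> * ennreal (1 - sigma_dk x y \<bar>z\<bar>)) * ennreal (kappa_alpha \<alpha> x y z) \<partial>mu_alpha \<alpha>)"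
    using kappa_nonneg[OF a] by (simp add: s ennreal_mult'' mult.assoc)
  also have "\<dots> = (\<integral>\<^sup>+t. h (rad x y t) * ennreal (1 - sigma_dk x y (rad x y t)) \<partial>geg \<alpha>)"
    by (rule nn_integral_kappa[OF _ a x y]) auto
  also have "\<dots> = (\<integral>\<^sup>+t. ennreal (1 + t) * h (rad x y t) \<partial>geg \<alpha>)"
  proof (rule nn_integral_cong_AE)
    show "AE t in geg \<alpha>. h (rad x y t) * ennreal (1 - sigma_dk x y (rad x y t)) = ennreal (1 + t) * h (rad x y t)"
      using AE_geg_abs_le[of \<alpha>]
    proof eventually_elim
      case (elim t)
      have e: "1 - sigma_dk x y (rad x y t) = 1 + t"
        using x y by (simp add: sigma_dk_def rad_sq[OF elim] field_simps)
      show ?case unfolding e by (rule mult.commute)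
    qed
  qed
  also have "\<dots> = (\<integral>\<^sup>+t. h (rad x y t) \<partial>ang \<alpha>)"
    by (rule nn_integral_ang[symmetric, OF _ a]) auto
  finally show ?thesis .
qed

text \<open>Up to sign this is the cosine of an angle of a triangle.\<close>

lemma sigma_dk_abs_le:
  assumes "\<bar>\<bar>x\<bar> - \<bar>y\<bar>\<bar> \<le> \<bar>z\<bar>" "\<bar>z\<bar> \<le> \<bar>x\<bar> + \<bar>y\<bar>"
  shows "\<bar>sigma_dk x y z\<bar> \<le> 1"
proof (cases "x \<noteq> 0 \<and> y \<noteq> 0")
  case True
  have sq: "(\<bar>x\<bar> + \<bar>y\<bar>)\<^sup>2 = x\<^sup>2 + y\<^sup>2 + 2 * \<bar>x * y\<bar>" "(\<bar>x\<bar> - \<bar>y\<bar>)\<^sup>2 = x\<^sup>2 + y\<^sup>2 - 2 * \<bar>x * y\<bar>"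
    by (simp_all add: power2_sum power2_diff abs_mult)
  have "(\<bar>x\<bar> - \<bar>y\<bar>)\<^sup>2 \<le> z\<^sup>2" using assms(1) by (simp add: abs_le_square_iff[symmetric])
  moreover have "z\<^sup>2 \<le> (\<bar>x\<bar> + \<bar>y\<bar>)\<^sup>2" using assms(2) by (simp add: abs_le_square_iff[symmetric])
  ultimately have "\<bar>x\<^sup>2 + y\<^sup>2 - z\<^sup>2\<bar> \<le> \<bar>2 * x * y\<bar>" unfolding sq by (simp add: abs_mult)
  then show ?thesis using True by (simp add: sigma_dk_def abs_divide)
qed (auto simp: sigma_dk_def)

text \<open>The support condition is the triangle inequality for |x|, |y|, |z|; each conclusion is
  one of its rearrangements.\<close>

lemma kappa_support:
  assumes "kappa_alpha \<alpha> x y z \<noteq> 0"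
  shows "\<bar>\<bar>x\<bar> - \<bar>y\<bar>\<bar> \<le> \<bar>z\<bar>" "\<bar>z\<bar> \<le> \<bar>x\<bar> + \<bar>y\<bar>" "\<bar>\<bar>z\<bar> - \<bar>x\<bar>\<bar> \<le> \<bar>y\<bar>" "\<bar>\<bar>z\<bar> - \<bar>y\<bar>\<bar> \<le> \<bar>x\<bar>"
    "\<bar>y\<bar> \<le> \<bar>z\<bar> + \<bar>x\<bar>" "\<bar>x\<bar> \<le> \<bar>z\<bar> + \<bar>y\<bar>"
proof -
  show "\<bar>\<bar>x\<bar> - \<bar>y\<bar>\<bar> \<le> \<bar>z\<bar>" "\<bar>z\<bar> \<le> \<bar>x\<bar> + \<bar>y\<bar>"
    using assms by (auto simp: kappa_alpha_def split: if_splits)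
  then have "\<bar>x\<bar> - \<bar>y\<bar> \<le> \<bar>z\<bar>" "\<bar>y\<bar> - \<bar>x\<bar> \<le> \<bar>z\<bar>" "\<bar>z\<bar> \<le> \<bar>x\<bar> + \<bar>y\<bar>"
    by (simp_all only: abs_le_iff) simp_all
  then show "\<bar>\<bar>z\<bar> - \<bar>x\<bar>\<bar> \<le> \<bar>y\<bar>" "\<bar>\<bar>z\<bar> - \<bar>y\<bar>\<bar> \<le> \<bar>x\<bar>"
    "\<bar>y\<bar> \<le> \<bar>z\<bar> + \<bar>x\<bar>" "\<bar>x\<bar> \<le> \<bar>z\<bar> + \<bar>y\<bar>"
    unfolding abs_le_iff[of "_ - _"] by simp_all
qed

text \<open>On the support all three \<open>sigma_dk\<close> terms are cosines up to sign, so the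
  Dunkl factor has absolute value at most 4. Off the support they are unbounded, hence the
  formulation with the factor \<open>kappa_alpha\<close> included.\<close>

lemma sigma_kappa_bounds:
  assumes a: "-1/2 < \<alpha>"
  shows "0 \<le> (1 - sigma_dk x y z) * kappa_alpha \<alpha> x y z"
    and "(1 - sigma_dk x y z) * kappa_alpha \<alpha> x y z \<le> 2 * kappa_alpha \<alpha> x y z"
    and "\<bar>W_alpha \<alpha> x y z\<bar> \<le> 4 * kappa_alpha \<alpha> x y z"
proof -
  have "0 \<le> (1 - sigma_dk x y z) * kappa_alpha \<alpha> x y z \<and> (1 - sigma_dk x y z) * kappa_alpha \<alpha> x y z \<le> 2 * kappa_alpha \<alpha> x y z
    \<and> \<bar>W_alpha \<alpha> x y z\<bar> \<le> 4 * kappa_alpha \<alpha> x y z" (is ?c)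
  proof (cases "kappa_alpha \<alpha> x y z = 0")
  case True then show ?c by (simp add: W_alpha_def)
next
  case False
  note s = kappa_support[OF False]
  have b: "\<bar>sigma_dk x y z\<bar> \<le> 1" "\<bar>sigma_dk z x y\<bar> \<le> 1" "\<bar>sigma_dk z y x\<bar> \<le> 1"
      proof -
    show "\<bar>sigma_dk x y z\<bar> \<le> 1" by (rule sigma_dk_abs_le[OF s(1,2)])
    show "\<bar>sigma_dk z x y\<bar> \<le> 1" by (rule sigma_dk_abs_le[OF s(3) s(5)])
    show "\<bar>sigma_dk z y x\<bar> \<le> 1" by (rule sigma_dk_abs_le[OF s(4) s(6)])
  qed
  have k: "0 \<le> kappa_alpha \<alpha> x y z" by (rule kappa_nonneg[OF a])
  have "\<bar>1 - sigma_dk x y z + sigma_dk z x y + sigma_dk z y x\<bar> \<le> 4" using b by linarith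
  then have "\<bar>W_alpha \<alpha> x y z\<bar> \<le> 4 * kappa_alpha \<alpha> x y z"
    unfolding W_alpha_def abs_mult using k by (simp add: mult_right_mono)
  moreover have "0 \<le> 1 - sigma_dk x y z" "1 - sigma_dk x y z \<le> 2" using b by linarith+
  ultimately show ?c using k by (simp add: mult_right_mono)
  qed
  then show "0 \<le> (1 - sigma_dk x y z) * kappa_alpha \<alpha> x y z" "(1 - sigma_dk x y z) * kappa_alpha \<alpha> x y z \<le> 2 * kappa_alpha \<alpha> x y z"
    "\<bar>W_alpha \<alpha> x y z\<bar> \<le> 4 * kappa_alpha \<alpha> x y z" by simp_all
qed

text \<open>Uses the factorisation of the Dunkl weight as \<open>(1 - \<sigma>) (1 + (x + y) / z)\<close>.\<close>
lemma W_alpha_opposite: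
  assumes a: "-1/2 < \<alpha>" and xz: "x * z < 0" and y: "y \<noteq> 0"
  shows "\<bar>W_alpha \<alpha> x y z\<bar> \<le> 4 * (\<bar>y\<bar> / \<bar>z\<bar>) * kappa_alpha \<alpha> x y z"
proof (cases "kappa_alpha \<alpha> x y z = 0")
  case True then show ?thesis by (simp add: W_alpha_def)
next
  case False
  note s = kappa_support[OF False]
  have x0: "x \<noteq> 0" and z0: "z \<noteq> 0" using xz by auto
  have "1 - sigma_dk x y z + sigma_dk z x y + sigma_dk z y x = (1 - sigma_dk x y z) * ((x + y + z) / z)"
    using x0 y z0 by (simp add: sigma_dk_def field_simps) algebra
  then have "W_alpha \<alpha> x y z = ((1 - sigma_dk x y z) * kappa_alpha \<alpha> x y z) * ((x + y + z) / z)"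
    unfolding W_alpha_def by simp
  then have "\<bar>W_alpha \<alpha> x y z\<bar> = ((1 - sigma_dk x y z) * kappa_alpha \<alpha> x y z) * (\<bar>x + y + z\<bar> / \<bar>z\<bar>)"
    using sigma_kappa_bounds(1)[OF a, of x y z] by (simp only: abs_mult[of "_ * _" "_ / _"] abs_of_nonneg abs_divide)
  also have "\<dots> \<le> (2 * kappa_alpha \<alpha> x y z) * ((2 * \<bar>y\<bar>) / \<bar>z\<bar>)"
  proof (rule mult_mono[OF sigma_kappa_bounds(2)[OF a] divide_right_mono])
    \<comment> \<open>Opposite signs make |x + z| a difference of lengths, bounded by the third side
      |y|. The numerator of (x + y + z) / z is then at most 2 |y|, although x and z may be
      large.\<close>
    have "\<bar>x + z\<bar> = \<bar>\<bar>z\<bar> - \<bar>x\<bar>\<bar>" using xz by (auto simp: mult_less_0_iff)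
    then have "\<bar>x + z\<bar> \<le> \<bar>y\<bar>" using s(3) by simp
    then show "\<bar>x + y + z\<bar> \<le> 2 * \<bar>y\<bar>" by linarith
  qed (use kappa_nonneg[OF a] in auto)
  finally show ?thesis by (simp add: mult_ac)
qed

text \<open>Put t = 2 u - 1 and p = \<alpha> + 1/2. Then 1 - t^2 = 4 u (1 - u), and the mass is a
  multiple of Beta p p = Gamma p ^ 2 / Gamma (2 p). Duplication expresses Gamma (2 p) through Gamma
  p and Gamma (p + 1/2), which cancel against \<open>A_alpha\<close> and
  \<open>D_alpha\<close>.\<close>

lemma emeasure_geg:
  assumes a: "-1/2 < \<alpha>" shows "emeasure (geg \<alpha>) UNIV = 1"
proof -
  define p where "p = \<alpha> + 1/2"
  have p: "0 < p" using a by (simp add: p_def)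
  let ?c = "2 * A_alpha \<alpha> * D_alpha \<alpha> * 4 powr (\<alpha> - 1/2)"
  have c0: "0 \<le> ?c" using A_alpha_pos[of \<alpha>] D_alpha_pos[of \<alpha>] a by simp
  have "emeasure (geg \<alpha>) UNIV = (\<integral>\<^sup>+t. ennreal (gegw \<alpha> t) \<partial>lborel)"
    unfolding geg_def by (subst emeasure_density) auto
  also have "\<dots> = 2 * (\<integral>\<^sup>+u. ennreal (gegw \<alpha> (-1 + 2 * u)) \<partial>lborel)"
    by (subst nn_integral_real_affine[where c=2 and t="-1"]) auto
  also have "(\<integral>\<^sup>+u. ennreal (gegw \<alpha> (-1 + 2 * u)) \<partial>lborel)
    = (\<integral>\<^sup>+u. ennreal (?c * 4 powr (p - 1)) * ennreal (indicator {0..1} u * (u powr (p - 1) * (1 - u) powr (p - 1))) \<partial>lborel)"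
  proof (intro nn_integral_cong)
    fix u :: real
    show "ennreal (gegw \<alpha> (-1 + 2 * u)) = ennreal (?c * 4 powr (p - 1)) * ennreal (indicator {0..1} u * (u powr (p - 1) * (1 - u) powr (p - 1)))"
    proof (cases "u \<in> {0..1}")
      case True
      have "1 - (-1 + 2 * u)\<^sup>2 = 4 * (u * (1 - u))" by algebra
      then have g: "gegw \<alpha> (-1 + 2 * u) = (?c * 4 powr (p - 1)) * (indicator {0..1} u * (u powr (p - 1) * (1 - u) powr (p - 1)))"
        using True by (simp add: gegw_def p_def powr_mult)
      show ?thesis unfolding g using True c0 by (intro ennreal_mult) auto
    qed (auto simp: gegw_def indicator_def)
  qed
  also have "\<dots> = ennreal (?c * 4 powr (p - 1)) * ennreal (Beta p p)"
    by (subst nn_integral_cmult) (auto simp: nn_integral_has_integral_lebesgue[OF _ has_integral_Beta_real[OF p p]])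
  also have "2 * (ennreal (?c * 4 powr (p - 1)) * ennreal (Beta p p)) = ennreal (2 * (?c * 4 powr (p - 1) * Beta p p))"
  proof -
    have "0 \<le> ?c * 4 powr (p - 1)" "0 \<le> Beta p p" using c0 p by (simp_all add: Beta_def)
    then have "ennreal (2 * (?c * 4 powr (p - 1) * Beta p p)) = ennreal 2 * (ennreal (?c * 4 powr (p - 1)) * ennreal (Beta p p))"
      by (simp only: ennreal_mult mult_nonneg_nonneg zero_le_numeral)
    then show ?thesis by simp
  qed
  also have "2 * (?c * 4 powr (p - 1) * Beta p p) = 1"
  proof -
    \<comment> \<open>The duplication formula is applied to the complex Gamma function and then read
      back on the reals; p > 0 keeps both arguments away from the poles.\<close>
    have pz: "complex_of_real p \<notin> \<int>\<^sub>\<le>\<^sub>0" using p by (auto elim!: nonpos_Ints_cases simp: complex_eq_iff)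
    have pz2: "complex_of_real p + 1/2 \<notin> \<int>\<^sub>\<le>\<^sub>0" using p by (auto elim!: nonpos_Ints_cases simp: complex_eq_iff)
    have e: "complex_of_real (exp ((1 - 2 * p) * ln 2)) = exp ((1 - 2 * complex_of_real p) * complex_of_real (ln 2))"
      unfolding exp_of_real[symmetric] by simp
    have r: "complex_of_real (Gamma p) = Gamma (complex_of_real p)"
      "complex_of_real (Gamma (p + 1/2)) = Gamma (complex_of_real p + 1/2)"
      "complex_of_real (Gamma (2 * p)) = Gamma (2 * complex_of_real p)"
      by (simp_all flip: Gamma_complex_of_real)
    have "complex_of_real (Gamma p * Gamma (p + 1/2)) = complex_of_real (exp ((1 - 2 * p) * ln 2) * sqrt pi * Gamma (2 * p))"
      unfolding of_real_mult e r by (rule Gamma_legendre_duplication[OF pz pz2])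
    then have "Gamma p * Gamma (p + 1/2) = exp ((1 - 2 * p) * ln 2) * sqrt pi * Gamma (2 * p)"
      by (rule of_real_eq_iff[THEN iffD1])
    then have dup: "Gamma p * Gamma (p + 1/2) = 2 powr (1 - 2 * p) * sqrt pi * Gamma (2 * p)"
      by (simp add: powr_def mult.commute)
    have g: "0 < Gamma p" "0 < Gamma (p + 1/2)" "0 < Gamma (2 * p)" using p by (auto intro: Gamma_real_pos)
    have q: "(4::real) powr x = 2 powr (2 * x)" for x using powr_powr[of 2 2 x] by simp
    have B: "Beta p p = Gamma p * (Gamma p / Gamma (2 * p))" by (simp add: Beta_def)
    also have "Gamma p / Gamma (2 * p) = 2 powr (1 - 2 * p) * sqrt pi / Gamma (p + 1/2)"
      using dup g by (simp add: frac_eq_eq mult.commute)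
    finally have B: "Beta p p = Gamma p * 2 powr (1 - 2 * p) * sqrt pi / Gamma (p + 1/2)" by simp
    have "2 * (?c * 4 powr (p - 1) * Beta p p) = 4 * (1 / (2 powr (p + 1/2) * Gamma (p + 1/2)))
      * (Gamma (p + 1/2) ^ 2 / (2 powr (p - 3/2) * sqrt pi * Gamma p)) * 2 powr (2 * (p - 1)) * 2 powr (2 * (p - 1)) * Beta p p"
    proof -
      have "A_alpha \<alpha> = 1 / (2 powr (p + 1/2) * Gamma (p + 1/2))" by (simp add: A_alpha_def p_def add.commute)
      moreover have "D_alpha \<alpha> = Gamma (p + 1/2) ^ 2 / (2 powr (p - 3/2) * sqrt pi * Gamma p)" by (simp add: D_alpha_def p_def add.commute)
      moreover have "4 powr (\<alpha> - 1/2) = (2::real) powr (2 * (p - 1))" "4 powr (p - 1) = (2::real) powr (2 * (p - 1))"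
        unfolding q p_def by simp_all
      ultimately show ?thesis by (simp only: mult.assoc)
    qed
    also have "\<dots> = 4 * (2 powr (2 * (p - 1)) * 2 powr (2 * (p - 1)) * 2 powr (1 - 2 * p)) / (2 powr (p + 1/2) * 2 powr (p - 3/2))"
    proof -
      \<comment> \<open>X, Y, Z, U stand for powers of 2, S for sqrt pi and G1, G2 for the two Gamma
        values. Only the powers of 2 survive the cancellation.\<close>
      have "4 * (1 / (X * G2)) * (G2 ^ 2 / (Y * S * G1)) * Z * Z * (G1 * U * S / G2) = 4 * (Z * Z * U) / (X * Y)"
        if "0 < X" "0 < Y" "0 < S" "0 < G1" "0 < G2" for X Y Z U S G1 G2 :: real
        using that by (simp add: power2_eq_square)
      then show ?thesis unfolding B using g by simp
    qed
    also have "2 powr (2 * (p - 1)) * 2 powr (2 * (p - 1)) * 2 powr (1 - 2 * p) = (2::real) powr (2 * p - 3)"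
      unfolding powr_add[symmetric] by (rule arg_cong[where f="(powr) 2"]) simp
    also have "2 powr (p + 1/2) * 2 powr (p - 3/2) = (2::real) powr (2 + (2 * p - 3))"
      unfolding powr_add[symmetric] by (rule arg_cong[where f="(powr) 2"]) simp
    also have "\<dots> = 4 * 2 powr (2 * p - 3)"
      by (subst powr_add) simp
    also have "4 * 2 powr (2 * p - 3) / (4 * 2 powr (2 * p - 3)) = (1::real)" by simp
    finally show ?thesis .
  qed
  finally show ?thesis by simp
qed

text \<open>Since \<open>geg\<close> is even, the factors 1 + t and 1 - t integrate to the same
  value, and their sum is the constant 2 against a measure of mass one.\<close>

lemma prob_space_ang:
  assumes a: "-1/2 \<le> \<alpha>" shows "prob_space (ang \<alpha>)"
proof (cases "\<alpha> = -1/2")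
  case True then show ?thesis unfolding ang_def if_P[OF True] by (intro prob_space_return) auto
next
  case False
  then have a: "-1/2 < \<alpha>" using a by simp
  have "2 * emeasure (ang \<alpha>) UNIV = 2 * (\<integral>\<^sup>+t. ennreal (1 + t) \<partial>geg \<alpha>)"
    using nn_integral_ang[OF _ a, of "\<lambda>_. 1"] by simp
  also have "\<dots> = (\<integral>\<^sup>+t. ennreal (1 + t) \<partial>geg \<alpha>) + (\<integral>\<^sup>+t. ennreal (1 - t) \<partial>geg \<alpha>)"
    using nn_integral_geg_reflect[of "\<lambda>t. ennreal (1 + t)" \<alpha>] by (simp add: mult_2)
  also have "\<dots> = (\<integral>\<^sup>+t. ennreal (1 + t) + ennreal (1 - t) \<partial>geg \<alpha>)"
    by (rule nn_integral_add[symmetric]) auto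
  also have "\<dots> = (\<integral>\<^sup>+t. 2 \<partial>geg \<alpha>)"
    using AE_geg_abs_le[of \<alpha>] by (intro nn_integral_cong_AE) (auto simp: ennreal_plus[symmetric] simp del: ennreal_plus)
  also have "\<dots> = 2 * 1" using emeasure_geg[OF a] by simp
  finally have "emeasure (ang \<alpha>) UNIV = 1" by (subst (asm) ennreal_mult_cancel_left) auto
  then show ?thesis by (intro prob_spaceI) simp
qed

text \<open>From 1 + t \<le> 2. It trades \<open>ang\<close> for \<open>geg\<close>, whose kernel
  \<open>kappa_alpha\<close> is symmetric in all three variables.\<close>

lemma ang_le_geg:
  assumes a: "-1/2 < \<alpha>" and [measurable]: "h \<in> borel_measurable borel"
  shows "(\<integral>\<^sup>+t. h t \<partial>ang \<alpha>) \<le> 2 * (\<integral>\<^sup>+t. h t \<partial>geg \<alpha>)"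
proof -
  have "(\<integral>\<^sup>+t. h t \<partial>ang \<alpha>) = (\<integral>\<^sup>+t. ennreal (1 + t) * h t \<partial>geg \<alpha>)" by (rule nn_integral_ang[OF _ a]) auto
  also have "\<dots> \<le> (\<integral>\<^sup>+t. 2 * h t \<partial>geg \<alpha>)"
    using AE_geg_abs_le[of \<alpha>]
    by (intro nn_integral_mono_AE) (auto elim!: eventually_mono intro!: mult_right_mono simp: ennreal_leI[of _ 2, simplified])
  also have "\<dots> = 2 * (\<integral>\<^sup>+t. h t \<partial>geg \<alpha>)" by (rule nn_integral_cmult) auto
  finally show ?thesis .
qed

section \<open>Angular measure of small radii\<close>

text \<open>The weight factors as (1 + t) powr p times (1 - t) powr p with p = \<alpha> - 1/2. On
  the interval 1 + t lies between 1 and 2, so its power lies between 1 and 2 powr p in one order or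
  the other, according to the sign of p; the second factor integrates explicitly.\<close>

lemma emeasure_geg_near_one:
  assumes a: "-1/2 < \<alpha>" and e: "0 < e" "e \<le> 1"
  defines "c \<equiv> 2 * A_alpha \<alpha> * D_alpha \<alpha> * 4 powr (\<alpha> - 1/2) / (\<alpha> + 1/2)"
  shows "emeasure (geg \<alpha>) {1-e..1} \<le> ennreal (c * max 1 (2 powr (\<alpha> - 1/2)) * e powr (\<alpha> + 1/2))"
    and "ennreal (c * min 1 (2 powr (\<alpha> - 1/2)) * e powr (\<alpha> + 1/2)) \<le> emeasure (geg \<alpha>) {1-e..1}"
proof -
  let ?p = "\<alpha> - 1/2"
  let ?max = "max 1 (2 powr ?p)" and ?min = "min 1 (2 powr ?p)"
  let ?c = "2 * A_alpha \<alpha> * D_alpha \<alpha> * 4 powr (?p)"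
  have c0: "0 \<le> ?c" using A_alpha_pos[of \<alpha>] D_alpha_pos[of \<alpha>] a by simp
  have I: "(\<integral>\<^sup>+t. ennreal (k * (1 - t) powr (?p)) * indicator {1-e..1} t \<partial>lborel) = ennreal (k / (\<alpha> + 1/2) * e powr (\<alpha> + 1/2))"
    if k: "0 \<le> k" for k
  proof -
    have "(\<integral>\<^sup>+t. ennreal (k * (1 - t) powr (?p)) * indicator {1-e..1} t \<partial>lborel)
       = (\<integral>\<^sup>+u. ennreal k * (ennreal (u powr (?p)) * indicator {0..e} u) \<partial>lborel)"
      by (subst nn_integral_real_affine[where c="-1" and t=1])
        (use k in \<open>auto intro!: nn_integral_cong simp: ennreal_mult split: split_indicator\<close>)
    also have "\<dots> = ennreal k * (\<integral>\<^sup>+u. ennreal (u powr (?p)) * indicator {0..e} u \<partial>lborel)"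
      by (rule nn_integral_cmult) auto
    also have "(\<integral>\<^sup>+u. ennreal (u powr (?p)) * indicator {0..e} u \<partial>lborel) = ennreal (e powr (\<alpha> + 1/2) / (\<alpha> + 1/2))"
      using has_integral_powr_from_0[of "?p" e] a e
      by (intro nn_integral_has_integral_lebesgue') (auto simp: add.commute)
    finally show ?thesis using k a by (simp add: ennreal_mult'[symmetric])
  qed
  have em: "emeasure (geg \<alpha>) {1-e..1} = (\<integral>\<^sup>+t. ennreal (gegw \<alpha> t) * indicator {1-e..1} t \<partial>lborel)"
    unfolding geg_def by (subst emeasure_density) auto
  have g: "gegw \<alpha> t = (?c * (1 + t) powr (?p)) * (1 - t) powr (?p)" if "t \<in> {1-e..1}" for t
  proof -
    have "1 - t\<^sup>2 = (1 + t) * (1 - t)" by algebra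
    then show ?thesis using that e by (simp add: gegw_def powr_mult)
  qed
  have b: "?min \<le> (1 + t) powr (?p)" "(1 + t) powr (?p) \<le> ?max"
    if "t \<in> {1-e..1}" for t
  proof -
    have t: "0 \<le> t" "t \<le> 1" using that e by auto
    show "?min \<le> (1 + t) powr (?p)"
    proof (cases "0 \<le> ?p")
      case True then show ?thesis using t ge_one_powr_ge_zero[of "1 + t" "?p"] by simp
    next
      case False then have "2 powr (?p) \<le> (1 + t) powr (?p)" using t by (intro powr_mono2') auto
      then show ?thesis by simp
    qed
    show "(1 + t) powr (?p) \<le> ?max"
    proof (cases "0 \<le> ?p")
      case True then have "(1 + t) powr (?p) \<le> 2 powr (?p)" using t by (intro powr_mono2) auto
      then show ?thesis by simp
    next
      case False then have "(1 + t) powr (?p) \<le> 1 powr (?p)" using t by (intro powr_mono2') auto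
      then show ?thesis by simp
    qed
  qed
  show "emeasure (geg \<alpha>) {1-e..1} \<le> ennreal (c * ?max * e powr (\<alpha> + 1/2))"
  proof -
    have "emeasure (geg \<alpha>) {1-e..1} \<le> (\<integral>\<^sup>+t. ennreal ((?c * ?max) * (1 - t) powr (?p)) * indicator {1-e..1} t \<partial>lborel)"
      unfolding em
    proof (intro nn_integral_mono)
      fix t show "ennreal (gegw \<alpha> t) * indicator {1-e..1} t \<le> ennreal ((?c * ?max) * (1 - t) powr (?p)) * indicator {1-e..1} t"
      proof (cases "t \<in> {1-e..1}")
        case True
        have "gegw \<alpha> t \<le> (?c * ?max) * (1 - t) powr (?p)"
          unfolding g[OF True] by (intro mult_right_mono mult_left_mono b[OF True] c0) auto
        then show ?thesis using True by (simp add: ennreal_leI)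
      qed simp
    qed
    also have "\<dots> = ennreal (?c * ?max / (\<alpha> + 1/2) * e powr (\<alpha> + 1/2))"
      by (rule I) (use c0 in \<open>auto intro!: mult_nonneg_nonneg\<close>)
    finally show ?thesis by (simp add: c_def mult_ac)
  qed
  show "ennreal (c * ?min * e powr (\<alpha> + 1/2)) \<le> emeasure (geg \<alpha>) {1-e..1}"
  proof -
    have "ennreal (c * ?min * e powr (\<alpha> + 1/2)) = ennreal (?c * ?min / (\<alpha> + 1/2) * e powr (\<alpha> + 1/2))"
      by (simp add: c_def mult_ac)
    also have "\<dots> = (\<integral>\<^sup>+t. ennreal ((?c * ?min) * (1 - t) powr (?p)) * indicator {1-e..1} t \<partial>lborel)"
      by (rule I[symmetric]) (use c0 in \<open>auto intro!: mult_nonneg_nonneg\<close>)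
    also have "\<dots> \<le> emeasure (geg \<alpha>) {1-e..1}"
      unfolding em
    proof (intro nn_integral_mono)
      fix t show "ennreal ((?c * ?min) * (1 - t) powr (?p)) * indicator {1-e..1} t \<le> ennreal (gegw \<alpha> t) * indicator {1-e..1} t"
      proof (cases "t \<in> {1-e..1}")
        case True
        have "(?c * ?min) * (1 - t) powr (?p) \<le> gegw \<alpha> t"
          unfolding g[OF True] by (intro mult_right_mono mult_left_mono b[OF True] c0) auto
        then show ?thesis using True by (simp add: ennreal_leI)
      qed simp
    qed
    finally show ?thesis .
  qed
qed

text \<open>For centres of opposite sign small radii occur at t near 1, and the excess over the
  minimum is linear in 1 - t.\<close>

lemma rad_sq_opposite:
  assumes "x * y \<le> 0" "\<bar>t\<bar> \<le> 1"
  shows "(rad x y t)\<^sup>2 = (\<bar>x\<bar> - \<bar>y\<bar>)\<^sup>2 + 2 * (\<bar>x\<bar> * \<bar>y\<bar>) * (1 - t)"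
proof -
  have "\<bar>x\<bar> * \<bar>y\<bar> = - (x * y)" using assms(1) by (simp flip: abs_mult)
  then show ?thesis by (simp add: rad_sq[OF assms(2)] power2_diff algebra_simps)
qed

text \<open>If |x| < 2 r the right side is bounded below and the total mass one suffices. Otherwise
  a radius below r forces |z| \<ge> |x| / 2, hence 1 - t \<le> (r / |x|)^2 for opposite signs, and
  the sector has measure of order (r / |x|) powr (2 \<alpha> + 1). The 3 in the constant comes from
  replacing |x| or r by |x| + r.\<close>

lemma geg_rad_upper:
  assumes a: "-1/2 < \<alpha>"
  obtains C where "0 < C" "\<And>x z r. \<lbrakk>0 < r; x \<noteq> 0; z \<noteq> 0\<rbrakk> \<Longrightarrow>
     emeasure (geg \<alpha>) {t. rad x z t < r} \<le> ennreal (C * (r / (\<bar>x\<bar> + r)) powr (2 * \<alpha> + 1))"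
proof -
  define c where "c = 2 * A_alpha \<alpha> * D_alpha \<alpha> * 4 powr (\<alpha> - 1/2) / (\<alpha> + 1/2) * max 1 (2 powr (\<alpha> - 1/2))"
  have c0: "0 \<le> c" unfolding c_def using A_alpha_pos[of \<alpha>] D_alpha_pos[of \<alpha>] a
    by (intro mult_nonneg_nonneg divide_nonneg_nonneg) auto
  define C where "C = (c + 1) * 3 powr (2 * \<alpha> + 1)"
  have C: "0 < C" using c0 by (simp add: C_def add_nonneg_pos)
  have neg: "emeasure (geg \<alpha>) {t. rad x z t < r} \<le> ennreal (C * (r / (\<bar>x\<bar> + r)) powr (2 * \<alpha> + 1))"
    if r: "0 < r" and x: "x \<noteq> 0" and z: "z \<noteq> 0" and xz: "x * z \<le> 0" for x z r
  proof (cases "\<bar>x\<bar> < 2 * r")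
    case True
    let ?q = "(r / (\<bar>x\<bar> + r)) powr (2 * \<alpha> + 1)"
    have "emeasure (geg \<alpha>) {t. rad x z t < r} \<le> emeasure (geg \<alpha>) UNIV" by (intro emeasure_mono) auto
    also have "\<dots> = ennreal 1" using emeasure_geg[OF a] by simp
    also have "\<dots> \<le> ennreal (C * ?q)"
    proof (rule ennreal_leI)
      have "1 = 1 powr (2 * \<alpha> + 1)" by simp
      also have "\<dots> \<le> (3 * (r / (\<bar>x\<bar> + r))) powr (2 * \<alpha> + 1)"
        using True r a by (intro powr_mono2) (auto simp: divide_simps)
      also have "\<dots> = 3 powr (2 * \<alpha> + 1) * ?q" using r by (subst powr_mult) auto
      also have "\<dots> \<le> C * ?q"
        unfolding C_def using c0 by (intro mult_right_mono) auto
      finally show "1 \<le> C * ?q" .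
    qed
    finally show ?thesis .
  next
    case False
    let ?q = "(r / (\<bar>x\<bar> + r)) powr (2 * \<alpha> + 1)"
    define e where "e = (r / \<bar>x\<bar>)\<^sup>2"
    have e: "0 < e" "e \<le> 1" using r x False by (auto simp: e_def power_le_one)
    have "emeasure (geg \<alpha>) {t. rad x z t < r} \<le> emeasure (geg \<alpha>) {1-e..1}"
    proof (rule emeasure_mono_AE)
      show "AE t in geg \<alpha>. t \<in> {t. rad x z t < r} \<longrightarrow> t \<in> {1-e..1}"
        using AE_geg_abs_le[of \<alpha>]
      proof eventually_elim
        case (elim t)
        show ?case
        proof
          assume "t \<in> {t. rad x z t < r}"
          then have t: "rad x z t < r" by simp
          have "\<bar>\<bar>x\<bar> - \<bar>z\<bar>\<bar> < r" using rad_bounds(1)[OF elim, of x z] t by simp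
          then have "\<bar>x\<bar> - \<bar>z\<bar> < r" by (simp only: abs_less_iff)
          then have z2: "\<bar>x\<bar> / 2 \<le> \<bar>z\<bar>" using False by simp
          have "(rad x z t)\<^sup>2 \<le> r\<^sup>2" using t rad_nonneg[OF elim, of x z] by (intro power_mono) auto
          then have "2 * (\<bar>x\<bar> * \<bar>z\<bar>) * (1 - t) \<le> r\<^sup>2"
            unfolding rad_sq_opposite[OF xz elim] by (smt (verit) zero_le_power2)
          moreover have "\<bar>x\<bar> * \<bar>x\<bar> * (1 - t) \<le> 2 * (\<bar>x\<bar> * \<bar>z\<bar>) * (1 - t)"
          proof (rule mult_right_mono)
            have "\<bar>x\<bar> * \<bar>x\<bar> \<le> \<bar>x\<bar> * (2 * \<bar>z\<bar>)" using z2 by (intro mult_left_mono) auto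
            then show "\<bar>x\<bar> * \<bar>x\<bar> \<le> 2 * (\<bar>x\<bar> * \<bar>z\<bar>)" by simp
          qed (use elim in simp)
          ultimately have "\<bar>x\<bar> * \<bar>x\<bar> * (1 - t) \<le> r\<^sup>2" by simp
          moreover have "0 < \<bar>x\<bar> * \<bar>x\<bar>" by (intro mult_pos_pos) (use x in auto)
          ultimately have "1 - t \<le> r\<^sup>2 / (\<bar>x\<bar> * \<bar>x\<bar>)" by (simp only: pos_le_divide_eq mult.commute)
          then have "1 - t \<le> e" by (simp add: e_def power_divide power2_eq_square)
          then show "t \<in> {1-e..1}" using elim by auto
        qed
      qed
    qed auto
    also have "\<dots> \<le> ennreal (c * e powr (\<alpha> + 1/2))" unfolding c_def by (rule emeasure_geg_near_one(1)[OF a e])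
    also have "\<dots> \<le> ennreal (C * ?q)"
    proof (rule ennreal_leI)
      have "e powr (\<alpha> + 1/2) = (r / \<bar>x\<bar>) powr (2 * \<alpha> + 1)"
        unfolding e_def using r x by (subst powr_numeral[symmetric], simp, subst powr_powr) (simp add: distrib_left)
      also have "\<dots> \<le> (3 * (r / (\<bar>x\<bar> + r))) powr (2 * \<alpha> + 1)"
        using False r x a by (intro powr_mono2) (auto simp: divide_simps)
      also have "\<dots> = 3 powr (2 * \<alpha> + 1) * ?q" using r by (subst powr_mult) auto
      finally have "c * e powr (\<alpha> + 1/2) \<le> c * (3 powr (2 * \<alpha> + 1) * ?q)"
        using c0 by (intro mult_left_mono) auto
      also have "\<dots> \<le> C * ?q"
        unfolding C_def by (simp add: distrib_right mult.assoc)
      finally show "c * e powr (\<alpha> + 1/2) \<le> C * ?q" .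
    qed
    finally show ?thesis .
  qed
  \<comment> \<open>Equal signs reduce to opposite signs because the change of t to -t turns the
    centre x into -x.\<close>
  have refl: "emeasure (geg \<alpha>) {t. rad x z t < r} = emeasure (geg \<alpha>) {t. rad (-x) z t < r}" for x z r
  proof -
    have [measurable]: "{t. rad x z t < r} \<in> sets borel" "{t. rad (-x) z t < r} \<in> sets borel" by measurable
    have "emeasure (geg \<alpha>) {t. rad x z t < r} = (\<integral>\<^sup>+t. indicator {t. rad x z t < r} t \<partial>geg \<alpha>)"
      by simp
    also have "\<dots> = (\<integral>\<^sup>+t. indicator {t. rad x z t < r} (-t) \<partial>geg \<alpha>)"
      by (rule nn_integral_geg_reflect[symmetric]) auto
    also have "\<dots> = (\<integral>\<^sup>+t. indicator {t. rad (-x) z t < r} t \<partial>geg \<alpha>)"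
      by (intro nn_integral_cong) (simp add: rad_def split: split_indicator)
    finally show ?thesis by simp
  qed
  show ?thesis
  proof (rule that[OF C])
    fix x z r :: real assume r: "0 < r" and x: "x \<noteq> 0" and z: "z \<noteq> 0"
    show "emeasure (geg \<alpha>) {t. rad x z t < r} \<le> ennreal (C * (r / (\<bar>x\<bar> + r)) powr (2 * \<alpha> + 1))"
    proof (cases "x * z \<le> 0")
      case True then show ?thesis by (rule neg[OF r x z])
    next
      case False then show ?thesis using neg[OF r _ z, of "-x"] x unfolding refl[of x] by simp
    qed
  qed
qed

text \<open>With q = r / (|x| + r), every t in [1 - q^2, 1] gives |x| |y| (1 - t) \<le> r^2 and thus
  squared radius at most 3 r^2, below (3 r)^2. The sign condition puts the small radii near t = 1,
  where the factor 1 + t of \<open>ang\<close> is at least 1; for equal signs they sit near t = -1,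
  where it vanishes.\<close>

lemma ang_rad_lower:
  assumes a: "-1/2 \<le> \<alpha>"
  obtains c where "0 < c" "\<And>x y r. \<lbrakk>0 < r; x * y \<le> 0; \<bar>\<bar>y\<bar> - \<bar>x\<bar>\<bar> < r\<rbrakk> \<Longrightarrow>
     ennreal (c * (r / (\<bar>x\<bar> + r)) powr (2 * \<alpha> + 1)) \<le> emeasure (ang \<alpha>) {t. rad x y t < 3 * r}"
proof (cases "\<alpha> = -1/2")
  case True
  show ?thesis
  proof (rule that[of 1])
    fix x y r :: real assume r: "0 < r" and xy: "x * y \<le> 0" and d: "\<bar>\<bar>y\<bar> - \<bar>x\<bar>\<bar> < r"
    have "\<bar>x + y\<bar> = \<bar>\<bar>y\<bar> - \<bar>x\<bar>\<bar>" using xy by (auto simp: mult_le_0_iff)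
    then have "rad x y 1 < 3 * r" using d r by (simp add: rad_one)
    moreover have "2 * \<alpha> + 1 = 0" using True by simp
    moreover have "r / (\<bar>x\<bar> + r) \<noteq> 0" using r by auto
    moreover have "{t. rad x y t < 3 * r} \<in> sets borel" by measurable
    ultimately show "ennreal (1 * (r / (\<bar>x\<bar> + r)) powr (2 * \<alpha> + 1)) \<le> emeasure (ang \<alpha>) {t. rad x y t < 3 * r}"
      unfolding ang_def if_P[OF True] by (subst emeasure_return) (auto simp: powr_zero_eq_one)
  qed simp
next
  case False
  then have a: "-1/2 < \<alpha>" using a by simp
  define c where "c = 2 * A_alpha \<alpha> * D_alpha \<alpha> * 4 powr (\<alpha> - 1/2) / (\<alpha> + 1/2) * min 1 (2 powr (\<alpha> - 1/2))"
  have c0: "0 < c" unfolding c_def using A_alpha_pos[of \<alpha>] D_alpha_pos[of \<alpha>] a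
    by (intro mult_pos_pos divide_pos_pos) auto
  show ?thesis
  proof (rule that[OF c0])
    fix x y r :: real assume r: "0 < r" and xy: "x * y \<le> 0" and d: "\<bar>\<bar>y\<bar> - \<bar>x\<bar>\<bar> < r"
    have [measurable]: "{t. rad x y t < 3 * r} \<in> sets borel" by measurable
    define q where "q = r / (\<bar>x\<bar> + r)"
    have q: "0 < q" "q \<le> 1" using r by (auto simp: q_def)
    have e: "0 < q\<^sup>2" "q\<^sup>2 \<le> 1" using q by (auto simp: power_le_one)
    have "ennreal (c * q powr (2 * \<alpha> + 1)) = ennreal (c * (q\<^sup>2) powr (\<alpha> + 1/2))"
      using q by (subst powr_numeral[symmetric], simp, subst powr_powr) (simp add: distrib_left)
    also have "\<dots> \<le> emeasure (geg \<alpha>) {1-q\<^sup>2..1}" unfolding c_def by (rule emeasure_geg_near_one(2)[OF a e])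
    also have "\<dots> = (\<integral>\<^sup>+t. indicator {1-q\<^sup>2..1} t \<partial>geg \<alpha>)" by simp
    also have "\<dots> \<le> (\<integral>\<^sup>+t. ennreal (1 + t) * indicator {t. rad x y t < 3 * r} t \<partial>geg \<alpha>)"
    proof (rule nn_integral_mono_AE)
      show "AE t in geg \<alpha>. indicator {1-q\<^sup>2..1} t \<le> ennreal (1 + t) * indicator {t. rad x y t < 3 * r} t"
        using AE_geg_abs_le[of \<alpha>]
      proof eventually_elim
        case (elim t)
        show ?case
        proof (cases "t \<in> {1-q\<^sup>2..1}")
          case True
          then have t: "0 \<le> 1 - t" "1 - t \<le> q\<^sup>2" "0 \<le> t" using e by auto
          have y: "\<bar>y\<bar> \<le> \<bar>x\<bar> + r" using d unfolding abs_less_iff by simp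
          have "(\<bar>x\<bar> * \<bar>y\<bar>) * (1 - t) \<le> ((\<bar>x\<bar> + r) * (\<bar>x\<bar> + r)) * q\<^sup>2"
            using t y r by (intro mult_mono) auto
          also have "\<dots> = r\<^sup>2" using r by (simp add: q_def power2_eq_square)
          finally have 1: "(\<bar>x\<bar> * \<bar>y\<bar>) * (1 - t) \<le> r\<^sup>2" .
          have "\<bar>\<bar>x\<bar> - \<bar>y\<bar>\<bar>\<^sup>2 \<le> r\<^sup>2" using d by (intro power_mono) (auto simp: abs_minus_commute)
          then have "(rad x y t)\<^sup>2 \<le> 3 * r\<^sup>2" unfolding rad_sq_opposite[OF xy elim] using 1 by simp
          also have "\<dots> < (3 * r)\<^sup>2" using r by (simp add: power_mult_distrib)
          finally have "rad x y t < 3 * r" by (rule power2_less_imp_less) (use r in simp)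
          moreover have "1 \<le> ennreal (1 + t)" using t by simp
          ultimately show ?thesis using True by simp
        qed simp
      qed
    qed
    also have "\<dots> = (\<integral>\<^sup>+t. indicator {t. rad x y t < 3 * r} t \<partial>ang \<alpha>)" by (rule nn_integral_ang[symmetric, OF _ a]) auto
    also have "\<dots> = emeasure (ang \<alpha>) {t. rad x y t < 3 * r}" by simp
    finally show "ennreal (c * (r / (\<bar>x\<bar> + r)) powr (2 * \<alpha> + 1)) \<le> emeasure (ang \<alpha>) {t. rad x y t < 3 * r}"
      unfolding q_def .
  qed
qed

section \<open>Translations of even functions\<close>

lemma integral_mu_alpha_symm:
  fixes F :: "real \<Rightarrow> real"
  assumes F: "integrable (mu_alpha \<alpha>) F"
  shows "(\<integral>z. F z \<partial>mu_alpha \<alpha>) = (\<integral>z. (F z + F (- z)) / 2 \<partial>mu_alpha \<alpha>)"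
proof -
  have [measurable]: "F \<in> borel_measurable borel" using borel_measurable_integrable[OF F] by simp
  have "(\<integral>z. (F z + F (- z)) / 2 \<partial>mu_alpha \<alpha>) = ((\<integral>z. F z \<partial>mu_alpha \<alpha>) + (\<integral>z. F (- z) \<partial>mu_alpha \<alpha>)) / 2"
    using F integrable_mu_alpha_reflect[OF F] by simp
  then show ?thesis by (simp add: integral_mu_alpha_reflect)
qed

text \<open>The two terms with z in front are odd in z and cancel. Against an even function the
  signed kernel thus acts like a nonnegative one.\<close>

lemma W_alpha_symm_last: "(W_alpha \<alpha> x y z + W_alpha \<alpha> x y (- z)) / 2 = (1 - sigma_dk x y z) * kappa_alpha \<alpha> x y z"
  by (simp add: W_alpha_def kappa_abs) (simp add: sigma_dk_def field_simps)

text \<open>Here the terms odd in y cancel, leaving 1 + \<open>sigma_dk\<close> z x y. What remains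
  is the nonnegative kernel for the centres -x and z: the adjoint of translation by x is translation
  by -x.\<close>

lemma W_alpha_symm_middle:
  "(W_alpha \<alpha> x y z + W_alpha \<alpha> x (- y) z) / 2 = (1 - sigma_dk (- x) z y) * kappa_alpha \<alpha> (- x) z y"
proof -
  have "sigma_dk x (-y) z = - sigma_dk x y z" "sigma_dk z x (-y) = sigma_dk z x y" "sigma_dk z (-y) x = - sigma_dk z y x"
      "sigma_dk (-x) z y = - sigma_dk z x y"
    by (simp_all add: sigma_dk_def) (simp add: field_simps)
  then show ?thesis by (simp add: W_alpha_def kappa_abs kappa_rotate[of \<alpha> x z y]) (simp add: field_simps)
qed

lemma nn_integral_kappa_one:
  assumes "-1/2 < \<alpha>" "x \<noteq> 0" "y \<noteq> 0"
  shows "(\<integral>\<^sup>+z. ennreal (kappa_alpha \<alpha> x y z) \<partial>mu_alpha \<alpha>) = 1"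
  using nn_integral_kappa[OF _ assms, of "\<lambda>_. 1"] emeasure_geg[OF assms(1)] by simp

lemma integrable_W_alpha:
  assumes a: "-1/2 < \<alpha>" and x: "x \<noteq> 0" and y: "y \<noteq> 0"
  shows "integrable (mu_alpha \<alpha>) (W_alpha \<alpha> x y)"
proof (rule integrableI_bounded)
  have "(\<integral>\<^sup>+z. ennreal (norm (W_alpha \<alpha> x y z)) \<partial>mu_alpha \<alpha>) \<le> (\<integral>\<^sup>+z. 4 * ennreal (kappa_alpha \<alpha> x y z) \<partial>mu_alpha \<alpha>)"
    using sigma_kappa_bounds(3)[OF a, of x y] kappa_nonneg[OF a, of x y]
    by (intro nn_integral_mono) (simp add: ennreal_mult'[symmetric] ennreal_leI flip: ennreal_numeral)
  also have "\<dots> = 4" using nn_integral_kappa_one[OF assms] by (subst nn_integral_cmult) auto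
  also have "\<dots> < \<infinity>" by simp
  finally show "(\<integral>\<^sup>+z. ennreal (norm (W_alpha \<alpha> x y z)) \<partial>mu_alpha \<alpha>) < \<infinity>" .
qed measurable

text \<open>Symmetrising a Bochner integral requires integrability first. The bound B on the range
  of the radius provides it, as |W| has finite mass and lives over that range.\<close>

lemma integral_even_W_alpha:
  assumes a: "-1/2 < \<alpha>" and x: "x \<noteq> 0" and y: "y \<noteq> 0"
    and [measurable]: "h \<in> borel_measurable borel" and h0: "\<And>s. 0 \<le> h s" and even: "\<And>s. h \<bar>s\<bar> = h s"
    and hB: "\<And>s. \<lbrakk>\<bar>\<bar>x\<bar> - \<bar>y\<bar>\<bar> \<le> s; s \<le> \<bar>x\<bar> + \<bar>y\<bar>\<rbrakk> \<Longrightarrow> h s \<le> B"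
  shows "(\<integral>z. h z * W_alpha \<alpha> x y z \<partial>mu_alpha \<alpha>) = (\<integral>t. h (rad x y t) \<partial>ang \<alpha>)"
proof -
  have "integrable (mu_alpha \<alpha>) (\<lambda>z. h z * W_alpha \<alpha> x y z)"
  proof (rule Bochner_Integration.integrable_bound[of _ "\<lambda>z. B * W_alpha \<alpha> x y z"])
    show "integrable (mu_alpha \<alpha>) (\<lambda>z. B * W_alpha \<alpha> x y z)" using integrable_W_alpha[OF a x y] by simp
    show "AE z in mu_alpha \<alpha>. norm (h z * W_alpha \<alpha> x y z) \<le> norm (B * W_alpha \<alpha> x y z)"
    proof (rule AE_I2)
      fix z show "norm (h z * W_alpha \<alpha> x y z) \<le> norm (B * W_alpha \<alpha> x y z)"
      proof (cases "kappa_alpha \<alpha> x y z = 0")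
        case False
        have "h z \<le> B" using hB[OF kappa_support(1,2)[OF False]] even by simp
        then show ?thesis using h0[of z] by (simp add: abs_mult mult_right_mono)
      qed (simp add: W_alpha_def)
    qed
  qed measurable
  then have "(\<integral>z. h z * W_alpha \<alpha> x y z \<partial>mu_alpha \<alpha>) = (\<integral>z. (h z * W_alpha \<alpha> x y z + h (-z) * W_alpha \<alpha> x y (-z)) / 2 \<partial>mu_alpha \<alpha>)"
    by (rule integral_mu_alpha_symm)
  also have "\<dots> = (\<integral>z. h z * ((1 - sigma_dk x y z) * kappa_alpha \<alpha> x y z) \<partial>mu_alpha \<alpha>)"
  proof (rule Bochner_Integration.integral_cong[OF refl])
    fix z have "h (-z) = h z" using even[of "-z"] even[of z] by simp
    then show "(h z * W_alpha \<alpha> x y z + h (-z) * W_alpha \<alpha> x y (-z)) / 2 = h z * ((1 - sigma_dk x y z) * kappa_alpha \<alpha> x y z)"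
      unfolding W_alpha_symm_last[symmetric] by (simp add: distrib_left)
  qed
  also have "\<dots> = enn2real (\<integral>\<^sup>+z. ennreal (h z * ((1 - sigma_dk x y z) * kappa_alpha \<alpha> x y z)) \<partial>mu_alpha \<alpha>)"
    using h0 sigma_kappa_bounds(1)[OF a] by (intro integral_eq_nn_integral) auto
  also have "(\<integral>\<^sup>+z. ennreal (h z * ((1 - sigma_dk x y z) * kappa_alpha \<alpha> x y z)) \<partial>mu_alpha \<alpha>)
     = (\<integral>\<^sup>+z. ennreal (h \<bar>z\<bar>) * ennreal ((1 - sigma_dk x y z) * kappa_alpha \<alpha> x y z) \<partial>mu_alpha \<alpha>)"
    using h0 sigma_kappa_bounds(1)[OF a] by (intro nn_integral_cong) (simp add: even ennreal_mult)
  also have "\<dots> = (\<integral>\<^sup>+t. ennreal (h (rad x y t)) \<partial>ang \<alpha>)"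
    by (rule nn_integral_kappa_sigma[OF _ a x y]) measurable
  also have "enn2real \<dots> = (\<integral>t. h (rad x y t) \<partial>ang \<alpha>)"
    using h0 by (intro integral_eq_nn_integral[symmetric]) auto
  finally show ?thesis .
qed

text \<open>Translation preserves constants, so a constant can be subtracted under the translation
  integral.\<close>

lemma integral_W_alpha:
  assumes a: "-1/2 < \<alpha>" and x: "x \<noteq> 0" and y: "y \<noteq> 0"
  shows "(\<integral>z. W_alpha \<alpha> x y z \<partial>mu_alpha \<alpha>) = 1"
proof -
  interpret prob_space "ang \<alpha>" by (rule prob_space_ang) (use a in simp)
  show ?thesis using integral_even_W_alpha[OF assms, of "\<lambda>_. 1" 1] prob_space by simp
qed

text \<open>Boundedness is asked only between ||x| - |y|| and |x| + |y|, which admits kernels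
  singular at 0 whenever |x| and |y| differ.\<close>

lemma dunkl_trans_even:
  assumes a: "-1/2 \<le> \<alpha>" and y: "y \<noteq> 0"
    and h [measurable]: "h \<in> borel_measurable borel" and h0: "\<And>s. 0 \<le> h s" and even: "\<And>s. h \<bar>s\<bar> = h s"
    and hB: "\<And>s. \<lbrakk>\<bar>\<bar>x\<bar> - \<bar>y\<bar>\<bar> \<le> s; s \<le> \<bar>x\<bar> + \<bar>y\<bar>\<rbrakk> \<Longrightarrow> h s \<le> B"
  shows "dunkl_trans \<alpha> x h y = (\<integral>t. h (rad x y t) \<partial>ang \<alpha>)"
proof (cases "\<alpha> = -1/2")
  case True
  have "dunkl_trans \<alpha> x h y = h (x + y)" by (simp add: dunkl_trans_def True)
  also have "\<dots> = (\<integral>t. h (rad x y t) \<partial>ang \<alpha>)"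
    unfolding ang_def if_P[OF True] by (subst integral_return) (auto simp: rad_one even)
  finally show ?thesis .
next
  case False
  then have a': "-1/2 < \<alpha>" using a by simp
  interpret prob_space "ang \<alpha>" by (rule prob_space_ang[OF a])
  show ?thesis
  proof (cases "x = 0")
    case True then show ?thesis using False prob_space by (simp add: dunkl_trans_def rad_zero even)
  next
    case x: False
    show ?thesis using integral_even_W_alpha[OF a' x y h h0 even hB] False x y by (simp add: dunkl_trans_def)
  qed
qed

lemma nn_integral_mu_half:
  assumes [measurable]: "f \<in> borel_measurable borel"
  shows "(\<integral>\<^sup>+x. f x \<partial>mu_alpha (-1/2)) = ennreal (A_alpha (-1/2)) * (\<integral>\<^sup>+x. f x \<partial>lborel)"
proof -
  have "(\<integral>\<^sup>+x. f x \<partial>mu_alpha (-1/2)) = (\<integral>\<^sup>+x. ennreal (A_alpha (-1/2)) * f x \<partial>lborel)"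
    \<comment> \<open>The density contains |x| powr 0, which is 1 except at x = 0, where
      \<open>powr\<close> gives 0.\<close>
    using AE_lborel_singleton[of 0]
    by (subst nn_integral_mu_alpha) (auto intro!: nn_integral_cong_AE elim!: eventually_mono)
  then show ?thesis by (simp add: nn_integral_cmult)
qed

lemma nn_integral_mu_half_shift:
  assumes [measurable]: "f \<in> borel_measurable borel"
  shows "(\<integral>\<^sup>+x. f (a + x) \<partial>mu_alpha (-1/2)) = (\<integral>\<^sup>+x. f x \<partial>mu_alpha (-1/2))"
proof -
  have [measurable]: "(\<lambda>x. f (a + x)) \<in> borel_measurable borel" by measurable
  show ?thesis
    unfolding nn_integral_mu_half[OF assms] nn_integral_mu_half[OF \<open>(\<lambda>x. f (a + x)) \<in> borel_measurable borel\<close>]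
    by (simp add: nn_integral_real_affine[of f 1 a])
qed

text \<open>Tonelli in the centre z and the radius s. By the symmetry of \<open>kappa_alpha\<close>,
  integrating z out leaves mass one; the factor 2 is the price of passing from \<open>ang\<close> to
  \<open>geg\<close>.\<close>

lemma nn_integral_rad_le:
  fixes h :: "real \<Rightarrow> ennreal"
  assumes a: "-1/2 \<le> \<alpha>" and y: "y \<noteq> 0" and h [measurable]: "h \<in> borel_measurable borel"
  shows "(\<integral>\<^sup>+z. (\<integral>\<^sup>+t. h (rad z y t) \<partial>ang \<alpha>) \<partial>mu_alpha \<alpha>) \<le> 2 * (\<integral>\<^sup>+s. h \<bar>s\<bar> \<partial>mu_alpha \<alpha>)"
proof (cases "\<alpha> = -1/2")
  case True
  have "(\<integral>\<^sup>+z. (\<integral>\<^sup>+t. h (rad z y t) \<partial>ang \<alpha>) \<partial>mu_alpha \<alpha>) = (\<integral>\<^sup>+z. h \<bar>y + z\<bar> \<partial>mu_alpha \<alpha>)"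
    unfolding ang_def if_P[OF True] by (intro nn_integral_cong, subst nn_integral_return) (auto simp: rad_one add.commute)
  also have "\<dots> = (\<integral>\<^sup>+z. h \<bar>z\<bar> \<partial>mu_alpha \<alpha>)"
    unfolding True by (rule nn_integral_mu_half_shift[of "\<lambda>z. h \<bar>z\<bar>"]) measurable
  also have "\<dots> \<le> 2 * (\<integral>\<^sup>+s. h \<bar>s\<bar> \<partial>mu_alpha \<alpha>)"
    using mult_right_mono[of 1 2 "\<integral>\<^sup>+s. h \<bar>s\<bar> \<partial>mu_alpha \<alpha>"] by simp
  finally show ?thesis .
next
  case False
  then have a: "-1/2 < \<alpha>" using a by simp
  interpret M: sigma_finite_measure "mu_alpha \<alpha>" by (rule sigma_finite_mu_alpha)
  interpret P: pair_sigma_finite "mu_alpha \<alpha>" "mu_alpha \<alpha>" ..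
  have "(\<integral>\<^sup>+z. (\<integral>\<^sup>+t. h (rad z y t) \<partial>ang \<alpha>) \<partial>mu_alpha \<alpha>) \<le> (\<integral>\<^sup>+z. (\<integral>\<^sup>+s. 2 * (h \<bar>s\<bar> * ennreal (kappa_alpha \<alpha> z y s)) \<partial>mu_alpha \<alpha>) \<partial>mu_alpha \<alpha>)"
  proof (rule nn_integral_mono_AE)
    show "AE z in mu_alpha \<alpha>. (\<integral>\<^sup>+t. h (rad z y t) \<partial>ang \<alpha>) \<le> (\<integral>\<^sup>+s. 2 * (h \<bar>s\<bar> * ennreal (kappa_alpha \<alpha> z y s)) \<partial>mu_alpha \<alpha>)"
      using AE_mu_alpha_neq[of 0 \<alpha>]
    proof eventually_elim
      case (elim z)
      have "(\<integral>\<^sup>+t. h (rad z y t) \<partial>ang \<alpha>) \<le> 2 * (\<integral>\<^sup>+t. h (rad z y t) \<partial>geg \<alpha>)" by (rule ang_le_geg[OF a]) measurable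
      also have "\<dots> = 2 * (\<integral>\<^sup>+s. h \<bar>s\<bar> * ennreal (kappa_alpha \<alpha> z y s) \<partial>mu_alpha \<alpha>)"
        by (simp add: nn_integral_kappa[OF h a elim y])
      also have "\<dots> = (\<integral>\<^sup>+s. 2 * (h \<bar>s\<bar> * ennreal (kappa_alpha \<alpha> z y s)) \<partial>mu_alpha \<alpha>)"
        by (rule nn_integral_cmult[symmetric]) measurable
      finally show ?case .
    qed
  qed
  also have "\<dots> = (\<integral>\<^sup>+s. (\<integral>\<^sup>+z. 2 * (h \<bar>s\<bar> * ennreal (kappa_alpha \<alpha> z y s)) \<partial>mu_alpha \<alpha>) \<partial>mu_alpha \<alpha>)"
    by (rule P.Fubini') measurable
  also have "\<dots> = (\<integral>\<^sup>+s. 2 * h \<bar>s\<bar> \<partial>mu_alpha \<alpha>)"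
  proof (rule nn_integral_cong_AE)
    show "AE s in mu_alpha \<alpha>. (\<integral>\<^sup>+z. 2 * (h \<bar>s\<bar> * ennreal (kappa_alpha \<alpha> z y s)) \<partial>mu_alpha \<alpha>) = 2 * h \<bar>s\<bar>"
      using AE_mu_alpha_neq[of 0 \<alpha>]
    proof eventually_elim
      case (elim s)
      have "kappa_alpha \<alpha> z y s = kappa_alpha \<alpha> y s z" for z
        by (metis kappa_commute kappa_rotate)
      then show ?case using nn_integral_kappa_one[OF a y elim]
        by (simp add: mult.assoc[symmetric] nn_integral_cmult)
    qed
  qed
  also have "\<dots> = 2 * (\<integral>\<^sup>+s. h \<bar>s\<bar> \<partial>mu_alpha \<alpha>)" by (rule nn_integral_cmult) measurable
  finally show ?thesis .
qed

lemma loc_integrable_nn_finite: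
  assumes "loc_integrable_dk \<alpha> f"
  shows "f \<in> borel_measurable borel" and "(\<integral>\<^sup>+z. ennreal \<bar>f z\<bar> * indicator {-r<..<r} z \<partial>mu_alpha \<alpha>) < \<infinity>"
proof -
  have i: "integrable (mu_alpha \<alpha>) (\<lambda>z. indicator {-s<..<s} z * f z)" if "0 < s" for s
    using assms that by (simp add: loc_integrable_dk_def set_integrable_def)
  show "f \<in> borel_measurable borel"
  proof (rule borel_measurable_LIMSEQ_real)
    fix x
    have "\<forall>\<^sub>F n in sequentially. indicator {- real (Suc n)<..<real (Suc n)} x * f x = f x"
    proof -
      obtain N where N: "\<bar>x\<bar> < real N" using reals_Archimedean2 by blast
      show ?thesis using eventually_ge_at_top[of N] by eventually_elim (use N in \<open>auto simp: indicator_def\<close>)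
    qed
    then show "(\<lambda>n. indicator {- real (Suc n)<..<real (Suc n)} x * f x) \<longlonglongrightarrow> f x"
      by (rule tendsto_eventually)
  next
    fix n show "(\<lambda>x. indicator {- real (Suc n)<..<real (Suc n)} x * f x) \<in> borel_measurable borel"
      using borel_measurable_integrable[OF i[of "real (Suc n)"]] by simp
  qed
  show "(\<integral>\<^sup>+z. ennreal \<bar>f z\<bar> * indicator {-r<..<r} z \<partial>mu_alpha \<alpha>) < \<infinity>"
  proof (cases "0 < r")
    case True
    have "(\<integral>\<^sup>+z. ennreal \<bar>f z\<bar> * indicator {-r<..<r} z \<partial>mu_alpha \<alpha>) = (\<integral>\<^sup>+z. ennreal (norm (indicator {-r<..<r} z * f z)) \<partial>mu_alpha \<alpha>)"
      by (intro nn_integral_cong) (auto split: split_indicator)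
    also have "\<dots> < \<infinity>" using i[OF True] by (simp add: integrable_iff_bounded)
    finally show ?thesis .
  qed simp
qed

section \<open>The Morrey condition in angular form\<close>

lemma measurable_emeasure_ang_rad [measurable]:
  assumes a: "-1/2 \<le> \<alpha>"
  shows "(\<lambda>z. emeasure (ang \<alpha>) {t. rad x z t < u}) \<in> borel_measurable borel"
proof -
  interpret prob_space "ang \<alpha>" by (rule prob_space_ang[OF a])
  have [measurable]: "{t. rad x z t < u} \<in> sets borel" for z by measurable
  have "(\<lambda>z. emeasure (ang \<alpha>) {t. rad x z t < u}) = (\<lambda>z. \<integral>\<^sup>+t. indicator {..<u} (rad x z t) \<partial>ang \<alpha>)"
  proof
    fix z
    have "(\<integral>\<^sup>+t. indicator {..<u} (rad x z t) \<partial>ang \<alpha>) = (\<integral>\<^sup>+t. indicator {t. rad x z t < u} t \<partial>ang \<alpha>)"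
      by (intro nn_integral_cong) (simp split: split_indicator)
    then show "emeasure (ang \<alpha>) {t. rad x z t < u} = (\<integral>\<^sup>+t. indicator {..<u} (rad x z t) \<partial>ang \<alpha>)" by simp
  qed
  then show ?thesis by simp
qed

lemma nn_integral_morrey_half:
  assumes loc: "loc_integrable_dk (-1/2) f" and u: "0 < u"
  shows "(\<integral>\<^sup>+z. ennreal \<bar>f z\<bar> * emeasure (ang (-1/2)) {t. rad (-x) z t < u} \<partial>mu_alpha (-1/2))
    = ennreal (LINT y:{-u<..<u}|mu_alpha (-1/2). dunkl_trans (-1/2) x (\<lambda>z. \<bar>f z\<bar>) y)"
proof -
  have [measurable]: "f \<in> borel_measurable borel" by (rule loc_integrable_nn_finite(1)[OF loc])
  have L: "(\<integral>\<^sup>+z. ennreal \<bar>f z\<bar> * emeasure (ang (-1/2)) {t. rad (-x) z t < u} \<partial>mu_alpha (-1/2))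
     = (\<integral>\<^sup>+z. ennreal \<bar>f z\<bar> * indicator {-u<..<u} (z - x) \<partial>mu_alpha (-1/2))"
  proof (intro nn_integral_cong arg_cong2[where f="(*)"] refl)
    fix z
    have [measurable]: "{t. rad (-x) z t < u} \<in> sets borel" by measurable
    have "ang (-1/2) = return borel 1" by (simp add: ang_def)
    then show "emeasure (ang (-1/2)) {t. rad (-x) z t < u} = indicator {-u<..<u} (z - x)"
      by (auto simp: rad_one indicator_def abs_less_iff)
  qed
  also have "\<dots> = (\<integral>\<^sup>+y. ennreal \<bar>f (x + y)\<bar> * indicator {-u<..<u} ((x + y) - x) \<partial>mu_alpha (-1/2))"
    by (rule nn_integral_mu_half_shift[symmetric]) measurable
  also have "\<dots> = (\<integral>\<^sup>+y. ennreal (indicator {-u<..<u} y * \<bar>f (x + y)\<bar>) \<partial>mu_alpha (-1/2))"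
    by (intro nn_integral_cong) (auto split: split_indicator)
  finally have eq: "(\<integral>\<^sup>+z. ennreal \<bar>f z\<bar> * emeasure (ang (-1/2)) {t. rad (-x) z t < u} \<partial>mu_alpha (-1/2))
     = (\<integral>\<^sup>+y. ennreal (indicator {-u<..<u} y * \<bar>f (x + y)\<bar>) \<partial>mu_alpha (-1/2))" .
  have "(\<integral>\<^sup>+z. ennreal \<bar>f z\<bar> * indicator {-u<..<u} (z - x) \<partial>mu_alpha (-1/2))
    \<le> (\<integral>\<^sup>+z. ennreal \<bar>f z\<bar> * indicator {-(\<bar>x\<bar> + u)<..<\<bar>x\<bar> + u} z \<partial>mu_alpha (-1/2))"
    by (intro nn_integral_mono mult_left_mono) (auto split: split_indicator)
  also have "\<dots> < \<infinity>" by (rule loc_integrable_nn_finite(2)[OF loc])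
  finally have fin: "(\<integral>\<^sup>+y. ennreal (indicator {-u<..<u} y * \<bar>f (x + y)\<bar>) \<partial>mu_alpha (-1/2)) < \<infinity>"
    unfolding eq[symmetric] L .
  have "integrable (mu_alpha (-1/2)) (\<lambda>y. indicator {-u<..<u} y * \<bar>f (x + y)\<bar>)"
    using fin by (intro integrableI_nonneg) auto
  then have "(\<integral>\<^sup>+y. ennreal (indicator {-u<..<u} y * \<bar>f (x + y)\<bar>) \<partial>mu_alpha (-1/2)) = ennreal (\<integral>y. indicator {-u<..<u} y * \<bar>f (x + y)\<bar> \<partial>mu_alpha (-1/2))"
    by (intro nn_integral_eq_integral) auto
  then show ?thesis unfolding eq by (simp add: set_lebesgue_integral_def dunkl_trans_def)
qed

lemma nn_integral_morrey_zero:
  assumes a: "-1/2 < \<alpha>" and loc: "loc_integrable_dk \<alpha> f" and u: "0 < u"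
  shows "(\<integral>\<^sup>+z. ennreal \<bar>f z\<bar> * emeasure (ang \<alpha>) {t. rad (-0) z t < u} \<partial>mu_alpha \<alpha>)
    = ennreal (LINT y:{-u<..<u}|mu_alpha \<alpha>. dunkl_trans \<alpha> 0 (\<lambda>z. \<bar>f z\<bar>) y)"
proof -
  interpret prob_space "ang \<alpha>" by (rule prob_space_ang) (use a in simp)
  have [measurable]: "f \<in> borel_measurable borel" by (rule loc_integrable_nn_finite(1)[OF loc])
  have e: "emeasure (ang \<alpha>) {t. rad (-0) z t < u} = indicator {-u<..<u} z" for z
    using emeasure_space_1 by (auto simp: rad_zero indicator_def abs_less_iff)
  have eq: "(\<integral>\<^sup>+z. ennreal \<bar>f z\<bar> * emeasure (ang \<alpha>) {t. rad (-0) z t < u} \<partial>mu_alpha \<alpha>)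
     = (\<integral>\<^sup>+z. ennreal (indicator {-u<..<u} z * \<bar>f z\<bar>) \<partial>mu_alpha \<alpha>)"
    unfolding e by (intro nn_integral_cong) (auto split: split_indicator)
  have "integrable (mu_alpha \<alpha>) (\<lambda>z. indicator {-u<..<u} z * \<bar>f z\<bar>)"
    using loc_integrable_nn_finite(2)[OF loc, of u] unfolding e[symmetric] eq by (intro integrableI_nonneg) auto
  then show ?thesis unfolding eq using a
    by (subst nn_integral_eq_integral) (auto simp: set_lebesgue_integral_def dunkl_trans_def)
qed

text \<open>A symmetric interval sees only the part of the kernel even in y, which is the angular
  average with centres -x and z.\<close>

lemma integral_ball_W_alpha:
  assumes a: "-1/2 < \<alpha>" and x: "x \<noteq> 0" and z: "z \<noteq> 0"
  shows "(\<integral>y. indicator {-u<..<u} y * W_alpha \<alpha> x y z \<partial>mu_alpha \<alpha>) = measure (ang \<alpha>) {t. rad (-x) z t < u}"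
proof -
  have k: "kappa_alpha \<alpha> x y z = kappa_alpha \<alpha> (-x) z y" for y by (simp add: kappa_abs kappa_rotate[of \<alpha> x y])
  have [measurable]: "{t. rad (-x) z t < u} \<in> sets borel" by measurable
  have "integrable (mu_alpha \<alpha>) (\<lambda>y. indicator {-u<..<u} y * W_alpha \<alpha> x y z)"
  proof (rule integrableI_bounded)
    have "(\<integral>\<^sup>+y. ennreal (norm (indicator {-u<..<u} y * W_alpha \<alpha> x y z)) \<partial>mu_alpha \<alpha>)
       \<le> (\<integral>\<^sup>+y. 4 * ennreal (kappa_alpha \<alpha> (-x) z y) \<partial>mu_alpha \<alpha>)"
    proof (intro nn_integral_mono)
      fix y
      have "\<bar>W_alpha \<alpha> x y z\<bar> \<le> 4 * kappa_alpha \<alpha> (-x) z y" using sigma_kappa_bounds(3)[OF a, of x y z] unfolding k .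
      then have "ennreal \<bar>W_alpha \<alpha> x y z\<bar> \<le> 4 * ennreal (kappa_alpha \<alpha> (-x) z y)"
        using kappa_nonneg[OF a] by (simp add: ennreal_mult'[symmetric] ennreal_leI flip: ennreal_numeral)
      then show "ennreal (norm (indicator {-u<..<u} y * W_alpha \<alpha> x y z)) \<le> 4 * ennreal (kappa_alpha \<alpha> (-x) z y)"
        by (auto split: split_indicator)
    qed
    also have "\<dots> = 4" using nn_integral_kappa_one[OF a, of "-x" z] x z by (subst nn_integral_cmult) auto
    also have "\<dots> < \<infinity>" by simp
    finally show "(\<integral>\<^sup>+y. ennreal (norm (indicator {-u<..<u} y * W_alpha \<alpha> x y z)) \<partial>mu_alpha \<alpha>) < \<infinity>" .
  qed measurable
  then have "(\<integral>y. indicator {-u<..<u} y * W_alpha \<alpha> x y z \<partial>mu_alpha \<alpha>)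
     = (\<integral>y. (indicator {-u<..<u} y * W_alpha \<alpha> x y z + indicator {-u<..<u} (-y) * W_alpha \<alpha> x (-y) z) / 2 \<partial>mu_alpha \<alpha>)"
    by (rule integral_mu_alpha_symm)
  also have "\<dots> = (\<integral>y. indicator {..<u} \<bar>y\<bar> * ((1 - sigma_dk (-x) z y) * kappa_alpha \<alpha> (-x) z y) \<partial>mu_alpha \<alpha>)"
    by (intro Bochner_Integration.integral_cong refl, subst W_alpha_symm_middle[symmetric]) (auto simp: indicator_def)
  also have "\<dots> = enn2real (\<integral>\<^sup>+y. ennreal (indicator {..<u} \<bar>y\<bar> * ((1 - sigma_dk (-x) z y) * kappa_alpha \<alpha> (-x) z y)) \<partial>mu_alpha \<alpha>)"
    using sigma_kappa_bounds(1)[OF a] by (intro integral_eq_nn_integral) (auto intro!: mult_nonneg_nonneg[of "indicator _ _"])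
  also have "(\<integral>\<^sup>+y. ennreal (indicator {..<u} \<bar>y\<bar> * ((1 - sigma_dk (-x) z y) * kappa_alpha \<alpha> (-x) z y)) \<partial>mu_alpha \<alpha>)
     = (\<integral>\<^sup>+y. indicator {..<u} \<bar>y\<bar> * ennreal ((1 - sigma_dk (-x) z y) * kappa_alpha \<alpha> (-x) z y) \<partial>mu_alpha \<alpha>)"
    by (intro nn_integral_cong) (auto split: split_indicator)
  also have "\<dots> = (\<integral>\<^sup>+t. indicator {..<u} (rad (-x) z t) \<partial>ang \<alpha>)"
    by (rule nn_integral_kappa_sigma[OF _ a]) (use x z in auto)
  also have "\<dots> = (\<integral>\<^sup>+t. indicator {t. rad (-x) z t < u} t \<partial>ang \<alpha>)"
    by (intro nn_integral_cong) (auto split: split_indicator)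
  also have "\<dots> = emeasure (ang \<alpha>) {t. rad (-x) z t < u}" by simp
  finally show ?thesis by (simp add: measure_def)
qed

text \<open>Fubini for a signed kernel: |W| \<le> 4 \<open>kappa_alpha\<close>, and |y| < u confines
  z to |z| < |x| + u, where f is integrable. Integrating over y first then leaves a nonnegative
  angular measure.\<close>

lemma nn_integral_morrey_nonzero:
  assumes a: "-1/2 < \<alpha>" and x: "x \<noteq> 0" and loc: "loc_integrable_dk \<alpha> f" and u: "0 < u"
  shows "(\<integral>\<^sup>+z. ennreal \<bar>f z\<bar> * emeasure (ang \<alpha>) {t. rad (-x) z t < u} \<partial>mu_alpha \<alpha>)
    = ennreal (LINT y:{-u<..<u}|mu_alpha \<alpha>. dunkl_trans \<alpha> x (\<lambda>z. \<bar>f z\<bar>) y)"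
proof -
  let ?B = "{-(\<bar>x\<bar>+u)<..<\<bar>x\<bar>+u}" and ?m = "\<lambda>z. measure (ang \<alpha>) {t. rad (-x) z t < u}"
  interpret A: prob_space "ang \<alpha>" by (rule prob_space_ang) (use a in simp)
  interpret M: sigma_finite_measure "mu_alpha \<alpha>" by (rule sigma_finite_mu_alpha)
  interpret P: pair_sigma_finite "mu_alpha \<alpha>" "mu_alpha \<alpha>" ..
  have [measurable]: "f \<in> borel_measurable borel" by (rule loc_integrable_nn_finite(1)[OF loc])
  let ?F = "\<lambda>y z. indicator {-u<..<u} y * (\<bar>f z\<bar> * W_alpha \<alpha> x y z)"
  have k: "kappa_alpha \<alpha> x y z = kappa_alpha \<alpha> x z y" for y z by (rule kappa_rotate)
  have "(\<integral>\<^sup>+w. ennreal (norm (case w of (y, z) \<Rightarrow> ?F y z)) \<partial>(mu_alpha \<alpha> \<Otimes>\<^sub>M mu_alpha \<alpha>))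
     \<le> (\<integral>\<^sup>+w. (case w of (y, z) \<Rightarrow> 4 * (ennreal \<bar>f z\<bar> * indicator ?B z * ennreal (kappa_alpha \<alpha> x z y))) \<partial>(mu_alpha \<alpha> \<Otimes>\<^sub>M mu_alpha \<alpha>))"
  proof (intro nn_integral_mono, clarify)
    fix y z
    show "ennreal (norm (?F y z)) \<le> 4 * (ennreal \<bar>f z\<bar> * indicator ?B z * ennreal (kappa_alpha \<alpha> x z y))"
    proof (cases "y \<in> {-u<..<u} \<and> kappa_alpha \<alpha> x y z \<noteq> 0")
      case True
      then have y: "\<bar>y\<bar> < u" and "kappa_alpha \<alpha> x y z \<noteq> 0" by auto
      from kappa_support(2)[OF this(2)] y have "\<bar>z\<bar> < \<bar>x\<bar> + u" by simp
      then have z: "z \<in> ?B" by (auto simp: abs_less_iff)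
      have "\<bar>f z\<bar> * \<bar>W_alpha \<alpha> x y z\<bar> \<le> \<bar>f z\<bar> * (4 * kappa_alpha \<alpha> x z y)"
        using sigma_kappa_bounds(3)[OF a, of x y z] unfolding k[of y] by (intro mult_left_mono) auto
      then have "ennreal (\<bar>f z\<bar> * \<bar>W_alpha \<alpha> x y z\<bar>) \<le> ennreal (4 * (\<bar>f z\<bar> * kappa_alpha \<alpha> x z y))"
        by (intro ennreal_leI) (simp add: mult_ac)
      also have "\<dots> = 4 * (ennreal \<bar>f z\<bar> * ennreal (kappa_alpha \<alpha> x z y))"
        using kappa_nonneg[OF a, of x z y] by (simp add: ennreal_mult)
      finally show ?thesis using True z by (simp add: abs_mult)
    next
      case False then show ?thesis by (auto simp: W_alpha_def)
    qed
  qed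
  also have "\<dots> = (\<integral>\<^sup>+z. (\<integral>\<^sup>+y. 4 * (ennreal \<bar>f z\<bar> * indicator ?B z * ennreal (kappa_alpha \<alpha> x z y)) \<partial>mu_alpha \<alpha>) \<partial>mu_alpha \<alpha>)"
    by (subst P.nn_integral_snd[symmetric]) auto
  also have "\<dots> = (\<integral>\<^sup>+z. 4 * (ennreal \<bar>f z\<bar> * indicator ?B z) \<partial>mu_alpha \<alpha>)"
  proof (rule nn_integral_cong_AE)
    show "AE z in mu_alpha \<alpha>. (\<integral>\<^sup>+y. 4 * (ennreal \<bar>f z\<bar> * indicator ?B z * ennreal (kappa_alpha \<alpha> x z y)) \<partial>mu_alpha \<alpha>)
        = 4 * (ennreal \<bar>f z\<bar> * indicator ?B z)"
      using AE_mu_alpha_neq[of 0 \<alpha>]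
    proof eventually_elim
      case (elim z)
      show ?case using nn_integral_kappa_one[OF a x elim] by (simp add: mult.assoc[symmetric] nn_integral_cmult)
    qed
  qed
  also have "\<dots> = 4 * (\<integral>\<^sup>+z. ennreal \<bar>f z\<bar> * indicator ?B z \<partial>mu_alpha \<alpha>)"
    by (rule nn_integral_cmult) measurable
  also have "\<dots> < \<infinity>" using loc_integrable_nn_finite(2)[OF loc, of "\<bar>x\<bar>+u"] by (simp add: ennreal_mult_less_top)
  finally have int: "integrable (mu_alpha \<alpha> \<Otimes>\<^sub>M mu_alpha \<alpha>) (\<lambda>(y, z). ?F y z)"
    by (intro integrableI_bounded) (auto simp: case_prod_beta')
  have "(LINT y:{-u<..<u}|mu_alpha \<alpha>. dunkl_trans \<alpha> x (\<lambda>z. \<bar>f z\<bar>) y) = (\<integral>y. (\<integral>z. ?F y z \<partial>mu_alpha \<alpha>) \<partial>mu_alpha \<alpha>)"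
    unfolding set_lebesgue_integral_def
  proof (rule integral_cong_AE)
    show "(\<lambda>y. indicator {-u<..<u} y *\<^sub>R dunkl_trans \<alpha> x (\<lambda>z. \<bar>f z\<bar>) y) \<in> borel_measurable (mu_alpha \<alpha>)"
      unfolding dunkl_trans_def by measurable
    show "AE y in mu_alpha \<alpha>. indicator {-u<..<u} y *\<^sub>R dunkl_trans \<alpha> x (\<lambda>z. \<bar>f z\<bar>) y = (\<integral>z. ?F y z \<partial>mu_alpha \<alpha>)"
      using AE_mu_alpha_neq[of 0 \<alpha>]
    proof eventually_elim
      case (elim y)
      then show ?case using a x by (simp add: dunkl_trans_def)
    qed
  qed measurable
  also have "\<dots> = (\<integral>z. (\<integral>y. ?F y z \<partial>mu_alpha \<alpha>) \<partial>mu_alpha \<alpha>)"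
    by (rule P.Fubini_integral[symmetric, OF int])
  also have "\<dots> = (\<integral>z. \<bar>f z\<bar> * ?m z \<partial>mu_alpha \<alpha>)"
  proof (rule integral_cong_AE)
    show "(\<lambda>z. \<bar>f z\<bar> * ?m z) \<in> borel_measurable (mu_alpha \<alpha>)"
      using measurable_emeasure_ang_rad[of \<alpha> "-x" u] a unfolding measure_def by simp
    show "AE z in mu_alpha \<alpha>. (\<integral>y. ?F y z \<partial>mu_alpha \<alpha>) = \<bar>f z\<bar> * ?m z"
      using AE_mu_alpha_neq[of 0 \<alpha>]
    proof eventually_elim
      case (elim z)
      have "(\<integral>y. ?F y z \<partial>mu_alpha \<alpha>) = (\<integral>y. \<bar>f z\<bar> * (indicator {-u<..<u} y * W_alpha \<alpha> x y z) \<partial>mu_alpha \<alpha>)"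
        by (intro Bochner_Integration.integral_cong refl) simp
      then show ?case unfolding integral_mult_right_zero integral_ball_W_alpha[OF a x elim] .
    qed
  qed measurable
  finally have I: "(LINT y:{-u<..<u}|mu_alpha \<alpha>. dunkl_trans \<alpha> x (\<lambda>z. \<bar>f z\<bar>) y) = (\<integral>z. \<bar>f z\<bar> * ?m z \<partial>mu_alpha \<alpha>)" .
  have e: "ennreal \<bar>f z\<bar> * emeasure (ang \<alpha>) {t. rad (-x) z t < u} = ennreal (\<bar>f z\<bar> * ?m z)" for z
    by (simp add: A.emeasure_eq_measure ennreal_mult)
  have m: "(\<lambda>z. \<bar>f z\<bar> * ?m z) \<in> borel_measurable (mu_alpha \<alpha>)"
      using measurable_emeasure_ang_rad[of \<alpha> "-x" u] a unfolding measure_def by simp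
  have "(\<integral>\<^sup>+z. ennreal (\<bar>f z\<bar> * ?m z) \<partial>mu_alpha \<alpha>) \<le> (\<integral>\<^sup>+z. ennreal \<bar>f z\<bar> * indicator ?B z \<partial>mu_alpha \<alpha>)"
  proof (intro nn_integral_mono)
    fix z
    show "ennreal (\<bar>f z\<bar> * ?m z) \<le> ennreal \<bar>f z\<bar> * indicator ?B z"
    proof (cases "z \<in> ?B")
      case True
      have "\<bar>f z\<bar> * ?m z \<le> \<bar>f z\<bar> * 1" by (intro mult_left_mono A.prob_le_1) auto
      then show ?thesis using True by (simp add: ennreal_leI)
    next
      case False
      then have z: "\<bar>x\<bar> + u \<le> \<bar>z\<bar>" by auto
      have "emeasure (ang \<alpha>) {t. rad (-x) z t < u} \<le> emeasure (ang \<alpha>) {}"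
      proof (rule emeasure_mono_AE)
        show "AE t in ang \<alpha>. t \<in> {t. rad (-x) z t < u} \<longrightarrow> t \<in> {}"
          using AE_ang_abs_le[of \<alpha>]
        proof eventually_elim
          case (elim t) show ?case using rad_bounds(1)[OF elim, of "-x" z] z by auto
        qed
      qed simp
      then have "?m z = 0" by (simp add: measure_def)
      then show ?thesis by simp
    qed
  qed
  also have "\<dots> < \<infinity>" by (rule loc_integrable_nn_finite(2)[OF loc])
  finally have "integrable (mu_alpha \<alpha>) (\<lambda>z. \<bar>f z\<bar> * ?m z)"
    by (intro integrableI_nonneg m) auto
  then show ?thesis unfolding e I by (intro nn_integral_eq_integral) auto
qed

text \<open>The dual form of the Morrey quantity. It replaces a translate of |f|, which involves a
  signed kernel, by |f| against a nonnegative weight, so it can be used with monotonicity and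
  Tonelli.\<close>

lemma nn_integral_morrey:
  assumes a: "-1/2 \<le> \<alpha>" and loc: "loc_integrable_dk \<alpha> f" and u: "0 < u"
  shows "(\<integral>\<^sup>+z. ennreal \<bar>f z\<bar> * emeasure (ang \<alpha>) {t. rad (-x) z t < u} \<partial>mu_alpha \<alpha>)
    = ennreal (LINT y:{-u<..<u}|mu_alpha \<alpha>. dunkl_trans \<alpha> x (\<lambda>z. \<bar>f z\<bar>) y)"
proof (cases "\<alpha> = -1/2")
  case True then show ?thesis using nn_integral_morrey_half[of f u x] loc u by simp
next
  case False
  then have a: "-1/2 < \<alpha>" using a by simp
  show ?thesis
    using nn_integral_morrey_zero[OF a loc u] nn_integral_morrey_nonzero[OF a _ loc u, of x] by (cases "x = 0") simp_all
qed

section \<open>Mean oscillation of a translate\<close>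

text \<open>The envelope of the kernel after y has been integrated over a ball: up to constants, r
  powr d times the normalised average over the annulus about |x|, damped by r / (|x| + r) on the
  half lying on the other side of 0.\<close>

definition cw :: "real \<Rightarrow> real \<Rightarrow> real \<Rightarrow> real \<Rightarrow> real" where
  "cw \<alpha> x r z = (r / (\<bar>x\<bar> + r)) powr (2 * \<alpha> + 1) * (if 0 \<le> x * z then 1 else r / (\<bar>x\<bar> + r))
     * indicator {z. \<bar>\<bar>z\<bar> - \<bar>x\<bar>\<bar> < r} z"

lemma cw_nonneg: "0 < r \<Longrightarrow> 0 \<le> cw \<alpha> x r z"
  by (simp add: cw_def)

lemma measurable_cw [measurable]: "cw \<alpha> x r \<in> borel_measurable borel"
proof -
  have [measurable]: "{z. \<bar>\<bar>z\<bar> - \<bar>x\<bar>\<bar> < r} \<in> sets borel" by measurable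
  show ?thesis unfolding cw_def[abs_def] by measurable
qed

text \<open>The integral of \<open>kappa_alpha\<close> over |y| < r is the angular measure of radii
  below r. On the opposite side the kernel gains |y| / |z|, at most a multiple of r / (|x| + r) when
  |x| \<ge> 2 r; for smaller |x| that damping factor exceeds 1/3 anyway, whence 12 = 4 times
  3.\<close>

lemma ball_abs_W_alpha_le:
  assumes a: "-1/2 < \<alpha>"
  obtains C where "0 < C" "\<And>x z r. \<lbrakk>0 < r; x \<noteq> 0; z \<noteq> 0\<rbrakk> \<Longrightarrow>
    (\<integral>\<^sup>+y. indicator {-r<..<r} y * ennreal \<bar>W_alpha \<alpha> x y z\<bar> \<partial>mu_alpha \<alpha>) \<le> ennreal (C * cw \<alpha> x r z)"
proof -
  obtain C0 where C0: "0 < C0" and up: "\<And>x z r. \<lbrakk>0 < r; x \<noteq> 0; z \<noteq> 0\<rbrakk> \<Longrightarrow>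
     emeasure (geg \<alpha>) {t. rad x z t < r} \<le> ennreal (C0 * (r / (\<bar>x\<bar> + r)) powr (2 * \<alpha> + 1))"
    using geg_rad_upper[OF a] by blast
  show ?thesis
  proof (rule that[of "12 * C0"])
    fix x z r :: real assume r: "0 < r" and x: "x \<noteq> 0" and z: "z \<noteq> 0"
    let ?s = "if 0 \<le> x * z then 1 else r / (\<bar>x\<bar> + r)"
    let ?i = "indicator {z. \<bar>\<bar>z\<bar> - \<bar>x\<bar>\<bar> < r} z :: real"
    have [measurable]: "{t. rad x z t < r} \<in> sets borel" by measurable
    have "(\<integral>\<^sup>+y. indicator {-r<..<r} y * ennreal \<bar>W_alpha \<alpha> x y z\<bar> \<partial>mu_alpha \<alpha>)
       \<le> (\<integral>\<^sup>+y. ennreal (12 * ?s * ?i) * (indicator {..<r} \<bar>y\<bar> * ennreal (kappa_alpha \<alpha> x z y)) \<partial>mu_alpha \<alpha>)"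
    proof (rule nn_integral_mono_AE)
      show "AE y in mu_alpha \<alpha>. indicator {-r<..<r} y * ennreal \<bar>W_alpha \<alpha> x y z\<bar>
         \<le> ennreal (12 * ?s * ?i) * (indicator {..<r} \<bar>y\<bar> * ennreal (kappa_alpha \<alpha> x z y))"
        using AE_mu_alpha_neq[of 0 \<alpha>]
      proof eventually_elim
        case y: (elim y)
        let ?k = "kappa_alpha \<alpha> x y z"
        have k: "kappa_alpha \<alpha> x z y = ?k" by (rule kappa_rotate[symmetric])
        have k0: "0 \<le> ?k" by (rule kappa_nonneg[OF a])
        show ?case
        proof (cases "\<bar>y\<bar> < r \<and> ?k \<noteq> 0")
          case False
          then have "y \<notin> {-r<..<r} \<or> W_alpha \<alpha> x y z = 0" by (auto simp: W_alpha_def)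
          then show ?thesis by auto
        next
          case True
          then have yr: "\<bar>y\<bar> < r" by simp
          note s = kappa_support[of \<alpha> x y z]
          have zx: "\<bar>\<bar>z\<bar> - \<bar>x\<bar>\<bar> < r" using s(3) True by simp
          have W4: "\<bar>W_alpha \<alpha> x y z\<bar> \<le> 4 * ?k" by (rule sigma_kappa_bounds(3)[OF a])
          have "\<bar>W_alpha \<alpha> x y z\<bar> \<le> 12 * ?s * ?k"
          proof (cases "0 \<le> x * z")
            case True then show ?thesis using W4 k0 by simp
          next
            case neg: False
            have "\<bar>W_alpha \<alpha> x y z\<bar> \<le> 12 * (r / (\<bar>x\<bar> + r)) * ?k"
            proof (cases "\<bar>x\<bar> < 2 * r")
              case True
              have "4 \<le> 12 * (r / (\<bar>x\<bar> + r))" using True r add_nonneg_pos[of "\<bar>x\<bar>" r] by (simp add: pos_le_divide_eq)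
              then have "4 * ?k \<le> 12 * (r / (\<bar>x\<bar> + r)) * ?k" using k0 by (rule mult_right_mono)
              then show ?thesis using W4 by simp
            next
              case False
              have "\<bar>x\<bar> - \<bar>z\<bar> < r" using zx by (simp add: abs_less_iff)
              then have z3: "\<bar>x\<bar> + r \<le> 3 * \<bar>z\<bar>" using False by simp
              have "\<bar>y\<bar> / \<bar>z\<bar> \<le> r / \<bar>z\<bar>" using yr by (intro divide_right_mono) auto
              also have "\<dots> \<le> r / ((\<bar>x\<bar> + r) / 3)" using z3 r by (intro divide_left_mono mult_pos_pos) auto
              finally have "4 * (\<bar>y\<bar> / \<bar>z\<bar>) \<le> 12 * (r / (\<bar>x\<bar> + r))" by simp
              then have "4 * (\<bar>y\<bar> / \<bar>z\<bar>) * ?k \<le> 12 * (r / (\<bar>x\<bar> + r)) * ?k" using k0 by (rule mult_right_mono)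
              moreover have "\<bar>W_alpha \<alpha> x y z\<bar> \<le> 4 * (\<bar>y\<bar> / \<bar>z\<bar>) * ?k"
                by (rule W_alpha_opposite[OF a _ y]) (use neg in simp)
              ultimately show ?thesis by simp
            qed
            then show ?thesis using neg by simp
          qed
          then have "ennreal \<bar>W_alpha \<alpha> x y z\<bar> \<le> ennreal (12 * ?s) * ennreal ?k"
            using k0 r by (subst ennreal_mult[symmetric]) (auto intro: ennreal_leI)
          then show ?thesis using zx yr by (simp add: k abs_less_iff)
        qed
      qed
    qed
    also have "\<dots> = ennreal (12 * ?s * ?i) * (\<integral>\<^sup>+y. indicator {..<r} \<bar>y\<bar> * ennreal (kappa_alpha \<alpha> x z y) \<partial>mu_alpha \<alpha>)"
      by (rule nn_integral_cmult) measurable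
    also have "(\<integral>\<^sup>+y. indicator {..<r} \<bar>y\<bar> * ennreal (kappa_alpha \<alpha> x z y) \<partial>mu_alpha \<alpha>) = (\<integral>\<^sup>+t. indicator {..<r} (rad x z t) \<partial>geg \<alpha>)"
      by (rule nn_integral_kappa[OF _ a x z]) measurable
    also have "\<dots> = (\<integral>\<^sup>+t. indicator {t. rad x z t < r} t \<partial>geg \<alpha>)"
      by (intro nn_integral_cong) (auto split: split_indicator)
    also have "\<dots> = emeasure (geg \<alpha>) {t. rad x z t < r}" by simp
    also have "ennreal (12 * ?s * ?i) * \<dots> \<le> ennreal (12 * ?s * ?i) * ennreal (C0 * (r / (\<bar>x\<bar> + r)) powr (2 * \<alpha> + 1))"
      by (intro mult_left_mono up[OF r x z]) simp
    also have "\<dots> = ennreal (12 * ?s * ?i * (C0 * (r / (\<bar>x\<bar> + r)) powr (2 * \<alpha> + 1)))"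
      using r C0 by (intro ennreal_mult[symmetric]) auto
    also have "12 * ?s * ?i * (C0 * (r / (\<bar>x\<bar> + r)) powr (2 * \<alpha> + 1)) = 12 * C0 * cw \<alpha> x r z"
      by (simp add: cw_def)
    finally show "(\<integral>\<^sup>+y. indicator {-r<..<r} y * ennreal \<bar>W_alpha \<alpha> x y z\<bar> \<partial>mu_alpha \<alpha>) \<le> ennreal (12 * C0 * cw \<alpha> x r z)" .
  qed (use C0 in simp)
qed

text \<open>The kernel has integral one, so c may be moved inside. A finite right side makes the
  translation integral converge; for an infinite one nothing is claimed about it.\<close>

lemma dunkl_trans_diff_le:
  assumes a: "-1/2 < \<alpha>" and x: "x \<noteq> 0" and y: "y \<noteq> 0" and [measurable]: "g \<in> borel_measurable borel"
  shows "ennreal \<bar>dunkl_trans \<alpha> x g y - c\<bar> \<le> (\<integral>\<^sup>+z. ennreal (\<bar>g z - c\<bar> * \<bar>W_alpha \<alpha> x y z\<bar>) \<partial>mu_alpha \<alpha>)" (is "_ \<le> ?R")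
proof (cases "?R = \<infinity>")
  case False
  have i: "integrable (mu_alpha \<alpha>) (\<lambda>z. (g z - c) * W_alpha \<alpha> x y z)"
    using False by (intro integrableI_bounded) (auto simp: abs_mult top.not_eq_extremum)
  note w = integrable_W_alpha[OF a x y]
  have "dunkl_trans \<alpha> x g y = (\<integral>z. (g z - c) * W_alpha \<alpha> x y z + c * W_alpha \<alpha> x y z \<partial>mu_alpha \<alpha>)"
    using a x y by (simp add: dunkl_trans_def algebra_simps)
  also have "\<dots> = (\<integral>z. (g z - c) * W_alpha \<alpha> x y z \<partial>mu_alpha \<alpha>) + c"
    using i w integral_W_alpha[OF a x y] by simp
  finally have "\<bar>dunkl_trans \<alpha> x g y - c\<bar> = norm (\<integral>z. (g z - c) * W_alpha \<alpha> x y z \<partial>mu_alpha \<alpha>)" by simp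
  also have "ennreal \<dots> \<le> (\<integral>\<^sup>+z. ennreal (norm ((g z - c) * W_alpha \<alpha> x y z)) \<partial>mu_alpha \<alpha>)"
    by (rule integral_norm_bound_ennreal[OF i])
  finally show ?thesis by (simp add: abs_mult)
qed simp

lemma measurable_dunkl_trans [measurable]:
  assumes [measurable]: "g \<in> borel_measurable borel"
  shows "dunkl_trans \<alpha> x g \<in> borel_measurable borel"
proof -
  interpret M: sigma_finite_measure "mu_alpha \<alpha>" by (rule sigma_finite_mu_alpha)
  show ?thesis unfolding dunkl_trans_def[abs_def] by measurable
qed

text \<open>Absolute values inside the translation and Tonelli reduce the oscillation of a translate
  over a ball to that of g itself on an annulus. This is how iterated translations are
  avoided.\<close>

lemma dunkl_trans_oscillation:
  assumes a: "-1/2 \<le> \<alpha>"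
  obtains C where "0 < C" "\<And>g x c r. \<lbrakk>g \<in> borel_measurable borel; 0 < r\<rbrakk> \<Longrightarrow>
    (\<integral>\<^sup>+y. indicator {-r<..<r} y * ennreal \<bar>dunkl_trans \<alpha> x g y - c\<bar> \<partial>mu_alpha \<alpha>)
      \<le> ennreal C * (\<integral>\<^sup>+z. ennreal (\<bar>g z - c\<bar> * cw \<alpha> x r z) \<partial>mu_alpha \<alpha>)"
proof (cases "\<alpha> = -1/2")
  case True
  show ?thesis
  proof (rule that[of 2])
    fix g :: "real \<Rightarrow> real" and x c r :: real assume [measurable]: "g \<in> borel_measurable borel" and r: "0 < r"
    let ?F = "\<lambda>z. ennreal (\<bar>g z - c\<bar> * cw (-1/2) x r z)"
    have "(\<integral>\<^sup>+y. indicator {-r<..<r} y * ennreal \<bar>dunkl_trans \<alpha> x g y - c\<bar> \<partial>mu_alpha \<alpha>)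
       = (\<integral>\<^sup>+y. indicator {-r<..<r} ((x + y) - x) * ennreal \<bar>g (x + y) - c\<bar> \<partial>mu_alpha (-1/2))"
      unfolding True by (simp add: dunkl_trans_def)
    also have "\<dots> = (\<integral>\<^sup>+z. indicator {-r<..<r} (z - x) * ennreal \<bar>g z - c\<bar> \<partial>mu_alpha (-1/2))"
      by (rule nn_integral_mu_half_shift) measurable
    also have "\<dots> \<le> (\<integral>\<^sup>+z. ennreal 2 * ?F z \<partial>mu_alpha (-1/2))"
    proof (rule nn_integral_mono)
      fix z
      show "indicator {-r<..<r} (z - x) * ennreal \<bar>g z - c\<bar> \<le> ennreal 2 * ?F z"
      proof (cases "\<bar>z - x\<bar> < r")
        case True
        then have zx: "\<bar>\<bar>z\<bar> - \<bar>x\<bar>\<bar> < r" by linarith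
        have q: "r / (\<bar>x\<bar> + r) > 0" using r by (intro divide_pos_pos add_nonneg_pos) auto
        \<comment> \<open>If x and z lie on different sides of 0 then |x| \<le> |z - x| < r, so the
          damping factor is at least 1/2; hence the constant 2.\<close>
        have "1 \<le> 2 * (if 0 \<le> x * z then 1 else r / (\<bar>x\<bar> + r))"
        proof (cases "0 \<le> x * z")
          case False
          then have "\<bar>x\<bar> \<le> \<bar>z - x\<bar>" by (auto simp: zero_le_mult_iff)
          then have "\<bar>x\<bar> < r" using True by simp
          moreover have "0 < \<bar>x\<bar> + r" using r by (simp add: add_nonneg_pos)
          ultimately have "1 \<le> 2 * (r / (\<bar>x\<bar> + r))" by (simp add: pos_le_divide_eq)
          then show ?thesis using False by simp
        qed simp
        also have "\<dots> = 2 * cw (-1/2) x r z" using zx q by (auto simp: cw_def)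
        finally have "1 \<le> 2 * cw (-1/2) x r z" .
        then have "\<bar>g z - c\<bar> * 1 \<le> \<bar>g z - c\<bar> * (2 * cw (-1/2) x r z)" by (intro mult_left_mono) auto
        then have "ennreal \<bar>g z - c\<bar> \<le> ennreal (2 * (\<bar>g z - c\<bar> * cw (-1/2) x r z))" by (intro ennreal_leI) (simp add: mult_ac)
        also have "\<dots> = ennreal 2 * ?F z" by (rule ennreal_mult) (use r cw_nonneg in auto)
        finally show ?thesis by (auto split: split_indicator)
      qed (auto simp: abs_less_iff split: split_indicator)
    qed
    also have "\<dots> = ennreal 2 * (\<integral>\<^sup>+z. ?F z \<partial>mu_alpha (-1/2))"
      by (rule nn_integral_cmult) measurable
    finally show "(\<integral>\<^sup>+y. indicator {-r<..<r} y * ennreal \<bar>dunkl_trans \<alpha> x g y - c\<bar> \<partial>mu_alpha \<alpha>)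
      \<le> ennreal 2 * (\<integral>\<^sup>+z. ennreal (\<bar>g z - c\<bar> * cw \<alpha> x r z) \<partial>mu_alpha \<alpha>)" unfolding True .
  qed simp
next
  case False
  then have a: "-1/2 < \<alpha>" using a by simp
  interpret M: sigma_finite_measure "mu_alpha \<alpha>" by (rule sigma_finite_mu_alpha)
  interpret P: pair_sigma_finite "mu_alpha \<alpha>" "mu_alpha \<alpha>" ..
  obtain C0 where C0: "0 < C0" and up: "\<And>x z r. \<lbrakk>0 < r; x \<noteq> 0; z \<noteq> 0\<rbrakk> \<Longrightarrow>
    (\<integral>\<^sup>+y. indicator {-r<..<r} y * ennreal \<bar>W_alpha \<alpha> x y z\<bar> \<partial>mu_alpha \<alpha>) \<le> ennreal (C0 * cw \<alpha> x r z)"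
    using ball_abs_W_alpha_le[OF a] by blast
  show ?thesis
  proof (rule that[of "max 1 C0"])
    fix g :: "real \<Rightarrow> real" and x c r :: real assume g [measurable]: "g \<in> borel_measurable borel" and r: "0 < r"
    let ?F = "\<lambda>z. ennreal (\<bar>g z - c\<bar> * cw \<alpha> x r z)" and ?G = "\<lambda>y z. indicator {-r<..<r} y * ennreal (\<bar>g z - c\<bar> * \<bar>W_alpha \<alpha> x y z\<bar>)"
    show "(\<integral>\<^sup>+y. indicator {-r<..<r} y * ennreal \<bar>dunkl_trans \<alpha> x g y - c\<bar> \<partial>mu_alpha \<alpha>)
      \<le> ennreal (max 1 C0) * (\<integral>\<^sup>+z. ?F z \<partial>mu_alpha \<alpha>)"
    \<comment> \<open>At x = 0 the translation is the identity and \<open>cw\<close> is the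
      indicator of the ball, which explains the 1 in the maximum.\<close>
    proof (cases "x = 0")
      case True
      have "(\<integral>\<^sup>+y. indicator {-r<..<r} y * ennreal \<bar>dunkl_trans \<alpha> x g y - c\<bar> \<partial>mu_alpha \<alpha>) = (\<integral>\<^sup>+z. ?F z \<partial>mu_alpha \<alpha>)"
        using True a r by (intro nn_integral_cong) (auto simp: dunkl_trans_def cw_def abs_less_iff split: split_indicator)
      also have "\<dots> \<le> ennreal (max 1 C0) * \<dots>"
        using mult_right_mono[of 1 "ennreal (max 1 C0)"] by simp
      finally show ?thesis .
    next
      case x: False
      have "(\<integral>\<^sup>+y. indicator {-r<..<r} y * ennreal \<bar>dunkl_trans \<alpha> x g y - c\<bar> \<partial>mu_alpha \<alpha>)
         \<le> (\<integral>\<^sup>+y. (\<integral>\<^sup>+z. ?G y z \<partial>mu_alpha \<alpha>) \<partial>mu_alpha \<alpha>)"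
      proof (rule nn_integral_mono_AE)
        show "AE y in mu_alpha \<alpha>. indicator {-r<..<r} y * ennreal \<bar>dunkl_trans \<alpha> x g y - c\<bar>
           \<le> (\<integral>\<^sup>+z. ?G y z \<partial>mu_alpha \<alpha>)"
          using AE_mu_alpha_neq[of 0 \<alpha>]
        proof eventually_elim
          case (elim y)
          show ?case using dunkl_trans_diff_le[OF a x elim g, of c] by (auto split: split_indicator)
        qed
      qed
      also have "\<dots> = (\<integral>\<^sup>+z. (\<integral>\<^sup>+y. ?G y z \<partial>mu_alpha \<alpha>) \<partial>mu_alpha \<alpha>)"
        by (rule P.Fubini'[symmetric]) measurable
      also have "\<dots> \<le> (\<integral>\<^sup>+z. ennreal (max 1 C0) * ?F z \<partial>mu_alpha \<alpha>)"
      proof (rule nn_integral_mono_AE)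
        show "AE z in mu_alpha \<alpha>. (\<integral>\<^sup>+y. ?G y z \<partial>mu_alpha \<alpha>)
            \<le> ennreal (max 1 C0) * ?F z"
          using AE_mu_alpha_neq[of 0 \<alpha>]
        proof eventually_elim
          case z: (elim z)
          have "(\<integral>\<^sup>+y. ?G y z \<partial>mu_alpha \<alpha>)
             = (\<integral>\<^sup>+y. ennreal \<bar>g z - c\<bar> * (indicator {-r<..<r} y * ennreal \<bar>W_alpha \<alpha> x y z\<bar>) \<partial>mu_alpha \<alpha>)"
            by (intro nn_integral_cong) (simp add: ennreal_mult mult_ac)
          also have "\<dots> = ennreal \<bar>g z - c\<bar> * (\<integral>\<^sup>+y. indicator {-r<..<r} y * ennreal \<bar>W_alpha \<alpha> x y z\<bar> \<partial>mu_alpha \<alpha>)"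
            by (rule nn_integral_cmult) measurable
          also have "\<dots> \<le> ennreal \<bar>g z - c\<bar> * ennreal (C0 * cw \<alpha> x r z)"
            by (intro mult_left_mono up[OF r x z]) simp
          also have "\<dots> = ennreal C0 * ?F z"
            using C0 cw_nonneg[OF r] by (simp add: ennreal_mult mult_ac)
          also have "\<dots> \<le> ennreal (max 1 C0) * ?F z"
            by (intro mult_right_mono ennreal_leI) auto
          finally show ?case .
        qed
      qed
      also have "\<dots> = ennreal (max 1 C0) * (\<integral>\<^sup>+z. ?F z \<partial>mu_alpha \<alpha>)"
        by (rule nn_integral_cmult) measurable
      finally show ?thesis .
    qed
  qed simp
qed

section \<open>Tails of the kernel\<close>

text \<open>The doubling and regularity conditions are restated without quotients. The functions are
  Borel on the whole line, which is arranged by cutting them off to the positive half-line.\<close>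

locale riesz_setup =
  fixes \<alpha> :: real and \<phi> \<rho> :: "real \<Rightarrow> real" and C\<phi> C\<rho> Cd :: real
  assumes alpha: "-1/2 \<le> \<alpha>"
    and phi_pos: "\<And>r. 0 < r \<Longrightarrow> 0 < \<phi> r" and rho_pos: "\<And>r. 0 < r \<Longrightarrow> 0 < \<rho> r"
    and phi_doubling: "\<And>r s. \<lbrakk>0 < r; 0 < s; r \<le> 2 * s; s \<le> 2 * r\<rbrakk> \<Longrightarrow> \<phi> r \<le> C\<phi> * \<phi> s"
    and rho_doubling: "\<And>r s. \<lbrakk>0 < r; 0 < s; r \<le> 2 * s; s \<le> 2 * r\<rbrakk> \<Longrightarrow> \<rho> r \<le> C\<rho> * \<rho> s"
    and Cd: "0 \<le> Cd"
    and rho_smooth: "\<And>r s. \<lbrakk>0 < r; 0 < s; r \<le> 2 * s; s \<le> 2 * r\<rbrakk> \<Longrightarrow>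
        \<bar>\<rho> r / r powr d_alpha \<alpha> - \<rho> s / s powr d_alpha \<alpha>\<bar> \<le> Cd * \<bar>r - s\<bar> * \<rho> s / s powr (d_alpha \<alpha> + 1)"
    and rho_meas [measurable]: "\<rho> \<in> borel_measurable borel"
    and phi_meas [measurable]: "\<phi> \<in> borel_measurable borel"
begin

sublocale ang: prob_space "ang \<alpha>" by (rule prob_space_ang[OF alpha])
sublocale mu: sigma_finite_measure "mu_alpha \<alpha>" by (rule sigma_finite_mu_alpha)

definition K :: "real \<Rightarrow> real" where "K s = \<rho> \<bar>s\<bar> / \<bar>s\<bar> powr d_alpha \<alpha>"

text \<open>The pair \<open>far\<close> and \<open>near\<close> carries the two integrals of the
  domination condition, as extended nonnegative numbers so that convergence need not be known
  beforehand.\<close>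

definition far :: "real \<Rightarrow> ennreal" where
  "far a = (\<integral>\<^sup>+ t\<in>{a<..}. ennreal (\<rho> t * \<phi> t / t\<^sup>2) \<partial>lborel)"

definition near :: "real \<Rightarrow> ennreal" where
  "near r = (\<integral>\<^sup>+ t\<in>{0<..<r}. ennreal (\<rho> t / t) \<partial>lborel)"

definition Ktail :: "real \<Rightarrow> real \<Rightarrow> real" where
  "Ktail a s = K s * indicator {a..} s"

section \<open>The radial kernel: local boundedness, averages and regularity\<close>

lemma measurable_K [measurable]: "K \<in> borel_measurable borel"
  unfolding K_def[abs_def] by measurable

lemma measurable_Ktail [measurable]: "Ktail a \<in> borel_measurable borel"
  unfolding Ktail_def[abs_def] by measurable

lemma K_nonneg: "0 \<le> K s"
proof (cases "s = 0")
  case False then show ?thesis using rho_pos[of "\<bar>s\<bar>"] by (simp add: K_def)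
qed (simp add: K_def)

lemma Ktail_nonneg: "0 \<le> Ktail a s"
  using K_nonneg by (simp add: Ktail_def)

lemma K_abs: "K \<bar>s\<bar> = K s"
  by (simp add: K_def)

lemma C\<rho>_ge_1: "1 \<le> C\<rho>" using rho_doubling[of 1 1] rho_pos[of 1] by simp

lemma C\<phi>_ge_1: "1 \<le> C\<phi>" using phi_doubling[of 1 1] phi_pos[of 1] by simp

lemma d_pos: "1 \<le> d_alpha \<alpha>" using alpha by (simp add: d_alpha_def)

text \<open>Doubling iterated n times from \<delta> bounds \<rho> on [\<delta>, 2^n \<delta>]; away
  from 0 the power in the denominator is bounded below.\<close>

lemma K_bounded:
  assumes d: "0 < \<delta>"
  obtains B where "\<And>s. \<lbrakk>\<delta> \<le> s; s \<le> L\<rbrakk> \<Longrightarrow> K s \<le> B"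
proof -
  have grow: "\<rho> s \<le> C\<rho> ^ n * \<rho> \<delta>" if "\<delta> \<le> s" "s \<le> 2 ^ n * \<delta>" for s n
    using that
  proof (induction n arbitrary: s)
    case 0 then show ?case by simp
  next
    case (Suc n)
    show ?case
    proof (cases "s \<le> 2 ^ n * \<delta>")
      case True
      then have "\<rho> s \<le> C\<rho> ^ n * \<rho> \<delta>" using Suc by simp
      also have "\<dots> \<le> C\<rho> ^ Suc n * \<rho> \<delta>" using C\<rho>_ge_1 rho_pos[OF d] by (intro mult_right_mono power_increasing) auto
      finally show ?thesis .
    next
      case False
      have "\<delta> \<le> 2 ^ n * \<delta>" using d by simp
      \<comment> \<open>Halving s could fall below \<delta>, the left end of the range covered by
        the induction.\<close>
      define s' where "s' = max \<delta> (s / 2)"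
      have s': "\<delta> \<le> s'" "s' \<le> 2 ^ n * \<delta>" "0 < s'" "s \<le> 2 * s'" "s' \<le> 2 * s"
        using Suc.prems d \<open>\<delta> \<le> 2 ^ n * \<delta>\<close> by (auto simp: s'_def)
      have "\<rho> s \<le> C\<rho> * \<rho> s'" using Suc.prems d s' by (intro rho_doubling) auto
      also have "\<dots> \<le> C\<rho> * (C\<rho> ^ n * \<rho> \<delta>)" using Suc.IH[OF s'(1,2)] C\<rho>_ge_1 by (intro mult_left_mono) auto
      finally show ?thesis by simp
    qed
  qed
  obtain n :: nat where n: "L / \<delta> < 2 ^ n" using real_arch_pow[of 2 "L / \<delta>"] by auto
  show ?thesis
  proof (rule that)
    fix s assume s: "\<delta> \<le> s" "s \<le> L"
    have "L \<le> 2 ^ n * \<delta>" using n d by (simp add: divide_less_eq)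
    then have "\<rho> s \<le> C\<rho> ^ n * \<rho> \<delta>" using s by (intro grow) auto
    moreover have "\<delta> powr d_alpha \<alpha> \<le> s powr d_alpha \<alpha>" using d s d_pos by (intro powr_mono2) auto
    ultimately show "K s \<le> C\<rho> ^ n * \<rho> \<delta> / \<delta> powr d_alpha \<alpha>"
      unfolding K_def using s d rho_pos[of s] by (intro frac_le) auto
  qed
qed

text \<open>One doubling of \<rho> between s and u, and u < 2 s inside a power of exponent d +
  2.\<close>

definition C0 :: real where "C0 = C\<rho> * 2 powr (d_alpha \<alpha> + 2)"

text \<open>The 2 counts the centres x and -x, the two doublings and 3 powr d come from balls of
  radius 3 r, and c is the lower angular bound.\<close>

definition Cann :: "real \<Rightarrow> real" where "Cann c = 2 * C\<phi> * C\<phi> * 3 powr d_alpha \<alpha> / c"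

text \<open>The factor 4 \<open>A_alpha\<close> comes from integrating the local kernel; the rest is
  the annulus constant at half-width 2 r, brought back to r.\<close>

definition Cloc :: "real \<Rightarrow> real" where
  "Cloc c = 4 * A_alpha \<alpha> * (Cann c * (2 * C\<phi> * 2 powr (2 * \<alpha> + 1)))"

lemma Cann_pos: "0 < c \<Longrightarrow> 0 < Cann c"
  using C\<phi>_ge_1 by (simp add: Cann_def)

lemma Cloc_pos: "0 < c \<Longrightarrow> 0 < Cloc c"
  using C\<phi>_ge_1 A_alpha_pos[OF alpha] Cann_pos[of c] by (simp add: Cloc_def)

lemma C0_pos: "0 < C0" using C\<rho>_ge_1 by (simp add: C0_def)

text \<open>By doubling, a value at s is dominated by an average over u in (s, 2 s). This writes the
  kernel as a superposition of indicators of s < u, the form to which the Morrey condition applies.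
  The exponent is d + 1 from K s / s, plus one for the length s of the interval.\<close>

lemma K_over_le:
  assumes s: "0 < s"
  shows "ennreal (K s / s) \<le> ennreal C0 * (\<integral>\<^sup>+u. ennreal (\<rho> u / u powr (d_alpha \<alpha> + 2)) * indicator {s<..<2 * s} u \<partial>lborel)"
proof -
  let ?d = "d_alpha \<alpha>"
  have sp: "s powr (?d + 2) = s powr ?d * s * s" using s powr_add[of s ?d 2] by (simp add: power2_eq_square)
  have eq: "K s / s = C0 * (\<rho> s / (C0 * s powr (?d + 2)) * s)"
    using s C0_pos by (simp add: K_def sp)
  define p where "p = \<rho> s / (C0 * s powr (?d + 2))"
  have p: "0 \<le> p" using C0_pos rho_pos[OF s] by (simp add: p_def)
  have start: "ennreal (K s / s) = ennreal C0 * (ennreal (\<rho> s / (C0 * s powr (?d + 2))) * emeasure lborel {s<..<2 * s})"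
    unfolding eq p_def[symmetric] using s C0_pos p by (simp add: ennreal_mult)
  have "ennreal (\<rho> s / (C0 * s powr (?d + 2))) * emeasure lborel {s<..<2 * s}
    = (\<integral>\<^sup>+u. ennreal (\<rho> s / (C0 * s powr (?d + 2))) * indicator {s<..<2 * s} u \<partial>lborel)"
    by (rule nn_integral_cmult_indicator[symmetric]) simp
  also have "\<dots> \<le> (\<integral>\<^sup>+u. ennreal (\<rho> u / u powr (?d + 2)) * indicator {s<..<2 * s} u \<partial>lborel)"
  proof (rule nn_integral_mono)
    fix u
    show "ennreal (\<rho> s / (C0 * s powr (?d + 2))) * indicator {s<..<2 * s} u \<le> ennreal (\<rho> u / u powr (?d + 2)) * indicator {s<..<2 * s} u"
    proof (cases "u \<in> {s<..<2 * s}")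
      case True
      then have u: "s < u" "u < 2 * s" "0 < u" using s by auto
      have "\<rho> s \<le> C\<rho> * \<rho> u" using u s by (intro rho_doubling) auto
      moreover have "u powr (?d + 2) \<le> (2 * s) powr (?d + 2)" using u d_pos by (intro powr_mono2) auto
      ultimately have "\<rho> s / (2 * s) powr (?d + 2) \<le> (C\<rho> * \<rho> u) / u powr (?d + 2)"
        using u rho_pos[OF s] by (intro frac_le) auto
      moreover have "A / (C * P) \<le> V / U" if "A / P \<le> (C * V) / U" "1 \<le> C" for A P C V U :: real
        using divide_right_mono[OF that(1), of C] that(2) by (simp add: mult.commute)
      ultimately have "\<rho> s / (C\<rho> * (2 * s) powr (?d + 2)) \<le> \<rho> u / u powr (?d + 2)"
        using C\<rho>_ge_1 by blast
      also have "C\<rho> * (2 * s) powr (?d + 2) = C0 * s powr (?d + 2)" using s by (simp add: C0_def powr_mult)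
      finally show ?thesis by (intro mult_right_mono ennreal_leI) auto
    qed simp
  qed
  finally show ?thesis unfolding start by (rule mult_left_mono) simp
qed

text \<open>If s \<ge> 4 D both radii exceed the cutoffs and are comparable, so regularity applies.
  Otherwise both are at most 5 D, and each tail is its radius times the quotient on the right. The
  cutoffs may differ, because the operator compares cutoff r at x with cutoff 1 at 0.\<close>

lemma Ktail_diff:
  assumes s: "0 \<le> s" "0 \<le> s'" "\<bar>s - s'\<bar> \<le> D" and ab: "0 < a" "a \<le> D" "0 < b" "b \<le> D"
  shows "\<bar>Ktail a s - Ktail b s'\<bar> \<le> (5 + Cd) * D * (Ktail a s / s + Ktail b s' / s')"
proof (cases "4 * D \<le> s")
  case True
  then have p: "0 < s" "0 < s'" "s' \<le> 2 * s" "s \<le> 2 * s'" "a \<le> s" "b \<le> s'" using s ab by auto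
  have "\<bar>Ktail a s - Ktail b s'\<bar> = \<bar>K s' - K s\<bar>" using p by (simp add: Ktail_def abs_minus_commute)
  also have "\<dots> \<le> Cd * \<bar>s' - s\<bar> * \<rho> s / s powr (d_alpha \<alpha> + 1)"
    using rho_smooth[OF p(2,1,3,4)] p by (simp add: K_def)
  also have "\<dots> = Cd * \<bar>s' - s\<bar> * (K s / s)" using p by (simp add: K_def powr_add)
  also have "\<dots> \<le> (5 + Cd) * D * (K s / s)"
    using s K_nonneg[of s] p Cd by (intro mult_right_mono mult_mono) auto
  also have "\<dots> \<le> (5 + Cd) * D * (Ktail a s / s + Ktail b s' / s')"
    using s Ktail_nonneg[of b s'] p Cd ab by (intro mult_left_mono mult_nonneg_nonneg) (auto simp: Ktail_def)
  finally show ?thesis .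
next
  case False
  have D: "0 < D" using ab by simp
  have e: "Ktail c v \<le> (5 + Cd) * D * (Ktail c v / v)" if v: "v \<le> 5 * D" "0 < c" for c v
  proof (cases "c \<le> v")
    case True
    then have v0: "0 < v" using v by simp
    have "Ktail c v = v * (Ktail c v / v)" using v0 by simp
    also have "\<dots> \<le> ((5 + Cd) * D) * (Ktail c v / v)"
    proof (rule mult_right_mono)
      have "5 * D \<le> (5 + Cd) * D" using Cd D by (intro mult_right_mono) auto
      then show "v \<le> (5 + Cd) * D" using v by simp
    qed (use Ktail_nonneg[of c v] v0 in simp)
    finally show ?thesis .
  qed (simp add: Ktail_def)
  have "Ktail a s \<le> (5 + Cd) * D * (Ktail a s / s)" by (rule e) (use False ab in auto)
  moreover have "Ktail b s' \<le> (5 + Cd) * D * (Ktail b s' / s')" by (rule e) (use False ab s in auto)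
  ultimately show ?thesis using Ktail_nonneg[of a s] Ktail_nonneg[of b s'] unfolding distrib_left by linarith
qed

text \<open>The density has exponent d - 1, so density times kernel is \<rho> s / s on each
  half-line.\<close>

lemma nn_integral_K_ball:
  "(\<integral>\<^sup>+s. ennreal (K \<bar>s\<bar> * indicator {..<r} \<bar>s\<bar>) \<partial>mu_alpha \<alpha>) = ennreal (2 * A_alpha \<alpha>) * near r"
proof -
  let ?F = "\<lambda>s. ennreal (A_alpha \<alpha> * \<bar>s\<bar> powr (2 * \<alpha> + 1)) * ennreal (K \<bar>s\<bar> * indicator {..<r} \<bar>s\<bar>)"
  have A: "0 < A_alpha \<alpha>" by (rule A_alpha_pos[OF alpha])
  have "(\<integral>\<^sup>+s. ennreal (K \<bar>s\<bar> * indicator {..<r} \<bar>s\<bar>) \<partial>mu_alpha \<alpha>)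
     = (\<integral>\<^sup>+s. ?F s \<partial>lborel)"
    by (rule nn_integral_mu_alpha) measurable
  also have "\<dots> = (\<integral>\<^sup>+s. 2 * ?F s * indicator {0..} s \<partial>lborel)"
    by (rule nn_integral_even) auto
  also have "\<dots> = (\<integral>\<^sup>+s. ennreal (2 * A_alpha \<alpha>) * (ennreal (\<rho> s / s) * indicator {0<..<r} s) \<partial>lborel)"
  proof (rule nn_integral_cong)
    fix s :: real
    show "2 * ?F s * indicator {0..} s
      = ennreal (2 * A_alpha \<alpha>) * (ennreal (\<rho> s / s) * indicator {0<..<r} s)"
    proof (cases "0 < s \<and> s < r")
      case True
      then have s: "0 < s" by simp
      have "s powr d_alpha \<alpha> = s powr (2 * \<alpha> + 1) * s" using s powr_add[of s "2*\<alpha>+1" 1] by (simp add: d_alpha_def add.commute)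
      then have "s powr (2 * \<alpha> + 1) * K s = \<rho> s / s" using s by (simp add: K_def)
      then have "2 * A_alpha \<alpha> * (\<rho> s / s) = 2 * ((A_alpha \<alpha> * s powr (2 * \<alpha> + 1)) * K s)" by (simp add: mult.assoc)
      then have "ennreal (2 * A_alpha \<alpha>) * ennreal (\<rho> s / s) = 2 * (ennreal (A_alpha \<alpha> * s powr (2 * \<alpha> + 1)) * ennreal (K s))"
        using A K_nonneg[of s] rho_pos[OF s] s by (simp add: ennreal_mult[symmetric] flip: ennreal_numeral)
      then show ?thesis using True by simp
    next
      case False
      then show ?thesis by (auto simp: not_less split: split_indicator)
    qed
  qed
  also have "\<dots> = ennreal (2 * A_alpha \<alpha>) * near r" unfolding near_def by (rule nn_integral_cmult) measurable
  finally show ?thesis .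
qed

end

text \<open>The function enters only through the angular form of its Morrey bound, with N in the
  place of the norm.\<close>

locale morrey_function = riesz_setup +
  fixes f :: "real \<Rightarrow> real" and N :: real
  assumes f_meas [measurable]: "f \<in> borel_measurable borel" and N: "0 \<le> N"
    and morrey: "\<And>x u. 0 < u \<Longrightarrow> (\<integral>\<^sup>+z. ennreal \<bar>f z\<bar> * emeasure (ang \<alpha>) {t. rad x z t < u} \<partial>mu_alpha \<alpha>)
        \<le> ennreal (\<phi> u * u powr d_alpha \<alpha> * N)"
begin

section \<open>Morrey bounds integrated against the kernel\<close>

sublocale mm: pair_sigma_finite "mu_alpha \<alpha>" "mu_alpha \<alpha>" ..
sublocale al: pair_sigma_finite "ang \<alpha>" lborel ..
sublocale ml: pair_sigma_finite "mu_alpha \<alpha>" lborel ..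

lemma sets_rad [measurable]: "{t. rad x z t < u} \<in> sets borel"
  by measurable

lemma nn_integral_ang_indicator: "(\<integral>\<^sup>+t. indicator {rad x y t<..} u \<partial>ang \<alpha>) = emeasure (ang \<alpha>) {t. rad x y t < u}"
proof -
  have "(\<integral>\<^sup>+t. indicator {rad x y t<..} u \<partial>ang \<alpha>) = (\<integral>\<^sup>+t. indicator {t. rad x y t < u} t \<partial>ang \<alpha>)"
    by (intro nn_integral_cong) (auto split: split_indicator)
  then show ?thesis by simp
qed

text \<open>A layer-cake argument: expand K s / s over u > s, interchange, and apply the Morrey
  bound at each radius u. Its factor \<phi> u times u powr d against \<rho> u / u powr (d + 2)
  leaves the integrand of \<open>far\<close>.\<close>

lemma tail_over_bound:
  assumes a: "0 < a"
  shows "(\<integral>\<^sup>+y. ennreal \<bar>f y\<bar> * (\<integral>\<^sup>+t. ennreal (Ktail a (rad x y t) / rad x y t) \<partial>ang \<alpha>) \<partial>mu_alpha \<alpha>) \<le> ennreal (C0 * N) * far a"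
proof -
  let ?m = "\<lambda>y u. emeasure (ang \<alpha>) {t. rad x y t < u}"
  let ?q = "\<lambda>u. ennreal C0 * (ennreal (\<rho> u / u powr (d_alpha \<alpha> + 2)) * indicator {a<..} u)"
  have inner: "(\<integral>\<^sup>+t. ennreal (Ktail a (rad x y t) / rad x y t) \<partial>ang \<alpha>) \<le> (\<integral>\<^sup>+u. ?q u * ?m y u \<partial>lborel)" for y
  proof -
    have "(\<integral>\<^sup>+t. ennreal (Ktail a (rad x y t) / rad x y t) \<partial>ang \<alpha>) \<le> (\<integral>\<^sup>+t. (\<integral>\<^sup>+u. ?q u * indicator {rad x y t<..} u \<partial>lborel) \<partial>ang \<alpha>)"
    proof (rule nn_integral_mono)
      fix t
      let ?s = "rad x y t"
      show "ennreal (Ktail a ?s / ?s) \<le> (\<integral>\<^sup>+u. ?q u * indicator {?s<..} u \<partial>lborel)"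
      proof (cases "a \<le> ?s")
        case True
        then have s: "0 < ?s" using a by simp
        have "ennreal (Ktail a ?s / ?s) = ennreal (K ?s / ?s)" using True by (simp add: Ktail_def)
        also have "\<dots> \<le> ennreal C0 * (\<integral>\<^sup>+u. ennreal (\<rho> u / u powr (d_alpha \<alpha> + 2)) * indicator {?s<..<2 * ?s} u \<partial>lborel)"
          by (rule K_over_le[OF s])
        also have "\<dots> = (\<integral>\<^sup>+u. ennreal C0 * (ennreal (\<rho> u / u powr (d_alpha \<alpha> + 2)) * indicator {?s<..<2 * ?s} u) \<partial>lborel)"
          by (rule nn_integral_cmult[symmetric]) measurable
        also have "\<dots> \<le> (\<integral>\<^sup>+u. ?q u * indicator {?s<..} u \<partial>lborel)"
          using True by (intro nn_integral_mono) (auto split: split_indicator)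
        finally show ?thesis .
      qed (simp add: Ktail_def)
    qed
    also have "\<dots> = (\<integral>\<^sup>+u. (\<integral>\<^sup>+t. ?q u * indicator {rad x y t<..} u \<partial>ang \<alpha>) \<partial>lborel)"
      \<comment> \<open>Unfolding the ray with moving endpoint exposes a comparison of two jointly
        measurable functions.\<close>
      by (rule al.Fubini'[symmetric]) (simp add: greaterThan_def, measurable)
    also have "\<dots> = (\<integral>\<^sup>+u. ?q u * ?m y u \<partial>lborel)"
    proof (rule nn_integral_cong)
      fix u
      have "(\<integral>\<^sup>+t. ?q u * indicator {rad x y t<..} u \<partial>ang \<alpha>) = ?q u * (\<integral>\<^sup>+t. indicator {rad x y t<..} u \<partial>ang \<alpha>)"
        by (rule nn_integral_cmult) (simp add: greaterThan_def)
      then show "(\<integral>\<^sup>+t. ?q u * indicator {rad x y t<..} u \<partial>ang \<alpha>) = ?q u * ?m y u"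
        unfolding nn_integral_ang_indicator .
    qed
    finally show ?thesis .
  qed
  have m [measurable]: "(\<lambda>(y, u). ?m y u) \<in> borel_measurable (borel \<Otimes>\<^sub>M borel)"
    unfolding nn_integral_ang_indicator[symmetric] by (simp add: greaterThan_def, measurable)
  have "(\<integral>\<^sup>+y. ennreal \<bar>f y\<bar> * (\<integral>\<^sup>+t. ennreal (Ktail a (rad x y t) / rad x y t) \<partial>ang \<alpha>) \<partial>mu_alpha \<alpha>)
     \<le> (\<integral>\<^sup>+y. ennreal \<bar>f y\<bar> * (\<integral>\<^sup>+u. ?q u * ?m y u \<partial>lborel) \<partial>mu_alpha \<alpha>)"
    by (intro nn_integral_mono mult_left_mono inner) simp
  also have "\<dots> = (\<integral>\<^sup>+y. (\<integral>\<^sup>+u. ennreal \<bar>f y\<bar> * (?q u * ?m y u) \<partial>lborel) \<partial>mu_alpha \<alpha>)"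
    by (intro nn_integral_cong nn_integral_cmult[symmetric]) measurable
  also have "\<dots> = (\<integral>\<^sup>+u. (\<integral>\<^sup>+y. ennreal \<bar>f y\<bar> * (?q u * ?m y u) \<partial>mu_alpha \<alpha>) \<partial>lborel)"
    by (rule ml.Fubini'[symmetric]) measurable
  also have "\<dots> = (\<integral>\<^sup>+u. ?q u * (\<integral>\<^sup>+y. ennreal \<bar>f y\<bar> * ?m y u \<partial>mu_alpha \<alpha>) \<partial>lborel)"
  proof (rule nn_integral_cong)
    fix u
    have "(\<integral>\<^sup>+y. ennreal \<bar>f y\<bar> * (?q u * ?m y u) \<partial>mu_alpha \<alpha>)
       = (\<integral>\<^sup>+y. ?q u * (ennreal \<bar>f y\<bar> * ?m y u) \<partial>mu_alpha \<alpha>)"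
      by (intro nn_integral_cong) (simp add: mult_ac)
    also have "\<dots> = ?q u * (\<integral>\<^sup>+y. ennreal \<bar>f y\<bar> * ?m y u \<partial>mu_alpha \<alpha>)"
      by (rule nn_integral_cmult) measurable
    finally show "(\<integral>\<^sup>+y. ennreal \<bar>f y\<bar> * (?q u * ?m y u) \<partial>mu_alpha \<alpha>)
      = ?q u * (\<integral>\<^sup>+y. ennreal \<bar>f y\<bar> * ?m y u \<partial>mu_alpha \<alpha>)" .
  qed
  also have "\<dots> \<le> (\<integral>\<^sup>+u. ennreal (C0 * N) * (ennreal (\<rho> u * \<phi> u / u\<^sup>2) * indicator {a<..} u) \<partial>lborel)"
  proof (rule nn_integral_mono)
    fix u
    show "?q u * (\<integral>\<^sup>+y. ennreal \<bar>f y\<bar> * ?m y u \<partial>mu_alpha \<alpha>)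
      \<le> ennreal (C0 * N) * (ennreal (\<rho> u * \<phi> u / u\<^sup>2) * indicator {a<..} u)"
    proof (cases "a < u")
      case True
      then have u: "0 < u" using a by simp
      have "?q u * (\<integral>\<^sup>+y. ennreal \<bar>f y\<bar> * ?m y u \<partial>mu_alpha \<alpha>) \<le> ?q u * ennreal (\<phi> u * u powr d_alpha \<alpha> * N)"
        by (intro mult_left_mono morrey[OF u]) simp
      also have "\<dots> = ennreal (C0 * (\<rho> u / u powr (d_alpha \<alpha> + 2)) * (\<phi> u * u powr d_alpha \<alpha> * N))"
        using True C0_pos rho_pos[OF u] phi_pos[OF u] N by (simp add: ennreal_mult[symmetric] less_imp_le)
      also have "C0 * (\<rho> u / u powr (d_alpha \<alpha> + 2)) * (\<phi> u * u powr d_alpha \<alpha> * N) = C0 * N * (\<rho> u * \<phi> u / u\<^sup>2)"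
        using u by (simp add: powr_add)
      also have "ennreal \<dots> = ennreal (C0 * N) * (ennreal (\<rho> u * \<phi> u / u\<^sup>2) * indicator {a<..} u)"
        using True C0_pos rho_pos[OF u] phi_pos[OF u] N by (subst ennreal_mult) auto
      finally show ?thesis .
    qed simp
  qed
  also have "\<dots> = ennreal (C0 * N) * far a"
    unfolding far_def by (rule nn_integral_cmult) measurable
  finally show ?thesis .
qed

end

lemma ennreal_le_divide:
  assumes "0 < k" "0 \<le> B" "ennreal k * I \<le> ennreal B" shows "I \<le> ennreal (B / k)"
proof -
  have "I = ennreal (1 / k) * (ennreal k * I)"
    using assms(1) by (simp add: mult.assoc[symmetric] ennreal_mult[symmetric])
  also have "\<dots> \<le> ennreal (1 / k) * ennreal B" using assms(3) by (rule mult_left_mono) simp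
  also have "\<dots> = ennreal (B / k)" using assms by (simp add: ennreal_mult[symmetric])
  finally show ?thesis .
qed

context morrey_function
begin

text \<open>At a fixed angle the two radii differ by at most D, so the pointwise comparison of tails
  integrates to two copies of the preceding layer-cake bound.\<close>

lemma tail_diff_bound:
  assumes D: "\<bar>x - x'\<bar> \<le> D" and a: "0 < a" "a \<le> D" and b: "0 < b" "b \<le> D"
  shows "(\<integral>\<^sup>+y. ennreal \<bar>f y\<bar> * (\<integral>\<^sup>+t. ennreal \<bar>Ktail a (rad x y t) - Ktail b (rad x' y t)\<bar> \<partial>ang \<alpha>) \<partial>mu_alpha \<alpha>)
    \<le> ennreal ((5 + Cd) * D * C0 * N) * (far a + far b)"
proof -
  let ?d = "\<lambda>y t. \<bar>Ktail a (rad x y t) - Ktail b (rad x' y t)\<bar>"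
  let ?u = "\<lambda>y t. Ktail a (rad x y t) / rad x y t" and ?v = "\<lambda>y t. Ktail b (rad x' y t) / rad x' y t"
  have D0: "0 \<le> (5 + Cd) * D" using a Cd by simp
  have n: "0 \<le> Ktail c s / s" if "0 < c" for c s
    using Ktail_nonneg[of c s] that by (cases "c \<le> s") (auto simp: Ktail_def)
  have inner: "(\<integral>\<^sup>+t. ennreal (?d y t) \<partial>ang \<alpha>)
     \<le> (\<integral>\<^sup>+t. ennreal ((5 + Cd) * D) * (ennreal (?u y t) + ennreal (?v y t)) \<partial>ang \<alpha>)" for y
  proof (rule nn_integral_mono_AE)
    show "AE t in ang \<alpha>. ennreal (?d y t)
       \<le> ennreal ((5 + Cd) * D) * (ennreal (?u y t) + ennreal (?v y t))"
      using AE_ang_abs_le[of \<alpha>]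
    proof eventually_elim
      case (elim t)
      have "?d y t \<le> (5 + Cd) * D * (?u y t + ?v y t)"
        using rad_lipschitz[OF elim, of x y x'] D rad_nonneg[OF elim] a b by (intro Ktail_diff) auto
      then have "ennreal (?d y t) \<le> ennreal ((5 + Cd) * D * (?u y t + ?v y t))"
        by (rule ennreal_leI)
      also have "\<dots> = ennreal ((5 + Cd) * D) * (ennreal (?u y t) + ennreal (?v y t))"
        using D0 n a b by (subst ennreal_mult) (auto simp del: ennreal_plus simp: ennreal_plus[symmetric] intro!: add_nonneg_nonneg)
      finally show ?case .
    qed
  qed
  have "(\<integral>\<^sup>+y. ennreal \<bar>f y\<bar> * (\<integral>\<^sup>+t. ennreal (?d y t) \<partial>ang \<alpha>) \<partial>mu_alpha \<alpha>)
     \<le> (\<integral>\<^sup>+y. ennreal \<bar>f y\<bar> * (\<integral>\<^sup>+t. ennreal ((5 + Cd) * D) * (ennreal (?u y t) + ennreal (?v y t)) \<partial>ang \<alpha>) \<partial>mu_alpha \<alpha>)"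
    by (rule nn_integral_mono, rule mult_left_mono[OF inner]) simp
  also have "\<dots> = (\<integral>\<^sup>+y. ennreal ((5 + Cd) * D) * (ennreal \<bar>f y\<bar> * (\<integral>\<^sup>+t. ennreal (?u y t) \<partial>ang \<alpha>)
       + ennreal \<bar>f y\<bar> * (\<integral>\<^sup>+t. ennreal (?v y t) \<partial>ang \<alpha>)) \<partial>mu_alpha \<alpha>)"
  proof (rule nn_integral_cong)
    fix y
    have "(\<integral>\<^sup>+t. ennreal ((5 + Cd) * D) * (ennreal (?u y t) + ennreal (?v y t)) \<partial>ang \<alpha>)
      = ennreal ((5 + Cd) * D) * (\<integral>\<^sup>+t. ennreal (?u y t) + ennreal (?v y t) \<partial>ang \<alpha>)"
      by (rule nn_integral_cmult) measurable
    also have "(\<integral>\<^sup>+t. ennreal (?u y t) + ennreal (?v y t) \<partial>ang \<alpha>)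
      = (\<integral>\<^sup>+t. ennreal (?u y t) \<partial>ang \<alpha>) + (\<integral>\<^sup>+t. ennreal (?v y t) \<partial>ang \<alpha>)"
      by (rule nn_integral_add) measurable
    finally show "ennreal \<bar>f y\<bar> * (\<integral>\<^sup>+t. ennreal ((5 + Cd) * D) * (ennreal (?u y t) + ennreal (?v y t)) \<partial>ang \<alpha>)
      = ennreal ((5 + Cd) * D) * (ennreal \<bar>f y\<bar> * (\<integral>\<^sup>+t. ennreal (?u y t) \<partial>ang \<alpha>)
       + ennreal \<bar>f y\<bar> * (\<integral>\<^sup>+t. ennreal (?v y t) \<partial>ang \<alpha>))"
      by (simp only: distrib_left mult_ac)
  qed
  also have "\<dots> = ennreal ((5 + Cd) * D) * (\<integral>\<^sup>+y. ennreal \<bar>f y\<bar> * (\<integral>\<^sup>+t. ennreal (?u y t) \<partial>ang \<alpha>)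
       + ennreal \<bar>f y\<bar> * (\<integral>\<^sup>+t. ennreal (?v y t) \<partial>ang \<alpha>) \<partial>mu_alpha \<alpha>)"
    by (rule nn_integral_cmult) measurable
  also have "(\<integral>\<^sup>+y. ennreal \<bar>f y\<bar> * (\<integral>\<^sup>+t. ennreal (?u y t) \<partial>ang \<alpha>)
       + ennreal \<bar>f y\<bar> * (\<integral>\<^sup>+t. ennreal (?v y t) \<partial>ang \<alpha>) \<partial>mu_alpha \<alpha>)
     = (\<integral>\<^sup>+y. ennreal \<bar>f y\<bar> * (\<integral>\<^sup>+t. ennreal (?u y t) \<partial>ang \<alpha>) \<partial>mu_alpha \<alpha>)
       + (\<integral>\<^sup>+y. ennreal \<bar>f y\<bar> * (\<integral>\<^sup>+t. ennreal (?v y t) \<partial>ang \<alpha>) \<partial>mu_alpha \<alpha>)"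
    by (rule nn_integral_add) measurable
  also have "ennreal ((5 + Cd) * D) * \<dots> \<le> ennreal ((5 + Cd) * D) * (ennreal (C0 * N) * far a + ennreal (C0 * N) * far b)"
    by (intro mult_left_mono add_mono tail_over_bound a b) simp
  also have "\<dots> = (ennreal ((5 + Cd) * D) * ennreal (C0 * N)) * (far a + far b)"
    by (simp only: distrib_left mult.assoc)
  also have "ennreal ((5 + Cd) * D) * ennreal (C0 * N) = ennreal ((5 + Cd) * D * C0 * N)"
    using D0 C0_pos N by (subst ennreal_mult[symmetric]) (auto simp: mult.assoc)
  finally show ?thesis .
qed

text \<open>For y in the annulus, whichever of x and -x is opposite in sign to y sees it at radius
  below 3 r with angular measure at least k. Summing the two Morrey bounds and dividing by k turns r
  powr d into r (|x| + r) powr (2 \<alpha> + 1).\<close>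

lemma annulus_bound:
  assumes c: "0 < c" and low: "\<And>x y r. \<lbrakk>0 < r; x * y \<le> 0; \<bar>\<bar>y\<bar> - \<bar>x\<bar>\<bar> < r\<rbrakk> \<Longrightarrow>
     ennreal (c * (r / (\<bar>x\<bar> + r)) powr (2 * \<alpha> + 1)) \<le> emeasure (ang \<alpha>) {t. rad x y t < 3 * r}"
    and r: "0 < r"
  shows "(\<integral>\<^sup>+y. ennreal \<bar>f y\<bar> * indicator {y. \<bar>\<bar>y\<bar> - \<bar>x\<bar>\<bar> < r} y \<partial>mu_alpha \<alpha>)
      \<le> ennreal (Cann c * (\<phi> r * r * (\<bar>x\<bar> + r) powr (2 * \<alpha> + 1)) * N)"
proof -
    let ?m = "\<lambda>x y. emeasure (ang \<alpha>) {t. rad x y t < 3 * r}"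
    define k where "k = c * (r / (\<bar>x\<bar> + r)) powr (2 * \<alpha> + 1)"
    have xr: "0 < \<bar>x\<bar> + r" using r by simp
    have k: "0 < k" using c r xr by (simp add: k_def)
    have [measurable]: "{y. \<bar>\<bar>y\<bar> - \<bar>x\<bar>\<bar> < r} \<in> sets borel" by measurable
    note [measurable] = measurable_emeasure_ang_rad[OF alpha]
    have "ennreal k * (\<integral>\<^sup>+y. ennreal \<bar>f y\<bar> * indicator {y. \<bar>\<bar>y\<bar> - \<bar>x\<bar>\<bar> < r} y \<partial>mu_alpha \<alpha>)
       = (\<integral>\<^sup>+y. ennreal k * (ennreal \<bar>f y\<bar> * indicator {y. \<bar>\<bar>y\<bar> - \<bar>x\<bar>\<bar> < r} y) \<partial>mu_alpha \<alpha>)"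
      by (rule nn_integral_cmult[symmetric]) measurable
    also have "\<dots> \<le> (\<integral>\<^sup>+y. ennreal \<bar>f y\<bar> * ?m x y + ennreal \<bar>f y\<bar> * ?m (-x) y \<partial>mu_alpha \<alpha>)"
    proof (rule nn_integral_mono)
      fix y
      show "ennreal k * (ennreal \<bar>f y\<bar> * indicator {y. \<bar>\<bar>y\<bar> - \<bar>x\<bar>\<bar> < r} y) \<le> ennreal \<bar>f y\<bar> * ?m x y + ennreal \<bar>f y\<bar> * ?m (-x) y"
      proof (cases "\<bar>\<bar>y\<bar> - \<bar>x\<bar>\<bar> < r")
        case True
        have "ennreal k \<le> ?m x y + ?m (-x) y"
        proof (cases "x * y \<le> 0")
          case le: True
          have "ennreal k \<le> ?m x y" unfolding k_def by (rule low[OF r le True])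
          then show ?thesis by (simp add: add_increasing2)
        next
          case False
          then have "ennreal k \<le> ?m (-x) y" unfolding k_def using low[OF r, of "-x" y] True by simp
          then show ?thesis by (simp add: add_increasing)
        qed
        then have "ennreal \<bar>f y\<bar> * ennreal k \<le> ennreal \<bar>f y\<bar> * (?m x y + ?m (-x) y)" by (intro mult_left_mono) auto
        then show ?thesis using True by (simp add: distrib_left mult.commute)
      qed simp
    qed
    also have "\<dots> = (\<integral>\<^sup>+y. ennreal \<bar>f y\<bar> * ?m x y \<partial>mu_alpha \<alpha>) + (\<integral>\<^sup>+y. ennreal \<bar>f y\<bar> * ?m (-x) y \<partial>mu_alpha \<alpha>)"
      by (rule nn_integral_add) measurable
    also have "\<dots> \<le> ennreal (\<phi> (3 * r) * (3 * r) powr d_alpha \<alpha> * N) + ennreal (\<phi> (3 * r) * (3 * r) powr d_alpha \<alpha> * N)"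
      using r by (intro add_mono morrey) auto
    also have "\<dots> = ennreal (2 * (\<phi> (3 * r) * (3 * r) powr d_alpha \<alpha> * N))"
      using phi_pos[of "3 * r"] r N by (subst ennreal_plus[symmetric]) auto
    also have "\<dots> \<le> ennreal (2 * (C\<phi> * C\<phi> * \<phi> r * (3 * r) powr d_alpha \<alpha> * N))"
    proof -
      have "\<phi> (3 * r) \<le> C\<phi> * \<phi> (3 / 2 * r)" using r by (intro phi_doubling) auto
      also have "\<dots> \<le> C\<phi> * (C\<phi> * \<phi> r)" using r C\<phi>_ge_1 by (intro mult_left_mono phi_doubling) auto
      finally show ?thesis using N by (intro ennreal_leI mult_left_mono mult_right_mono) auto
    qed
    finally have "(\<integral>\<^sup>+y. ennreal \<bar>f y\<bar> * indicator {y. \<bar>\<bar>y\<bar> - \<bar>x\<bar>\<bar> < r} y \<partial>mu_alpha \<alpha>)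
       \<le> ennreal (2 * (C\<phi> * C\<phi> * \<phi> r * (3 * r) powr d_alpha \<alpha> * N) / k)"
      using k C\<phi>_ge_1 phi_pos[OF r] N by (intro ennreal_le_divide) auto
    also have "2 * (C\<phi> * C\<phi> * \<phi> r * (3 * r) powr d_alpha \<alpha> * N) / k = Cann c * (\<phi> r * r * (\<bar>x\<bar> + r) powr (2 * \<alpha> + 1)) * N"
    proof -
      have "(3 * r) powr d_alpha \<alpha> = 3 powr d_alpha \<alpha> * (r powr (2 * \<alpha> + 1) * r)"
        using r powr_add[of r "2 * \<alpha> + 1" 1] by (simp add: powr_mult d_alpha_def add.commute)
      moreover have "k = c * (r powr (2 * \<alpha> + 1) / (\<bar>x\<bar> + r) powr (2 * \<alpha> + 1))"
        using r xr by (simp add: k_def powr_divide)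
      moreover have "0 < r powr (2 * \<alpha> + 1)" "0 < (\<bar>x\<bar> + r) powr (2 * \<alpha> + 1)" using r xr by simp_all
      ultimately show ?thesis using c by (simp add: Cann_def)
    qed
    finally show "(\<integral>\<^sup>+y. ennreal \<bar>f y\<bar> * indicator {y. \<bar>\<bar>y\<bar> - \<bar>x\<bar>\<bar> < r} y \<partial>mu_alpha \<alpha>)
      \<le> ennreal (Cann c * (\<phi> r * r * (\<bar>x\<bar> + r) powr (2 * \<alpha> + 1)) * N)" .
qed

text \<open>The contribution of radii below r, with |f| in place of f. It may be infinite at
  individual z; only its integral over an annulus is controlled.\<close>

definition loc :: "real \<Rightarrow> real \<Rightarrow> ennreal" where
  "loc r z = (\<integral>\<^sup>+y. ennreal \<bar>f y\<bar> * (\<integral>\<^sup>+t. ennreal (K (rad z y t) * indicator {..<r} (rad z y t)) \<partial>ang \<alpha>) \<partial>mu_alpha \<alpha>)"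

lemma measurable_loc [measurable]: "loc r \<in> borel_measurable borel"
  unfolding loc_def[abs_def] by measurable

text \<open>A radius below r keeps |y| within r of |z|, so only y in the annulus of half-width 2 r
  contribute. Integrating z first costs the kernel mass 4 \<open>A_alpha\<close> times
  \<open>near\<close>, and the annulus bound at 2 r handles what is left of f.\<close>

lemma loc_bound:
  assumes c: "0 < c" and low: "\<And>x y r. \<lbrakk>0 < r; x * y \<le> 0; \<bar>\<bar>y\<bar> - \<bar>x\<bar>\<bar> < r\<rbrakk> \<Longrightarrow>
     ennreal (c * (r / (\<bar>x\<bar> + r)) powr (2 * \<alpha> + 1)) \<le> emeasure (ang \<alpha>) {t. rad x y t < 3 * r}"
    and r: "0 < r"
  shows "(\<integral>\<^sup>+z. indicator {z. \<bar>\<bar>z\<bar> - \<bar>x\<bar>\<bar> < r} z * loc r z \<partial>mu_alpha \<alpha>)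
      \<le> ennreal (Cloc c * (\<phi> r * r * (\<bar>x\<bar> + r) powr (2 * \<alpha> + 1)) * N) * near r"
proof -
  let ?X = "Cann c * ((C\<phi> * \<phi> r) * (2 * r) * (2 powr (2 * \<alpha> + 1) * (\<bar>x\<bar> + r) powr (2 * \<alpha> + 1))) * N"
  have CH: "0 < Cann c" by (rule Cann_pos[OF c])
  have A: "0 < A_alpha \<alpha>" by (rule A_alpha_pos[OF alpha])
    define h where "h s = ennreal (K s * indicator {..<r} s)" for s
    have hm [measurable]: "h \<in> borel_measurable borel" unfolding h_def[abs_def] by measurable
    let ?I = "\<lambda>u z. indicator {z. \<bar>\<bar>z\<bar> - \<bar>x\<bar>\<bar> < u} z :: ennreal"
    let ?H = "\<lambda>z y. \<integral>\<^sup>+t. h (rad z y t) \<partial>ang \<alpha>"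
    let ?w = "\<lambda>y. ennreal \<bar>f y\<bar> * ?I (2 * r) y"
    have [measurable]: "{y. \<bar>\<bar>y\<bar> - \<bar>x\<bar>\<bar> < u} \<in> sets borel" for u by measurable
    have "(\<integral>\<^sup>+z. ?I r z * loc r z \<partial>mu_alpha \<alpha>)
      = (\<integral>\<^sup>+z. (\<integral>\<^sup>+y. ?I r z * (ennreal \<bar>f y\<bar> * ?H z y) \<partial>mu_alpha \<alpha>) \<partial>mu_alpha \<alpha>)"
      unfolding loc_def h_def[symmetric] by (intro nn_integral_cong nn_integral_cmult[symmetric]) measurable
    also have "\<dots> \<le> (\<integral>\<^sup>+z. (\<integral>\<^sup>+y. ?w y * ?H z y \<partial>mu_alpha \<alpha>) \<partial>mu_alpha \<alpha>)"
    proof (intro nn_integral_mono)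
      fix z y
      have "?I r z * ?H z y \<le> ?I (2 * r) y * ?H z y"
      proof (cases "\<bar>\<bar>z\<bar> - \<bar>x\<bar>\<bar> < r \<and> \<not> \<bar>\<bar>y\<bar> - \<bar>x\<bar>\<bar> < 2 * r")
        case True
        have "?H z y = (\<integral>\<^sup>+t. 0 \<partial>ang \<alpha>)"
        proof (rule nn_integral_cong_AE)
          show "AE t in ang \<alpha>. h (rad z y t) = 0"
            using AE_ang_abs_le[of \<alpha>]
          proof eventually_elim
            case (elim t)
            have "r \<le> \<bar>\<bar>z\<bar> - \<bar>y\<bar>\<bar>" using True by (auto simp: abs_less_iff)
            then show ?case using rad_bounds(1)[OF elim, of z y] by (simp add: h_def)
          qed
        qed
        then show ?thesis by simp
      qed (auto split: split_indicator)
      from mult_left_mono[OF this, of "ennreal \<bar>f y\<bar>"]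
      show "?I r z * (ennreal \<bar>f y\<bar> * ?H z y) \<le> ?w y * ?H z y"
        by (simp add: mult_ac)
    qed
    also have "\<dots> = (\<integral>\<^sup>+y. (\<integral>\<^sup>+z. ?w y * ?H z y \<partial>mu_alpha \<alpha>) \<partial>mu_alpha \<alpha>)"
      by (rule mm.Fubini') measurable
    also have "\<dots> \<le> (\<integral>\<^sup>+y. ennreal (4 * A_alpha \<alpha>) * near r * ?w y \<partial>mu_alpha \<alpha>)"
    proof (rule nn_integral_mono_AE)
      show "AE y in mu_alpha \<alpha>. (\<integral>\<^sup>+z. ?w y * ?H z y \<partial>mu_alpha \<alpha>)
         \<le> ennreal (4 * A_alpha \<alpha>) * near r * ?w y"
        using AE_mu_alpha_neq[of 0 \<alpha>]
      proof eventually_elim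
        case (elim y)
        have "(\<integral>\<^sup>+z. ?w y * ?H z y \<partial>mu_alpha \<alpha>)
           = ?w y * (\<integral>\<^sup>+z. ?H z y \<partial>mu_alpha \<alpha>)"
          by (rule nn_integral_cmult) measurable
        also have "\<dots> \<le> ?w y * (2 * (\<integral>\<^sup>+s. h \<bar>s\<bar> \<partial>mu_alpha \<alpha>))"
          by (intro mult_left_mono nn_integral_rad_le[OF alpha elim hm]) simp
        also have "2 * (\<integral>\<^sup>+s. h \<bar>s\<bar> \<partial>mu_alpha \<alpha>) = ennreal (4 * A_alpha \<alpha>) * near r"
          unfolding h_def nn_integral_K_ball using A by (simp add: mult.assoc[symmetric] ennreal_mult[symmetric] flip: ennreal_numeral)
        finally show ?case by (simp add: mult.commute)
      qed
    qed
    also have "\<dots> = ennreal (4 * A_alpha \<alpha>) * near r * (\<integral>\<^sup>+y. ennreal \<bar>f y\<bar> * ?I (2 * r) y \<partial>mu_alpha \<alpha>)"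
      by (rule nn_integral_cmult) measurable
    also have "\<dots> \<le> ennreal (4 * A_alpha \<alpha>) * near r * ennreal (Cann c * (\<phi> (2 * r) * (2 * r) * (\<bar>x\<bar> + 2 * r) powr (2 * \<alpha> + 1)) * N)"
      using r by (intro mult_left_mono annulus_bound[OF c low]) auto
    also have "\<dots> \<le> ennreal (4 * A_alpha \<alpha>) * near r * ennreal ?X"
    proof -
      have "\<phi> (2 * r) \<le> C\<phi> * \<phi> r" using r by (intro phi_doubling) auto
      moreover have "(\<bar>x\<bar> + 2 * r) powr (2 * \<alpha> + 1) \<le> (2 * (\<bar>x\<bar> + r)) powr (2 * \<alpha> + 1)"
        using r alpha by (intro powr_mono2) auto
      moreover have "\<dots> = 2 powr (2 * \<alpha> + 1) * (\<bar>x\<bar> + r) powr (2 * \<alpha> + 1)" by (rule powr_mult)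
      ultimately have "Cann c * (\<phi> (2 * r) * (2 * r) * (\<bar>x\<bar> + 2 * r) powr (2 * \<alpha> + 1)) * N
         \<le> ?X"
        using CH N r phi_pos[of r] phi_pos[of "2*r"] C\<phi>_ge_1
        by (intro mult_right_mono mult_left_mono mult_mono) auto
      then show ?thesis by (intro mult_left_mono ennreal_leI) auto
    qed
    also have "\<dots> = ennreal (4 * A_alpha \<alpha>) * ennreal ?X * near r"
      by (simp only: mult_ac)
    also have "ennreal (4 * A_alpha \<alpha>) * ennreal ?X
      = ennreal (4 * A_alpha \<alpha> * ?X)"
      using CH N r phi_pos[of r] C\<phi>_ge_1 A by (intro ennreal_mult[symmetric] mult_nonneg_nonneg) auto
    also have "4 * A_alpha \<alpha> * ?X
      = Cloc c * (\<phi> r * r * (\<bar>x\<bar> + r) powr (2 * \<alpha> + 1)) * N"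
      by (simp add: Cloc_def)
    finally show "(\<integral>\<^sup>+z. ?I r z * loc r z \<partial>mu_alpha \<alpha>) \<le> ennreal (Cloc c * (\<phi> r * r * (\<bar>x\<bar> + r) powr (2 * \<alpha> + 1)) * N) * near r" .
qed

end

section \<open>Oscillation of the modified operator\<close>

lemma emeasure_mu_alpha_annulus:
  assumes a: "-1/2 \<le> \<alpha>" and r: "0 < r"
  shows "emeasure (mu_alpha \<alpha>) {z. \<bar>\<bar>z\<bar> - \<bar>x\<bar>\<bar> < r} \<le> ennreal (4 * A_alpha \<alpha> * (r * (\<bar>x\<bar> + r) powr (2 * \<alpha> + 1)))"
proof -
  have A: "0 < A_alpha \<alpha>" by (rule A_alpha_pos[OF a])
  let ?S = "{z. \<bar>\<bar>z\<bar> - \<bar>x\<bar>\<bar> < r}"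
  have [measurable]: "?S \<in> sets borel" by measurable
  have "emeasure (mu_alpha \<alpha>) ?S \<le> ennreal (A_alpha \<alpha> * (\<bar>x\<bar> + r) powr (2 * \<alpha> + 1)) * emeasure lborel ?S"
    by (rule emeasure_mu_alpha_upper[OF a]) (auto simp: abs_less_iff)
  also have "emeasure lborel ?S \<le> emeasure lborel ({\<bar>x\<bar> - r..\<bar>x\<bar> + r} \<union> {- \<bar>x\<bar> - r..- \<bar>x\<bar> + r})"
    by (intro emeasure_mono) (auto simp: abs_if split: if_splits)
  also have "\<dots> \<le> emeasure lborel {\<bar>x\<bar> - r..\<bar>x\<bar> + r} + emeasure lborel {- \<bar>x\<bar> - r..- \<bar>x\<bar> + r}"
    by (rule emeasure_subadditive) auto
  also have "\<dots> = ennreal (4 * r)" using r by (simp add: ennreal_plus[symmetric] del: ennreal_plus)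
  finally have "emeasure (mu_alpha \<alpha>) ?S \<le> ennreal (A_alpha \<alpha> * (\<bar>x\<bar> + r) powr (2 * \<alpha> + 1)) * ennreal (4 * r)"
    by (simp add: mult_left_mono)
  also have "\<dots> = ennreal (4 * A_alpha \<alpha> * (r * (\<bar>x\<bar> + r) powr (2 * \<alpha> + 1)))"
    using A r by (subst ennreal_mult[symmetric]) (auto simp: mult_ac)
  finally show ?thesis .
qed

section \<open>Translated and truncated kernels\<close>

context riesz_setup
begin

text \<open>For |z| different from |y| the radius stays in a compact interval away from the
  singularity at 0.\<close>

lemma K_rad_integrable:
  assumes "\<bar>z\<bar> \<noteq> \<bar>y\<bar>"
  shows "integrable (ang \<alpha>) (\<lambda>t. K (rad z y t))"
    and "y \<noteq> 0 \<Longrightarrow> dunkl_trans \<alpha> z K y = (\<integral>t. K (rad z y t) \<partial>ang \<alpha>)"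
proof -
  have "0 < \<bar>\<bar>z\<bar> - \<bar>y\<bar>\<bar>" using assms by simp
  then obtain B where B: "\<And>s. \<lbrakk>\<bar>\<bar>z\<bar> - \<bar>y\<bar>\<bar> \<le> s; s \<le> \<bar>z\<bar> + \<bar>y\<bar>\<rbrakk> \<Longrightarrow> K s \<le> B"
    using K_bounded by blast
  show "integrable (ang \<alpha>) (\<lambda>t. K (rad z y t))"
  proof (rule ang.integrable_const_bound[of _ B])
    show "AE t in ang \<alpha>. norm (K (rad z y t)) \<le> B"
      using AE_ang_abs_le[of \<alpha>] by eventually_elim (use B rad_bounds K_nonneg in auto)
  qed measurable
  assume "y \<noteq> 0"
  then show "dunkl_trans \<alpha> z K y = (\<integral>t. K (rad z y t) \<partial>ang \<alpha>)"
    by (rule dunkl_trans_even[OF alpha _ measurable_K K_nonneg K_abs B])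
qed

lemma Ktail_rad_integrable:
  assumes a: "0 < a" shows "integrable (ang \<alpha>) (\<lambda>t. Ktail a (rad x y t))"
proof -
  obtain B where B: "\<And>s. \<lbrakk>a \<le> s; s \<le> \<bar>x\<bar> + \<bar>y\<bar>\<rbrakk> \<Longrightarrow> K s \<le> B" using K_bounded[OF a] by blast
  show ?thesis
  proof (rule ang.integrable_const_bound[of _ "max B 0"])
    show "AE t in ang \<alpha>. norm (Ktail a (rad x y t)) \<le> max B 0"
      using AE_ang_abs_le[of \<alpha>]
    proof eventually_elim
      case (elim t)
      show ?case using B[of "rad x y t"] rad_bounds(2)[OF elim, of x y] K_nonneg[of "rad x y t"]
        by (cases "a \<le> rad x y t") (auto simp: Ktail_def)
    qed
  qed measurable
qed

text \<open>The translate of the truncated kernel, given directly as an angular average so that no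
  exceptional points occur.\<close>

definition mtail :: "real \<Rightarrow> real \<Rightarrow> real \<Rightarrow> real" where
  "mtail x a y = (\<integral>t. Ktail a (rad x y t) \<partial>ang \<alpha>)"

lemma measurable_mtail [measurable]: "mtail x a \<in> borel_measurable borel"
  unfolding mtail_def[abs_def] by measurable

text \<open>At centre 0 every radius is |y|. Hence the term subtracted in \<open>modT\<close> is
  itself a tail, and the tail comparison also covers it.\<close>

lemma mtail_zero_one: "mtail 0 1 y = K y * (1 - indicator {-1<..<1} y)"
proof -
  have "mtail 0 1 y = Ktail 1 \<bar>y\<bar>" using ang.prob_space by (simp add: mtail_def rad_zero)
  also have "\<dots> = K y * (1 - indicator {-1<..<1} y)" by (auto simp: Ktail_def K_abs indicator_def)
  finally show ?thesis .
qed

lemma modT_eq: "modT \<alpha> \<rho> f z = (\<integral>y. f y * (dunkl_trans \<alpha> z K y - mtail 0 1 y) \<partial>mu_alpha \<alpha>)"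
  unfolding modT_def mtail_zero_one K_def[abs_def] by simp

lemma measurable_modT:
  assumes [measurable]: "f \<in> borel_measurable borel"
  shows "modT \<alpha> \<rho> f \<in> borel_measurable borel"
proof -
  have "(\<lambda>z. (\<integral>y. f y * (dunkl_trans \<alpha> z K y - mtail 0 1 y) \<partial>mu_alpha \<alpha>)) \<in> borel_measurable borel"
    unfolding dunkl_trans_def by measurable
  then show ?thesis unfolding modT_eq[abs_def] .
qed

end

section \<open>Distance of the operator from its truncated value at the centre\<close>

context morrey_function
begin

text \<open>The constant from which oscillation is measured: the modified operator at x with radii
  below r removed. It does not depend on the point z being compared.\<close>

definition center :: "real \<Rightarrow> real \<Rightarrow> real" where
  "center x r = (\<integral>y. f y * (mtail x r y - mtail 0 1 y) \<partial>mu_alpha \<alpha>)"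

lemma mtail_diff_bound:
  assumes D: "\<bar>x - x'\<bar> \<le> D" and a: "0 < a" "a \<le> D" and b: "0 < b" "b \<le> D"
  shows "(\<integral>\<^sup>+y. ennreal \<bar>f y * (mtail x a y - mtail x' b y)\<bar> \<partial>mu_alpha \<alpha>) \<le> ennreal ((5 + Cd) * D * C0 * N) * (far a + far b)"
proof -
  have "(\<integral>\<^sup>+y. ennreal \<bar>f y * (mtail x a y - mtail x' b y)\<bar> \<partial>mu_alpha \<alpha>)
     \<le> (\<integral>\<^sup>+y. ennreal \<bar>f y\<bar> * (\<integral>\<^sup>+t. ennreal \<bar>Ktail a (rad x y t) - Ktail b (rad x' y t)\<bar> \<partial>ang \<alpha>) \<partial>mu_alpha \<alpha>)"
  proof (rule nn_integral_mono)
    fix y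
    have i: "integrable (ang \<alpha>) (\<lambda>t. Ktail a (rad x y t) - Ktail b (rad x' y t))"
      by (intro Bochner_Integration.integrable_diff Ktail_rad_integrable a b)
    have "mtail x a y - mtail x' b y = (\<integral>t. Ktail a (rad x y t) - Ktail b (rad x' y t) \<partial>ang \<alpha>)"
      unfolding mtail_def by (intro Bochner_Integration.integral_diff[symmetric] Ktail_rad_integrable a b)
    then have "ennreal \<bar>mtail x a y - mtail x' b y\<bar> \<le> (\<integral>\<^sup>+t. ennreal \<bar>Ktail a (rad x y t) - Ktail b (rad x' y t)\<bar> \<partial>ang \<alpha>)"
      using integral_norm_bound_ennreal[OF i] by simp
    then show "ennreal \<bar>f y * (mtail x a y - mtail x' b y)\<bar> \<le> ennreal \<bar>f y\<bar> * (\<integral>\<^sup>+t. ennreal \<bar>Ktail a (rad x y t) - Ktail b (rad x' y t)\<bar> \<partial>ang \<alpha>)"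
      by (simp add: abs_mult ennreal_mult mult_left_mono)
  qed
  also have "\<dots> \<le> ennreal ((5 + Cd) * D * C0 * N) * (far a + far b)" by (rule tail_diff_bound[OF assms])
  finally show ?thesis .
qed

text \<open>At z the kernel splits into radii below r, which give \<open>loc\<close>, and the tail
  at z, which differs from the tail at x by D times \<open>far\<close>. Where \<open>loc\<close> is
  infinite, and \<open>modT\<close> might be a default value, the bound is trivial.\<close>

lemma modT_minus_center:
  assumes fin: "\<And>a. 0 < a \<Longrightarrow> far a < \<infinity>" and r: "0 < r" "r \<le> D" and D: "\<bar>z - x\<bar> \<le> D"
  shows "ennreal \<bar>modT \<alpha> \<rho> f z - center x r\<bar> \<le> loc r z + ennreal (2 * ((5 + Cd) * D * C0 * N)) * far r"
proof (cases "loc r z = \<infinity>")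
  case False
  have i0: "integrable (mu_alpha \<alpha>) (\<lambda>y. f y * (mtail x r y - mtail 0 1 y))"
  proof (rule integrableI_bounded)
    \<comment> \<open>Convergence of \<open>center\<close> comes from the same comparison, between x
      and 0 and with cutoffs r and 1; all three lengths must lie below the distance
      parameter.\<close>
    let ?D = "max (max \<bar>x\<bar> r) 1"
    have "(\<integral>\<^sup>+y. ennreal (norm (f y * (mtail x r y - mtail 0 1 y))) \<partial>mu_alpha \<alpha>) \<le> ennreal ((5 + Cd) * ?D * C0 * N) * (far r + far 1)"
      unfolding real_norm_def by (rule mtail_diff_bound) (use r in auto)
    also have "\<dots> < \<infinity>" using fin[OF r(1)] fin[of 1] by (simp add: ennreal_mult_less_top)
    finally show "(\<integral>\<^sup>+y. ennreal (norm (f y * (mtail x r y - mtail 0 1 y))) \<partial>mu_alpha \<alpha>) < \<infinity>" .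
  qed measurable
  let ?T = "\<lambda>y. dunkl_trans \<alpha> z K y"
  let ?E = "\<lambda>y. ennreal \<bar>f y * (mtail z r y - mtail x r y)\<bar>"
  let ?L = "\<lambda>y. ennreal \<bar>f y\<bar> * (\<integral>\<^sup>+t. ennreal (K (rad z y t) * indicator {..<r} (rad z y t)) \<partial>ang \<alpha>)"
  have mT [measurable]: "?T \<in> borel_measurable borel" by measurable
  have "AE y in mu_alpha \<alpha>. ennreal \<bar>f y * (?T y - mtail x r y)\<bar> \<le> ?L y + ?E y"
    using AE_mu_alpha_neq[of 0 \<alpha>] AE_mu_alpha_abs_neq[of "\<bar>z\<bar>" \<alpha>]
  proof eventually_elim
    case (elim y)
    have zy: "\<bar>z\<bar> \<noteq> \<bar>y\<bar>" using elim by simp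
    note kr = K_rad_integrable[OF zy]
    have split: "K s = K s * indicator {..<r} s + Ktail r s" for s by (auto simp: Ktail_def indicator_def)
    have i: "integrable (ang \<alpha>) (\<lambda>t. K (rad z y t) - Ktail r (rad z y t))"
      using kr(1) Ktail_rad_integrable[OF r(1)] by (rule Bochner_Integration.integrable_diff)
    have d: "K (rad z y t) - Ktail r (rad z y t) = K (rad z y t) * indicator {..<r} (rad z y t)" for t
      using split[of "rad z y t"] by simp
    have "?T y - mtail z r y = (\<integral>t. K (rad z y t) - Ktail r (rad z y t) \<partial>ang \<alpha>)"
      unfolding kr(2)[OF elim(1)] mtail_def
      using kr(1) Ktail_rad_integrable[OF r(1)] by (rule Bochner_Integration.integral_diff[symmetric])
    then have "ennreal \<bar>?T y - mtail z r y\<bar> \<le> (\<integral>\<^sup>+t. ennreal (norm (K (rad z y t) - Ktail r (rad z y t))) \<partial>ang \<alpha>)"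
      using integral_norm_bound_ennreal[OF i] by simp
    also have "\<dots> = (\<integral>\<^sup>+t. ennreal (K (rad z y t) * indicator {..<r} (rad z y t)) \<partial>ang \<alpha>)"
      unfolding d using K_nonneg by (simp add: abs_mult)
    finally have "ennreal \<bar>f y * (?T y - mtail z r y)\<bar> \<le> ?L y"
      by (simp add: abs_mult ennreal_mult mult_left_mono)
    moreover have "\<bar>f y * (?T y - mtail x r y)\<bar> \<le> \<bar>f y * (?T y - mtail z r y)\<bar> + \<bar>f y * (mtail z r y - mtail x r y)\<bar>"
      by (rule order_trans[OF _ abs_triangle_ineq]) (simp add: algebra_simps)
    then have "ennreal \<bar>f y * (?T y - mtail x r y)\<bar> \<le> ennreal (\<bar>f y * (?T y - mtail z r y)\<bar> + \<bar>f y * (mtail z r y - mtail x r y)\<bar>)"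
      by (rule ennreal_leI)
    then have "ennreal \<bar>f y * (?T y - mtail x r y)\<bar> \<le> ennreal \<bar>f y * (?T y - mtail z r y)\<bar> + ?E y"
      by simp
    ultimately show ?case by (meson add_right_mono order_trans)
  qed
  then have "(\<integral>\<^sup>+y. ennreal \<bar>f y * (?T y - mtail x r y)\<bar> \<partial>mu_alpha \<alpha>) \<le> (\<integral>\<^sup>+y. ?L y + ?E y \<partial>mu_alpha \<alpha>)"
    by (rule nn_integral_mono_AE)
  also have "\<dots> = (\<integral>\<^sup>+y. ?L y \<partial>mu_alpha \<alpha>) + (\<integral>\<^sup>+y. ?E y \<partial>mu_alpha \<alpha>)"
    by (rule nn_integral_add) measurable
  also have "\<dots> \<le> loc r z + ennreal ((5 + Cd) * D * C0 * N) * (far r + far r)"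
    unfolding loc_def using r D by (intro add_left_mono mtail_diff_bound) auto
  also have "ennreal ((5 + Cd) * D * C0 * N) * (far r + far r) = ennreal (2 * ((5 + Cd) * D * C0 * N)) * far r"
    using r Cd C0_pos N by (subst ennreal_mult) (auto simp: mult_ac mult_2[symmetric])
  finally have b: "(\<integral>\<^sup>+y. ennreal \<bar>f y * (?T y - mtail x r y)\<bar> \<partial>mu_alpha \<alpha>) \<le> loc r z + ennreal (2 * ((5 + Cd) * D * C0 * N)) * far r" .
  also have "\<dots> < \<infinity>" using False fin[OF r(1)] by (simp add: ennreal_mult_less_top top.not_eq_extremum)
  finally have i1: "integrable (mu_alpha \<alpha>) (\<lambda>y. f y * (?T y - mtail x r y))"
    by (intro integrableI_bounded) auto
  have "modT \<alpha> \<rho> f z = (\<integral>y. f y * (?T y - mtail x r y) + f y * (mtail x r y - mtail 0 1 y) \<partial>mu_alpha \<alpha>)"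
    unfolding modT_eq by (simp add: algebra_simps)
  also have "\<dots> = (\<integral>y. f y * (?T y - mtail x r y) \<partial>mu_alpha \<alpha>) + center x r"
    unfolding center_def by (rule Bochner_Integration.integral_add[OF i1 i0])
  finally have "ennreal \<bar>modT \<alpha> \<rho> f z - center x r\<bar> \<le> (\<integral>\<^sup>+y. ennreal \<bar>f y * (?T y - mtail x r y)\<bar> \<partial>mu_alpha \<alpha>)"
    using integral_norm_bound_ennreal[OF i1] by simp
  then show ?thesis using b by (rule order_trans)
qed simp

text \<open>The angular factor in \<open>cw\<close> converts the annulus mass r (|x| + r) powr (2
  \<alpha> + 1) into r powr d, in the local part and in the tail part alike. Thus x disappears from
  the bound.\<close>

lemma oscillation_bound:
  assumes fin: "\<And>a. 0 < a \<Longrightarrow> far a < \<infinity>"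
    and c: "0 < c" and low: "\<And>x y r. \<lbrakk>0 < r; x * y \<le> 0; \<bar>\<bar>y\<bar> - \<bar>x\<bar>\<bar> < r\<rbrakk> \<Longrightarrow>
     ennreal (c * (r / (\<bar>x\<bar> + r)) powr (2 * \<alpha> + 1)) \<le> emeasure (ang \<alpha>) {t. rad x y t < 3 * r}"
    and r: "0 < r"
  shows "(\<integral>\<^sup>+z. ennreal (\<bar>modT \<alpha> \<rho> f z - center x r\<bar> * cw \<alpha> x r z) \<partial>mu_alpha \<alpha>)
    \<le> ennreal ((Cloc c + 16 * A_alpha \<alpha> * ((5 + Cd) * C0)) * r powr d_alpha \<alpha> * N) * (ennreal (\<phi> r) * near r + ennreal r * far r)"
proof -
  let ?g = "\<lambda>z. \<bar>modT \<alpha> \<rho> f z - center x r\<bar>"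
  have A: "0 < A_alpha \<alpha>" by (rule A_alpha_pos[OF alpha])
  have CL: "0 < Cloc c" by (rule Cloc_pos[OF c])
  let ?I = "\<lambda>z. indicator {z. \<bar>\<bar>z\<bar> - \<bar>x\<bar>\<bar> < r} z :: ennreal"
  have [measurable]: "{y. \<bar>\<bar>y\<bar> - \<bar>x\<bar>\<bar> < r} \<in> sets borel" by measurable
  have xr: "0 < \<bar>x\<bar> + r" using r by simp
  define q where "q = (r / (\<bar>x\<bar> + r)) powr (2 * \<alpha> + 1)"
  define Q where "Q = (5 + Cd) * C0 * N"
  have q: "0 \<le> q" and Q: "0 \<le> Q" using Cd C0_pos N by (auto simp: q_def Q_def)
  have "ennreal (?g z * cw \<alpha> x r z) \<le> ennreal q * (?I z * loc r z + ennreal (4 * Q * r) * far r * ?I z)" for z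
  proof (cases "\<bar>\<bar>z\<bar> - \<bar>x\<bar>\<bar> < r")
    case zx: True
    define s where "s = (if 0 \<le> x * z then 1 else r / (\<bar>x\<bar> + r))"
    define D where "D = (if 0 \<le> x * z then r else 2 * (\<bar>x\<bar> + r))"
    have s: "0 \<le> s" "s \<le> 1" using r xr by (auto simp: s_def)
    \<comment> \<open>On the opposite side the large distance 2 (|x| + r) meets the damping r / (|x|
      + r), and the product is 2 r, independent of x.\<close>
    have "r / X * (2 * X) = 2 * r" if "0 < X" for X using that by simp
    from this[OF xr] have sD: "s * D \<le> 2 * r" using r unfolding s_def D_def by simp
    have D: "r \<le> D" "\<bar>z - x\<bar> \<le> D"
    proof -
      show "r \<le> D" using r by (auto simp: D_def)
      show "\<bar>z - x\<bar> \<le> D"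
      proof (cases "0 \<le> x * z")
        case True
        then have "\<bar>z - x\<bar> = \<bar>\<bar>z\<bar> - \<bar>x\<bar>\<bar>" by (auto simp: zero_le_mult_iff)
        then show ?thesis using True zx by (simp add: D_def)
      next
        case False
        have "\<bar>z\<bar> \<le> \<bar>x\<bar> + r" using zx by (simp add: abs_less_iff)
        then have "\<bar>z - x\<bar> \<le> 2 * (\<bar>x\<bar> + r)" using r abs_triangle_ineq4[of z x] by (simp add: distrib_left)
        then show ?thesis using False by (simp add: D_def)
      qed
    qed
    have "ennreal (?g z * cw \<alpha> x r z) = ennreal q * (ennreal s * ennreal (?g z))"
    proof -
      have cw: "cw \<alpha> x r z = q * s" using zx by (simp add: cw_def q_def s_def)
      show ?thesis unfolding cw using q s by (simp add: ennreal_mult[symmetric] mult_ac)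
    qed
    also have "\<dots> \<le> ennreal q * (ennreal s * (loc r z + ennreal (2 * ((5 + Cd) * D * C0 * N)) * far r))"
      by (intro mult_left_mono modT_minus_center[OF fin r D]) auto
    also have "\<dots> \<le> ennreal q * (1 * loc r z + ennreal (4 * Q * r) * far r)"
    proof (rule mult_left_mono)
      have "ennreal s * (ennreal (2 * ((5 + Cd) * D * C0 * N)) * far r) = ennreal (2 * Q * (s * D)) * far r"
      proof -
        have e: "2 * Q * (s * D) = s * (2 * ((5 + Cd) * D * C0 * N))" by (simp add: Q_def mult_ac)
        show ?thesis unfolding e ennreal_mult'[OF s(1)] by (rule mult.assoc[symmetric])
      qed
      also have "\<dots> \<le> ennreal (4 * Q * r) * far r"
        using mult_left_mono[OF sD, of "2 * Q"] Q by (intro mult_right_mono ennreal_leI) auto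
      finally have "ennreal s * (ennreal (2 * ((5 + Cd) * D * C0 * N)) * far r) \<le> ennreal (4 * Q * r) * far r" .
      moreover have "ennreal s * loc r z \<le> 1 * loc r z" using s by (intro mult_right_mono) auto
      ultimately show "ennreal s * (loc r z + ennreal (2 * ((5 + Cd) * D * C0 * N)) * far r) \<le> 1 * loc r z + ennreal (4 * Q * r) * far r"
        unfolding distrib_left by (intro add_mono)
    qed simp
    finally show ?thesis using zx by simp
  qed (simp add: cw_def)
  then have "(\<integral>\<^sup>+z. ennreal (?g z * cw \<alpha> x r z) \<partial>mu_alpha \<alpha>)
     \<le> (\<integral>\<^sup>+z. ennreal q * (?I z * loc r z + ennreal (4 * Q * r) * far r * ?I z) \<partial>mu_alpha \<alpha>)"
    by (rule nn_integral_mono)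
  also have "\<dots> = ennreal q * ((\<integral>\<^sup>+z. ?I z * loc r z \<partial>mu_alpha \<alpha>) + ennreal (4 * Q * r) * far r * emeasure (mu_alpha \<alpha>) {z. \<bar>\<bar>z\<bar> - \<bar>x\<bar>\<bar> < r})"
    by (subst nn_integral_cmult, measurable, subst nn_integral_add, measurable, subst nn_integral_cmult_indicator) auto
  also have "\<dots> \<le> ennreal q * (ennreal (Cloc c * (\<phi> r * r * (\<bar>x\<bar> + r) powr (2 * \<alpha> + 1)) * N) * near r
      + ennreal (4 * Q * r) * far r * ennreal (4 * A_alpha \<alpha> * (r * (\<bar>x\<bar> + r) powr (2 * \<alpha> + 1))))"
    by (intro mult_left_mono add_mono loc_bound[OF c low r] emeasure_mu_alpha_annulus[OF alpha r]) auto
  also have "\<dots> = ennreal (q * (Cloc c * (\<phi> r * r * (\<bar>x\<bar> + r) powr (2 * \<alpha> + 1)) * N)) * near r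
      + ennreal (q * (4 * Q * r * (4 * A_alpha \<alpha> * (r * (\<bar>x\<bar> + r) powr (2 * \<alpha> + 1))))) * far r"
    using q Q CL phi_pos[OF r] A N r by (simp add: ennreal_mult distrib_left mult_ac)
  also have "\<dots> = ennreal (Cloc c * r powr d_alpha \<alpha> * N * \<phi> r) * near r + ennreal (16 * A_alpha \<alpha> * ((5 + Cd) * C0) * r powr d_alpha \<alpha> * N * r) * far r"
  proof -
    \<comment> \<open>The normalisation in exact form: q times (|x| + r) powr (2 \<alpha> + 1) times
      r is r powr d.\<close>
    have "r powr d_alpha \<alpha> = r powr (2 * \<alpha> + 1) * r"
      using r powr_add[of r "2 * \<alpha> + 1" 1] by (simp add: d_alpha_def add.commute)
    also have "r powr (2 * \<alpha> + 1) = q * (\<bar>x\<bar> + r) powr (2 * \<alpha> + 1)" using r xr by (simp add: q_def powr_divide)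
    finally have e: "r powr d_alpha \<alpha> = q * (\<bar>x\<bar> + r) powr (2 * \<alpha> + 1) * r" .
    have "q * (Cloc c * (\<phi> r * r * (\<bar>x\<bar> + r) powr (2 * \<alpha> + 1)) * N) = Cloc c * r powr d_alpha \<alpha> * N * \<phi> r"
      "q * (4 * Q * r * (4 * A_alpha \<alpha> * (r * (\<bar>x\<bar> + r) powr (2 * \<alpha> + 1)))) = 16 * A_alpha \<alpha> * ((5 + Cd) * C0) * r powr d_alpha \<alpha> * N * r"
      unfolding e Q_def by (simp_all add: mult_ac)
    then show ?thesis by (simp only:)
  qed
  also have "\<dots>
    \<le> ennreal ((Cloc c + 16 * A_alpha \<alpha> * ((5 + Cd) * C0)) * r powr d_alpha \<alpha> * N) * (ennreal (\<phi> r) * near r + ennreal r * far r)"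
  proof -
    let ?M = "(Cloc c + 16 * A_alpha \<alpha> * ((5 + Cd) * C0)) * r powr d_alpha \<alpha> * N"
    have E: "0 \<le> 16 * A_alpha \<alpha> * ((5 + Cd) * C0)" using A Cd C0_pos by simp
    have M: "0 \<le> ?M" using CL N E by (intro mult_nonneg_nonneg) auto
    have "ennreal (Cloc c * r powr d_alpha \<alpha> * N * \<phi> r) \<le> ennreal (?M * \<phi> r)"
      using phi_pos[OF r] E N by (intro ennreal_leI mult_right_mono) auto
    moreover have "ennreal (16 * A_alpha \<alpha> * ((5 + Cd) * C0) * r powr d_alpha \<alpha> * N * r) \<le> ennreal (?M * r)"
      using r CL N by (intro ennreal_leI mult_right_mono) auto
    ultimately have "ennreal (Cloc c * r powr d_alpha \<alpha> * N * \<phi> r) * near r + ennreal (16 * A_alpha \<alpha> * ((5 + Cd) * C0) * r powr d_alpha \<alpha> * N * r) * far r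
       \<le> ennreal (?M * \<phi> r) * near r + ennreal (?M * r) * far r"
      by (intro add_mono mult_right_mono) auto
    also have "\<dots> = ennreal ?M * (ennreal (\<phi> r) * near r + ennreal r * far r)"
      unfolding ennreal_mult'[OF M] by (simp only: distrib_left mult.assoc)
    finally show ?thesis .
  qed
  finally show ?thesis .
qed

end

section \<open>Boundedness\<close>

text \<open>The mean is within the average deviation from c of any constant c, so replacing c by the
  mean at most doubles the deviation. Integrability of h on B follows from the same bound, since B
  has finite measure.\<close>

lemma mean_oscillation:
  fixes h :: "'a \<Rightarrow> real"
  assumes h [measurable]: "h \<in> borel_measurable M" and B [measurable]: "B \<in> sets M" and fin: "emeasure M B < \<infinity>"
    and pos: "0 < measure M B" and b: "(\<integral>\<^sup>+y. indicator B y * ennreal \<bar>h y - c\<bar> \<partial>M) \<le> ennreal k" and k: "0 \<le> k"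
  shows "set_integrable M B h"
    and "(LINT y:B|M. \<bar>h y - 1 / measure M B * (LINT y:B|M. h y)\<bar>) \<le> 2 * k"
proof -
  define e where "e = 1 / measure M B * (LINT y:B|M. h y)"
  have const: "set_integrable M B (\<lambda>_. v)" for v :: real
    using fin unfolding set_integrable_def by (intro integrable_scaleR_left) (simp add: top.not_eq_extremum)
  have cint: "(LINT y:B|M. v) = measure M B * v" for v :: real
    using fin by (simp add: set_lebesgue_integral_def top.not_eq_extremum)
  have nn: "(\<integral>\<^sup>+y. ennreal (indicator B y * \<bar>h y - c\<bar>) \<partial>M) \<le> ennreal k"
    using b by (simp add: ennreal_mult ennreal_indicator)
  have i: "integrable M (\<lambda>y. indicator B y * \<bar>h y - c\<bar>)"
    using nn by (intro integrableI_nonneg) (auto simp: less_top[symmetric] top_unique)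
  then have si: "set_integrable M B (\<lambda>y. \<bar>h y - c\<bar>)" by (simp add: set_integrable_def)
  have d: "set_integrable M B (\<lambda>y. h y - c)"
    unfolding set_integrable_def
    by (rule Bochner_Integration.integrable_bound[OF i]) (auto simp: abs_mult)
  show hi: "set_integrable M B h" using set_integral_add(1)[OF d const[of c]] by simp
  have I: "(LINT y:B|M. \<bar>h y - c\<bar>) \<le> k"
  proof -
    have "ennreal (LINT y:B|M. \<bar>h y - c\<bar>) = (\<integral>\<^sup>+y. ennreal (indicator B y * \<bar>h y - c\<bar>) \<partial>M)"
      using nn_integral_eq_integral[OF i] by (simp add: set_lebesgue_integral_def)
    then show ?thesis using nn k by (metis ennreal_le_iff)
  qed
  have hc: "(LINT y:B|M. h y - c) = (LINT y:B|M. h y) - measure M B * c"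
    using set_integral_diff(2)[OF hi const[of c]] by (simp add: cint)
  have "measure M B * \<bar>c - e\<bar> = \<bar>LINT y:B|M. h y - c\<bar>"
  proof -
    have "measure M B * (c - e) = - (LINT y:B|M. h y - c)" unfolding hc e_def using pos by (simp add: algebra_simps)
    then have "\<bar>measure M B * (c - e)\<bar> = \<bar>LINT y:B|M. h y - c\<bar>" by simp
    then show ?thesis using pos by (simp add: abs_mult)
  qed
  also have "\<dots> \<le> (LINT y:B|M. \<bar>h y - c\<bar>)" using set_integral_norm_bound[OF d] by simp
  finally have ce: "measure M B * \<bar>c - e\<bar> \<le> k" using I by simp
  have "(LINT y:B|M. \<bar>h y - e\<bar>) \<le> (LINT y:B|M. \<bar>h y - c\<bar> + \<bar>c - e\<bar>)"
  proof (rule set_integral_mono)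
    show "set_integrable M B (\<lambda>y. \<bar>h y - e\<bar>)"
      using set_integrable_norm[OF set_integral_diff(1)[OF hi const[of e]]] by simp
    show "set_integrable M B (\<lambda>y. \<bar>h y - c\<bar> + \<bar>c - e\<bar>)" by (rule set_integral_add(1)[OF si const])
  qed auto
  also have "\<dots> = (LINT y:B|M. \<bar>h y - c\<bar>) + measure M B * \<bar>c - e\<bar>"
    using set_integral_add(2)[OF si const[of "\<bar>c - e\<bar>"]] by (simp add: cint)
  also have "\<dots> \<le> 2 * k" using I ce by simp
  finally show "(LINT y:B|M. \<bar>h y - 1 / measure M B * (LINT y:B|M. h y)\<bar>) \<le> 2 * k" unfolding e_def .
qed

lemma morrey1_norm_bound:
  assumes f: "f \<in> morrey1_space \<alpha> \<phi>" and phi: "\<And>r. 0 < r \<Longrightarrow> 0 < \<phi> r"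
  shows "0 \<le> morrey1_norm \<alpha> \<phi> f"
    and "0 < u \<Longrightarrow> (LINT y:{-u<..<u}|mu_alpha \<alpha>. dunkl_trans \<alpha> x (\<lambda>z. \<bar>f z\<bar>) y) \<le> \<phi> u * u powr d_alpha \<alpha> * morrey1_norm \<alpha> \<phi> f"
proof -
  have up: "morrey1_quant \<alpha> \<phi> f u x \<le> morrey1_norm \<alpha> \<phi> f" if "0 < u" for u x
    unfolding morrey1_norm_def using f that by (intro cSup_upper) (auto simp: morrey1_space_def)
  show "(LINT y:{-u<..<u}|mu_alpha \<alpha>. dunkl_trans \<alpha> x (\<lambda>z. \<bar>f z\<bar>) y) \<le> \<phi> u * u powr d_alpha \<alpha> * morrey1_norm \<alpha> \<phi> f" if u: "0 < u"
  proof -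
    define m where "m = (LINT y:{-u<..<u}|mu_alpha \<alpha>. dunkl_trans \<alpha> x (\<lambda>z. \<bar>f z\<bar>) y)"
    have p: "0 < \<phi> u * u powr d_alpha \<alpha>" using phi[OF u] u by simp
    have "m / (\<phi> u * u powr d_alpha \<alpha>) \<le> morrey1_norm \<alpha> \<phi> f" using up[OF u, of x] by (simp add: morrey1_quant_def m_def)
    then show ?thesis unfolding m_def[symmetric] using p by (simp add: pos_divide_le_eq mult.commute)
  qed
  \<comment> \<open>The centre 0 is chosen because translation by 0 leaves |f| unchanged, so
    nonnegativity is immediate; one nonnegative member makes the supremum nonnegative.\<close>
  have "0 \<le> (LINT y:{-1<..<1}|mu_alpha \<alpha>. dunkl_trans \<alpha> 0 (\<lambda>z. \<bar>f z\<bar>) y)"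
    unfolding set_lebesgue_integral_def by (intro integral_nonneg_AE AE_I2) (auto simp: dunkl_trans_def)
  then have "0 \<le> morrey1_quant \<alpha> \<phi> f 1 0" using phi[of 1] by (simp add: morrey1_quant_def)
  also have "\<dots> \<le> morrey1_norm \<alpha> \<phi> f" by (rule up) simp
  finally show "0 \<le> morrey1_norm \<alpha> \<phi> f" .
qed

lemma doubling_upper:
  assumes "doubling \<theta>" and pos: "\<forall>r>0. 0 < \<theta> r"
  obtains C where "\<And>r s. \<lbrakk>0 < r; 0 < s; r \<le> 2 * s; s \<le> 2 * r\<rbrakk> \<Longrightarrow> \<theta> r \<le> C * \<theta> s"
proof -
  obtain C where C: "\<And>r s. \<lbrakk>0 < r; 0 < s; 1/2 \<le> r / s; r / s \<le> 2\<rbrakk> \<Longrightarrow> \<theta> r / \<theta> s \<le> C"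
    using assms(1) unfolding doubling_def by blast
  show ?thesis
  proof (rule that)
    fix r s :: real assume "0 < r" "0 < s" "r \<le> 2 * s" "s \<le> 2 * r"
    then have "\<theta> r / \<theta> s \<le> C" by (intro C) (auto simp: divide_simps)
    then show "\<theta> r \<le> C * \<theta> s" using pos \<open>0 < s\<close> by (simp add: pos_divide_le_eq)
  qed
qed

text \<open>The ball has measure at least a multiple of r powr d, which absorbs that factor; the 2
  is the cost of passing to the mean.\<close>

lemma campanato1_bounded:
  fixes g :: "real \<Rightarrow> real"
  assumes a: "-1/2 \<le> \<alpha>" and psi: "\<And>r. 0 < r \<Longrightarrow> 0 < \<psi> r" and g: "g \<in> borel_measurable borel" and C: "0 \<le> C"
    and osc: "\<And>x r. 0 < r \<Longrightarrow> \<exists>c. (\<integral>\<^sup>+y. indicator {-r<..<r} y * ennreal \<bar>dunkl_trans \<alpha> x g y - c\<bar> \<partial>mu_alpha \<alpha>) \<le> ennreal (C * r powr d_alpha \<alpha> * \<psi> r)"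
  shows "g \<in> campanato1_space \<alpha> \<psi>"
    and "campanato1_norm \<alpha> \<psi> g \<le> 2 * C / (A_alpha \<alpha> * 2 powr (- d_alpha \<alpha>))"
proof -
  define b where "b = A_alpha \<alpha> * 2 powr (- d_alpha \<alpha>)"
  have b: "0 < b" using A_alpha_pos[OF a] by (simp add: b_def)
  have main: "set_integrable (mu_alpha \<alpha>) {-r<..<r} (dunkl_trans \<alpha> x g)"
    "campanato1_quant \<alpha> \<psi> g r x \<le> 2 * C / b" if r: "0 < r" for r x
  proof -
    define m where "m = measure (mu_alpha \<alpha>) {-r<..<r}"
    have fin: "emeasure (mu_alpha \<alpha>) {-r<..<r} < \<infinity>" and mb: "b * r powr d_alpha \<alpha> \<le> m"
      using emeasure_mu_alpha_ball[OF a r] unfolding b_def m_def by auto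
    have rd: "0 < b * r powr d_alpha \<alpha>" using b r by simp
    then have m: "0 < m" using mb by simp
    obtain c where c: "(\<integral>\<^sup>+y. indicator {-r<..<r} y * ennreal \<bar>dunkl_trans \<alpha> x g y - c\<bar> \<partial>mu_alpha \<alpha>) \<le> ennreal (C * r powr d_alpha \<alpha> * \<psi> r)"
      using osc[OF r] by blast
    have k: "0 \<le> C * r powr d_alpha \<alpha> * \<psi> r" using C psi[OF r] by simp
    have hm: "dunkl_trans \<alpha> x g \<in> borel_measurable (mu_alpha \<alpha>)" using measurable_dunkl_trans[OF g] by simp
    have B: "{-r<..<r} \<in> sets (mu_alpha \<alpha>)" by simp
    note mo = mean_oscillation[OF hm B fin m[unfolded m_def] c k]
    show "set_integrable (mu_alpha \<alpha>) {-r<..<r} (dunkl_trans \<alpha> x g)" by (rule mo(1))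
    have "campanato1_quant \<alpha> \<psi> g r x \<le> 1 / \<psi> r * (1 / m * (2 * (C * r powr d_alpha \<alpha> * \<psi> r)))"
      unfolding campanato1_quant_def ball_avg_dk_def m_def
      using psi[OF r] by (intro mult_left_mono mo(2)) auto
    also have "\<dots> = 2 * C * r powr d_alpha \<alpha> / m" using psi[OF r] by simp
    also have "\<dots> \<le> 2 * C * r powr d_alpha \<alpha> / (b * r powr d_alpha \<alpha>)"
      using b mb rd m C by (intro divide_left_mono mult_pos_pos) auto
    also have "\<dots> = 2 * C / b" using r by simp
    finally show "campanato1_quant \<alpha> \<psi> g r x \<le> 2 * C / b" .
  qed
  have "set_integrable (mu_alpha \<alpha>) {-r<..<r} g" if "0 < r" for r
  proof -
    \<comment> \<open>Local integrability of g is the case x = 0 of the integrability of its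
      translates.\<close>
    have "dunkl_trans \<alpha> 0 g = g" by (auto simp: dunkl_trans_def)
    then show ?thesis using main(1)[OF that, of 0] by simp
  qed
  moreover have "bdd_above {campanato1_quant \<alpha> \<psi> g r x | r x. r > 0}"
    by (rule bdd_aboveI[of _ "2 * C / b"]) (use main(2) in auto)
  ultimately show "g \<in> campanato1_space \<alpha> \<psi>" by (simp add: campanato1_space_def loc_integrable_dk_def)
  have "campanato1_norm \<alpha> \<psi> g \<le> 2 * C / b"
    unfolding campanato1_norm_def
  proof (rule cSup_least)
    have "campanato1_quant \<alpha> \<psi> g 1 0 \<in> {campanato1_quant \<alpha> \<psi> g r x | r x. r > 0}"
      by (intro CollectI exI[of _ "1::real"] exI[of _ "0::real"]) simp
    then show "{campanato1_quant \<alpha> \<psi> g r x | r x. r > 0} \<noteq> {}" by blast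
  qed (use main(2) in auto)
  then show "campanato1_norm \<alpha> \<psi> g \<le> 2 * C / (A_alpha \<alpha> * 2 powr (- d_alpha \<alpha>))" unfolding b_def .
qed

theorem theorem3p2:
  fixes \<alpha> :: real and \<phi> \<psi> \<rho> :: "real \<Rightarrow> real"
  assumes alpha: "\<alpha> \<ge> -1/2"
    and phi_pos: "\<forall>r>0. \<phi> r > 0" and psi_pos: "\<forall>r>0. \<psi> r > 0"
    and phi_doub: "doubling \<phi>" and psi_doub: "doubling \<psi>"
    and phi_ai: "almost_increasing (\<lambda>r. \<phi> r * r powr d_alpha \<alpha>)"
    and psi_ai: "almost_increasing (\<lambda>r. \<psi> r * r powr d_alpha \<alpha>)"
    and rho_pos: "\<forall>r>0. \<rho> r > 0"
    and rho_meas: "set_borel_measurable lborel {0<..} \<rho>"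
    and phi_meas: "set_borel_measurable lborel {0<..} \<phi>"
    and rho_a: "(\<integral>\<^sup>+ t\<in>{0<..<1}. ennreal (\<rho> t / t) \<partial>lborel) < \<infinity>"
    and rho_b: "doubling \<rho>"
    and rho_c: "\<exists>C1'>0. \<forall>r>0.
        (\<integral>\<^sup>+ t\<in>{r<..}. ennreal (\<rho> t / t^2) \<partial>lborel) \<le> ennreal (C1' * \<rho> r / r)"
    and rho_d: "\<exists>C1''>0. \<forall>r>0. \<forall>s>0. 1/2 \<le> r / s \<and> r / s \<le> 2 \<longrightarrow>
        \<bar>\<rho> r / r powr d_alpha \<alpha> - \<rho> s / s powr d_alpha \<alpha>\<bar>
          \<le> C1'' * \<bar>r - s\<bar> * \<rho> s / s powr (d_alpha \<alpha> + 1)"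
    and main: "\<exists>C>0. \<forall>r>0.
        ennreal (\<phi> r) * (\<integral>\<^sup>+ t\<in>{0<..<r}. ennreal (\<rho> t / t) \<partial>lborel)
        + ennreal r * (\<integral>\<^sup>+ t\<in>{r<..}. ennreal (\<rho> t * \<phi> t / t^2) \<partial>lborel)
          \<le> ennreal (C * \<psi> r)"
  shows "\<exists>C>0. \<forall>f \<in> morrey1_space \<alpha> \<phi>.
           modT \<alpha> \<rho> f \<in> campanato1_space \<alpha> \<psi> \<and>
           campanato1_norm \<alpha> \<psi> (modT \<alpha> \<rho> f) \<le> C * morrey1_norm \<alpha> \<phi> f"
proof -
  \<comment> \<open>Measurability is assumed only on the positive half-line; cutting off there gives
    Borel functions with the same values at positive arguments.\<close>
  define \<rho>' \<phi>' where "\<rho>' t = indicator {0<..} t * \<rho> t" and "\<phi>' t = indicator {0<..} t * \<phi> t" for t :: real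
  have pos_eq: "\<rho>' t = \<rho> t" "\<phi>' t = \<phi> t" if "0 < t" for t using that by (simp_all add: \<rho>'_def \<phi>'_def)
  note phi_pos' = phi_pos[rule_format]
  obtain C\<phi> where C\<phi>: "\<And>r s. \<lbrakk>0 < r; 0 < s; r \<le> 2 * s; s \<le> 2 * r\<rbrakk> \<Longrightarrow> \<phi> r \<le> C\<phi> * \<phi> s"
    using doubling_upper[OF phi_doub phi_pos] by blast
  obtain C\<rho> where C\<rho>: "\<And>r s. \<lbrakk>0 < r; 0 < s; r \<le> 2 * s; s \<le> 2 * r\<rbrakk> \<Longrightarrow> \<rho> r \<le> C\<rho> * \<rho> s"
    using doubling_upper[OF rho_b rho_pos] by blast
  obtain Cd where Cd0: "0 < Cd" and Cd: "\<And>r s. \<lbrakk>0 < r; 0 < s; 1/2 \<le> r / s; r / s \<le> 2\<rbrakk> \<Longrightarrow>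
        \<bar>\<rho> r / r powr d_alpha \<alpha> - \<rho> s / s powr d_alpha \<alpha>\<bar> \<le> Cd * \<bar>r - s\<bar> * \<rho> s / s powr (d_alpha \<alpha> + 1)"
    using rho_d by blast
  obtain Cm where Cm: "0 < Cm" and dom: "\<And>r. 0 < r \<Longrightarrow>
        ennreal (\<phi> r) * (\<integral>\<^sup>+ t\<in>{0<..<r}. ennreal (\<rho> t / t) \<partial>lborel)
        + ennreal r * (\<integral>\<^sup>+ t\<in>{r<..}. ennreal (\<rho> t * \<phi> t / t^2) \<partial>lborel) \<le> ennreal (Cm * \<psi> r)"
    using main by blast
  interpret riesz_setup \<alpha> \<phi>' \<rho>' C\<phi> C\<rho> Cd
  proof
    show "\<rho>' \<in> borel_measurable borel" "\<phi>' \<in> borel_measurable borel"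
      using rho_meas phi_meas unfolding set_borel_measurable_def \<rho>'_def[abs_def] \<phi>'_def[abs_def] by simp_all
    show "\<bar>\<rho>' r / r powr d_alpha \<alpha> - \<rho>' s / s powr d_alpha \<alpha>\<bar> \<le> Cd * \<bar>r - s\<bar> * \<rho>' s / s powr (d_alpha \<alpha> + 1)"
      if "0 < r" "0 < s" "r \<le> 2 * s" "s \<le> 2 * r" for r s
      using Cd[of r s] that by (simp add: pos_eq divide_simps)
  qed (use alpha phi_pos rho_pos C\<phi> C\<rho> Cd0 in \<open>auto simp: pos_eq\<close>)
  have near: "near r = (\<integral>\<^sup>+ t\<in>{0<..<r}. ennreal (\<rho> t / t) \<partial>lborel)" for r
    unfolding near_def by (intro nn_integral_cong) (auto simp: pos_eq split: split_indicator)
  have far: "far r = (\<integral>\<^sup>+ t\<in>{r<..}. ennreal (\<rho> t * \<phi> t / t^2) \<partial>lborel)" if "0 < r" for r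
    unfolding far_def using that by (intro nn_integral_cong) (auto simp: pos_eq split: split_indicator)
  have dom': "ennreal (\<phi>' r) * near r + ennreal r * far r \<le> ennreal (Cm * \<psi> r)" if "0 < r" for r
    using dom[OF that] by (simp add: near far that pos_eq)
  \<comment> \<open>Convergence of the tail comes from the domination condition: its right side is
    finite and its second summand carries the factor r > 0.\<close>
  have fin: "far r < \<infinity>" if r: "0 < r" for r
  proof -
    have "ennreal r * far r \<le> ennreal (Cm * \<psi> r)" by (rule order_trans[OF _ dom'[OF r]]) simp
    also have "\<dots> < \<infinity>" by simp
    finally show ?thesis using r by (auto simp: ennreal_mult_less_top)
  qed
  have T: "modT \<alpha> \<rho> = modT \<alpha> \<rho>'"
  proof -
    \<comment> \<open>At z = 0 the functions may differ, but the denominator is 0 powr d = 0 and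
      both quotients are 0.\<close>
    have e: "\<rho>' \<bar>z\<bar> / \<bar>z\<bar> powr d_alpha \<alpha> = \<rho> \<bar>z\<bar> / \<bar>z\<bar> powr d_alpha \<alpha>" for z by (cases "z = 0") (simp_all add: pos_eq)
    show ?thesis by (simp only: modT_def[abs_def] e)
  qed
  obtain c where c: "0 < c" and low: "\<And>x y r. \<lbrakk>0 < r; x * y \<le> 0; \<bar>\<bar>y\<bar> - \<bar>x\<bar>\<bar> < r\<rbrakk> \<Longrightarrow>
     ennreal (c * (r / (\<bar>x\<bar> + r)) powr (2 * \<alpha> + 1)) \<le> emeasure (ang \<alpha>) {t. rad x y t < 3 * r}"
    using ang_rad_lower[OF alpha] by blast
  obtain C3 where C3: "0 < C3" and tr: "\<And>g x c r. \<lbrakk>g \<in> borel_measurable borel; 0 < r\<rbrakk> \<Longrightarrow>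
    (\<integral>\<^sup>+y. indicator {-r<..<r} y * ennreal \<bar>dunkl_trans \<alpha> x g y - c\<bar> \<partial>mu_alpha \<alpha>)
      \<le> ennreal C3 * (\<integral>\<^sup>+z. ennreal (\<bar>g z - c\<bar> * cw \<alpha> x r z) \<partial>mu_alpha \<alpha>)"
    using dunkl_trans_oscillation[OF alpha] by blast
  have A: "0 < A_alpha \<alpha>" by (rule A_alpha_pos[OF alpha])
  define M where "M = Cloc c + 16 * A_alpha \<alpha> * ((5 + Cd) * C0)"
  have M: "0 < M" using Cloc_pos[OF c] A C0_pos Cd0 by (simp add: M_def add_pos_nonneg)
  \<comment> \<open>C3 comes from the translation, M from the operator and Cm from the domination
    condition; the remaining factor is the passage to the mean and to the measure of the
    ball.\<close>
  define C where "C = 2 * (C3 * M * Cm) / (A_alpha \<alpha> * 2 powr (- d_alpha \<alpha>))"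
  have "modT \<alpha> \<rho> f \<in> campanato1_space \<alpha> \<psi> \<and> campanato1_norm \<alpha> \<psi> (modT \<alpha> \<rho> f) \<le> C * morrey1_norm \<alpha> \<phi> f"
    if f: "f \<in> morrey1_space \<alpha> \<phi>" for f
  proof -
    define N where "N = morrey1_norm \<alpha> \<phi> f"
    have loc: "loc_integrable_dk \<alpha> f" using f by (simp add: morrey1_space_def)
    have N0: "0 \<le> N" unfolding N_def by (rule morrey1_norm_bound(1)[OF f]) (rule phi_pos')
    have mb: "(LINT y:{-u<..<u}|mu_alpha \<alpha>. dunkl_trans \<alpha> x (\<lambda>z. \<bar>f z\<bar>) y) \<le> \<phi> u * u powr d_alpha \<alpha> * N" if "0 < u" for u x
      unfolding N_def by (rule morrey1_norm_bound(2)[OF f]) (use phi_pos' that in auto)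
    interpret morrey_function \<alpha> \<phi>' \<rho>' C\<phi> C\<rho> Cd f N
    proof
      show "f \<in> borel_measurable borel" by (rule loc_integrable_nn_finite(1)[OF loc])
      show "0 \<le> N" by (rule N0)
      fix x u :: real assume u: "0 < u"
      \<comment> \<open>Duality reverses the sign of the centre; the Morrey norm takes a supremum
        over all centres, so -x serves as well.\<close>
      have "(\<integral>\<^sup>+z. ennreal \<bar>f z\<bar> * emeasure (ang \<alpha>) {t. rad x z t < u} \<partial>mu_alpha \<alpha>)
        = ennreal (LINT y:{-u<..<u}|mu_alpha \<alpha>. dunkl_trans \<alpha> (-x) (\<lambda>z. \<bar>f z\<bar>) y)"
        using nn_integral_morrey[OF alpha loc u, of "-x"] by simp
      also have "\<dots> \<le> ennreal (\<phi>' u * u powr d_alpha \<alpha> * N)"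
        using mb[OF u] by (intro ennreal_leI) (simp add: pos_eq u)
      finally show "(\<integral>\<^sup>+z. ennreal \<bar>f z\<bar> * emeasure (ang \<alpha>) {t. rad x z t < u} \<partial>mu_alpha \<alpha>) \<le> ennreal (\<phi>' u * u powr d_alpha \<alpha> * N)" .
    qed
    have g: "modT \<alpha> \<rho> f \<in> borel_measurable borel" unfolding T by (rule measurable_modT[OF f_meas])
    have osc: "\<exists>v. (\<integral>\<^sup>+y. indicator {-r<..<r} y * ennreal \<bar>dunkl_trans \<alpha> x (modT \<alpha> \<rho> f) y - v\<bar> \<partial>mu_alpha \<alpha>)
        \<le> ennreal (C3 * M * Cm * N * r powr d_alpha \<alpha> * \<psi> r)" if r: "0 < r" for x r
    proof -
      have "(\<integral>\<^sup>+y. indicator {-r<..<r} y * ennreal \<bar>dunkl_trans \<alpha> x (modT \<alpha> \<rho> f) y - center x r\<bar> \<partial>mu_alpha \<alpha>)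
        \<le> ennreal C3 * (\<integral>\<^sup>+z. ennreal (\<bar>modT \<alpha> \<rho>' f z - center x r\<bar> * cw \<alpha> x r z) \<partial>mu_alpha \<alpha>)"
        using tr[OF g r] unfolding T .
      also have "\<dots> \<le> ennreal C3 * (ennreal (M * r powr d_alpha \<alpha> * N) * (ennreal (\<phi>' r) * near r + ennreal r * far r))"
        unfolding M_def by (intro mult_left_mono oscillation_bound[OF fin c low r]) auto
      also have "\<dots> \<le> ennreal C3 * (ennreal (M * r powr d_alpha \<alpha> * N) * ennreal (Cm * \<psi> r))"
        by (intro mult_left_mono dom'[OF r]) auto
      also have "\<dots> = ennreal (C3 * (M * r powr d_alpha \<alpha> * N * (Cm * \<psi> r)))"
        using C3 M N0 Cm psi_pos r by (simp add: ennreal_mult[symmetric] less_imp_le)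
      also have "C3 * (M * r powr d_alpha \<alpha> * N * (Cm * \<psi> r)) = C3 * M * Cm * N * r powr d_alpha \<alpha> * \<psi> r"
        by (simp add: mult_ac)
      finally show ?thesis by (rule exI)
    qed
    have nn: "0 \<le> C3 * M * Cm * N" using C3 M Cm N0 by simp
    have "2 * (C3 * M * Cm * N) / (A_alpha \<alpha> * 2 powr (- d_alpha \<alpha>)) = C * N" by (simp add: C_def)
    then show ?thesis
      using campanato1_bounded[OF alpha psi_pos[rule_format] g nn osc] unfolding N_def by simp
  qed
  moreover have "0 < C" using C3 M Cm A by (simp add: C_def)
  ultimately show ?thesis by blast
qed

end
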